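(* Let $\alpha_{\mathbf P}\ge\alpha$. Let $\boldsymbol m_h^n\in\boldsymbol{\mathcal M}_h$ be given and let $\boldsymbol\mu_h\in\boldsymbol{\mathcal M}_h$ be arbitrary. Consider the preconditioned GMRES algorithm with the preconditioner $\mathbf P_{\mathbf Q}[\boldsymbol\mu_h]$ for the solution of $\mathbf P_{\mathbf Q}[\boldsymbol\mu_h]\mathbf A_{\mathbf Q}[\boldsymbol m_h^n]\mathbf x=\mathbf P_{\mathbf Q}[\boldsymbol\mu_h]\mathbf b_{\mathbf Q}[\boldsymbol m_h^n]$ with initial guess $\mathbf x^{(0)}\in\mathbb R^{2N}$. For $\ell\in\mathbb N_0$, let $\mathbf x^{(\ell)}\in\mathbb R^{2N}$ denote the GMRES iterates with residuals $\mathbf r^{(\ell)}:=\mathbf P_{\mathbf Q}[\boldsymbol\mu_h]\mathbf b_{\mathbf Q}[\boldsymbol m_h^n]-\mathbf P_{\mathbf Q}[\boldsymbol\mu_h]\mathbf A_{\mathbf Q}[\boldsymbol m_h^n]\mathbf x^{(\ell)}$. Then: (i) There exists a constant $C>1$, which depends only on $C_{\rm mesh}$, such that for all $\ell\in\mathbb N_0$ $$|||\mathbf r^{(\ell)}|||_{\boldsymbol\mu_h}\le\bigg[1-C^{-1}\Big(\frac{\alpha}{\alpha_{\mathbf P}}\Big)^2\bigg(1+\frac1{\alpha_{\mathbf P}}+\frac{\|W_k(\lambda_h^n)-\alpha_{\mathbf P}\|_{L^\infty(\Omega)}}{\alpha_{\mathbf P}}\bigg)^{-2}\mathbb F^{-4}\bigg]^{\ell/2}|||\mathbf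 r^{(0)}|||_{\boldsymbol\mu_h},\qquad(\ast)$$ where $$\mathbb F:=1+\frac{\beta(k)k}{\alpha_{\mathbf P}h^2}\max_{z\in\mathcal N_h}\big\|\mathbf H[\mathbf T_n\boldsymbol m_h^n(z)]-\mathbf H[\mathbf T_n\boldsymbol\mu_h(z)]\big\|^2\ge1.$$ (ii) If, additionally, $1+(\mathbf T_n\boldsymbol m_h^n(z))_3\ge\gamma>0$ and $1+(\mathbf T_n\boldsymbol\mu_h(z))_3\ge\gamma>0$ for all nodes $z\in\mathcal N_h$, then the statement of (i), i.e. $(\ast)$ for all $\ell\in\mathbb N_0$ with a constant $C>1$ depending only on $C_{\rm mesh}$, holds with the ($h$-independent) factor $$\begin{aligned}\mathbb F:=\;&1+\gamma^{-2}\|\boldsymbol m_h^n-\boldsymbol\mu_h\|_{L^\infty(\Omega)}^2+\frac{\beta(k)k}{\alpha_{\mathbf P}\gamma^2}\|\nabla\boldsymbol m_h^n-\nabla\boldsymbol\mu_h\|_{L^\infty(\Omega)}^2\\&+\frac{\beta(k)k}{\alpha_{\mathbf P}\gamma^6}\big(\|\nabla\boldsymbol m_h^n\|_{L^\infty(\Omega)}^2+\|\nabla\boldsymbol\mu_h\|_{L^\infty(\Omega)}^2\big)\|\boldsymbol m_h^n-\boldsymbol\mu_h\|_{L^\infty(\Omega)}^2\ge1.\end{aligned}$$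
   Context: Mesh and spaces: $\Omega\subset\mathbb R^3$ is a bounded Lipschitz domain, $\mathcal T_h$ a triangulation of $\Omega$ into tetrahedra which is $C_{\rm mesh}$-quasi-uniform with mesh-size $h>0$, i.e. $h\le|K|^{1/3}\le\operatorname{diam}(K)\le C_{\rm mesh}h$ for all $K\in\mathcal T_h$. $\mathcal S_h$ is the space of continuous functions on $\Omega$ that are affine on each element, $\mathcal N_h=\{z_1,\dots,z_N\}$ the set of nodes, $\varphi_j\in\mathcal S_h$ the hat functions, $\boldsymbol{\mathcal S}_h=(\mathcal S_h)^3$ with basis $\boldsymbol\phi_{3(j-1)+\ell}:=\varphi_j\mathbf e_\ell$ ($j=1,\dots,N$, $\ell=1,2,3$). $\boldsymbol{\mathcal M}_h:=\{\boldsymbol\varphi_h\in\boldsymbol{\mathcal S}_h:|\boldsymbol\varphi_h(z)|=1\ \forall z\in\mathcal N_h\}$. $\langle\cdot,\cdot\rangle_\Omega$ is the $L^2(\Omega)$-scalar product (also for vector- and matrix-valued functions); $L^\infty$-norms of vector/matrix-valued functions are taken with the pointwise Euclidean (Frobenius) norm; $\|\cdot\|$ of a matrix is the norm induced by the Euclidean norm. Data: $\alpha\in(0,1]$, $\ell_{\rm ex}>0$, $T>0$, time-step size $k=T/M$ with $M\in\mathbb N$, $t_n=kn$, $0\le n<M$; $\boldsymbol m_h^{n-1}\in\boldsymbol{\mathcal M}_h$. $\boldsymbol\pi:H^1(\Omega)^3\to L^2(\Omega)^3$ is a bounded operator, $\boldsymbol f\in C^1([0,T],L^2(\Omega)^3)$.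 $\beta:\mathbb R_{>0}\to\mathbb R_{>0}$ and the (bounded, measurable) functions $W_k:\mathbb R\to\mathbb R_{>0}$ satisfy $\lim_{k\to0}\|W_k-\alpha\|_{L^\infty(\mathbb R)}=0$, $\inf_{k>0}\inf_{s\in\mathbb R}W_k(s)\ge\alpha/2>0$, $\lim_{k\to0}\beta(k)k=0$. $\lambda_h^n:=-\ell_{\rm ex}^2|\nabla\boldsymbol m_h^n|^2+(\boldsymbol f(t_n)+\boldsymbol\pi(\boldsymbol m_h^n))\cdot\boldsymbol m_h^n$. $\boldsymbol L_h(\boldsymbol m_h^n,\boldsymbol m_h^{n-1})\in L^2(\Omega)^3$ is a given function. Matrices (in $\mathbb R^{3N\times3N}$): $\mathbf M_{ij}:=\langle\boldsymbol\phi_i,\boldsymbol\phi_j\rangle_\Omega$, $\mathbf M_k[\boldsymbol m_h^n]_{ij}:=\langle(W_k(\lambda_h^n)/\alpha)\boldsymbol\phi_i,\boldsymbol\phi_j\rangle_\Omega$, $\mathbf L_{ij}:=\langle\nabla\boldsymbol\phi_i,\nabla\boldsymbol\phi_j\rangle_\Omega$, $\mathbf S[\boldsymbol m_h^n]_{ij}:=\langle\boldsymbol m_h^n\times\boldsymbol\phi_i,\boldsymbol\phi_j\rangle_\Omega$, $\mathbf A_k[\boldsymbol m_h^n]:=\alpha\mathbf M_k[\boldsymbol m_h^n]+\beta(k)k\,\mathbf L-\mathbf S[\boldsymbol m_h^n]$; and $\mathbf b[\boldsymbol m_h^n]_j:=-\ell_{\rm ex}^2\langle\nabla\boldsymbol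 m_h^n,\nabla\boldsymbol\phi_j\rangle_\Omega+\langle\boldsymbol L_h(\boldsymbol m_h^n,\boldsymbol m_h^{n-1}),\boldsymbol\phi_j\rangle_\Omega$. Householder matrices: for $\mathbf m\in\mathbb R^3$ with $|\mathbf m|=1$, $\widetilde{\mathbf H}[\mathbf m]:=\mathbf I-2\mathbf w\mathbf w^T$ with $\mathbf w:=(\mathbf m+\mathbf e_3)/|\mathbf m+\mathbf e_3|$ if $\mathbf m\ne-\mathbf e_3$, and $\widetilde{\mathbf H}[-\mathbf e_3]:=[\mathbf e_1,\mathbf e_2,-\mathbf e_3]$; $\mathbf H[\mathbf m]:=[\widetilde{\mathbf H}[\mathbf m]\mathbf e_1,\widetilde{\mathbf H}[\mathbf m]\mathbf e_2]\in\mathbb R^{3\times2}$. $\mathbf T_n\in\mathbb R^{3\times3}$ is a fixed matrix with $\mathbf T_n=\mathbf T_n^{-1}=\mathbf T_n^T$. For $\boldsymbol\nu_h\in\boldsymbol{\mathcal M}_h$, $\mathbf Q[\boldsymbol\nu_h]\in\mathbb R^{3N\times2N}$ is block-diagonal with $i$-th diagonal block $\mathbf T_n\mathbf H[\mathbf T_n\boldsymbol\nu_h(z_i)]$. System and preconditioner: $\mathbf A_{\mathbf Q}[\boldsymbol m_h^n]:=\mathbf Q[\boldsymbol m_h^n]^T\mathbf A_k[\boldsymbol m_h^n]\mathbf Q[\boldsymbol m_h^n]$, $\mathbf b_{\mathbf Q}[\boldsymbol m_h^n]:=\mathbf Q[\boldsymbol m_h^n]^T\mathbf b[\boldsymbol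 m_h^n]$. With a parameter $\alpha_{\mathbf P}>0$, $\mathbf P_{\mathbf Q}[\boldsymbol\mu_h]:=\big(\mathbf Q[\boldsymbol\mu_h]^T(\alpha_{\mathbf P}\mathbf M+\beta(k)k\,\mathbf L)\mathbf Q[\boldsymbol\mu_h]\big)^{-1}\in\mathbb R^{2N\times2N}$, and $|||\mathbf x|||_{\boldsymbol\mu_h}^2:=\mathbf x\cdot(\mathbf P_{\mathbf Q}[\boldsymbol\mu_h])^{-1}\mathbf x$ for $\mathbf x\in\mathbb R^{2N}$. GMRES with symmetric positive definite preconditioner $\mathbf P$ for $\mathbf P\mathbf A\mathbf x=\mathbf P\mathbf b$ is understood with respect to the scalar product $\mathbf x\cdot\mathbf P^{-1}\mathbf y$: the iterate $\mathbf x^{(\ell)}$ minimizes $\mathbf x\mapsto|||\mathbf P\mathbf b-\mathbf P\mathbf A\mathbf x|||$, $|||\mathbf y|||^2=\mathbf y\cdot\mathbf P^{-1}\mathbf y$, over $\mathbf x^{(0)}+\operatorname{span}\{(\mathbf P\mathbf A)^j\mathbf r^{(0)}:0\le j\le\ell-1\}$, where $\mathbf r^{(0)}=\mathbf P\mathbf b-\mathbf P\mathbf A\mathbf x^{(0)}$. *)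

theory Defs
  imports
    "HOL-Analysis.Analysis"
    "HOL-Probability.Essential_Supremum"
    "Jordan_Normal_Form.Gauss_Jordan_Elimination"
    "Jordan_Normal_Form.VS_Connect"
begin

text \<open>Vectors and matrices of fixed size (points of space, function values, Jacobians, Householder
  blocks) are those of HOL-Analysis; the vectors and matrices whose size depends on the number of
  nodes are those of Jordan_Normal_Form, with indices starting at 0.\<close>

no_notation vec_index (infixl "$" 100)

type_synonym R3 = "real ^ 3"

section \<open>Function spaces\<close>

text \<open>A function on a domain is a total function of which only the values on that domain (for
  finite element functions: on its closure) matter.\<close>

definition L2_fun :: "R3 set \<Rightarrow> (R3 \<Rightarrow> 'b::euclidean_space) \<Rightarrow> bool" where
  "L2_fun \<Omega> u \<longleftrightarrow> u \<in> borel_measurable (lebesgue_on \<Omega>)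
     \<and> integrable (lebesgue_on \<Omega>) (\<lambda>x. (norm (u x))\<^sup>2)"

definition L2_inner :: "R3 set \<Rightarrow> (R3 \<Rightarrow> 'b::euclidean_space) \<Rightarrow> (R3 \<Rightarrow> 'b) \<Rightarrow> real" where
  "L2_inner \<Omega> u v = integral\<^sup>L (lebesgue_on \<Omega>) (\<lambda>x. inner (u x) (v x))"

definition L2_norm :: "R3 set \<Rightarrow> (R3 \<Rightarrow> 'b::euclidean_space) \<Rightarrow> real" where
  "L2_norm \<Omega> u = sqrt (L2_inner \<Omega> u u)"

text \<open>The norm is only meaningful for measurable, essentially bounded functions: the conversion
  from extended reals sends an infinite essential supremum to 0. On \<^typ>\<open>real^3^3\<close>, \<^const>\<open>norm\<close> is the
  Frobenius norm.\<close>

definition Linf_norm :: "'a measure \<Rightarrow> ('a \<Rightarrow> 'b::real_normed_vector) \<Rightarrow> real" where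
  "Linf_norm M u = real_of_ereal (esssup M (\<lambda>x. ereal (norm (u x))))"

definition C1_L2 :: "R3 set \<Rightarrow> real \<Rightarrow> (real \<Rightarrow> R3 \<Rightarrow> R3) \<Rightarrow> bool" where
  "C1_L2 \<Omega> T f \<longleftrightarrow> (\<exists>f'.
     \<forall>t\<in>{0..T}. L2_fun \<Omega> (f t) \<and> L2_fun \<Omega> (f' t)
       \<and> ((\<lambda>s. L2_norm \<Omega> (\<lambda>x. (f s x - f t x) /\<^sub>R (s - t) - f' t x)) \<longlongrightarrow> 0) (at t within {0..T})
       \<and> ((\<lambda>s. L2_norm \<Omega> (\<lambda>x. f' s x - f' t x)) \<longlongrightarrow> 0) (at t within {0..T}))"

definition partial_deriv :: "3 \<Rightarrow> (R3 \<Rightarrow> real) \<Rightarrow> R3 \<Rightarrow> real" where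
  "partial_deriv j \<psi> x = frechet_derivative \<psi> (at x) (axis j 1)"

primrec C_k :: "nat \<Rightarrow> (R3 \<Rightarrow> real) \<Rightarrow> bool" where
  "C_k 0 \<psi> \<longleftrightarrow> continuous_on UNIV \<psi>"
| "C_k (Suc n) \<psi> \<longleftrightarrow> \<psi> differentiable_on UNIV \<and> (\<forall>j. C_k n (partial_deriv j \<psi>))"

definition test_function :: "R3 set \<Rightarrow> (R3 \<Rightarrow> real) \<Rightarrow> bool" where
  "test_function \<Omega> \<psi> \<longleftrightarrow> (\<forall>n. C_k n \<psi>)
     \<and> compact (closure {x. \<psi> x \<noteq> 0}) \<and> closure {x. \<psi> x \<noteq> 0} \<subseteq> \<Omega>"

definition weak_gradient :: "R3 set \<Rightarrow> (R3 \<Rightarrow> R3) \<Rightarrow> (R3 \<Rightarrow> real^3^3) \<Rightarrow> bool" where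
  "weak_gradient \<Omega> u G \<longleftrightarrow> (\<forall>\<psi> i j. test_function \<Omega> \<psi> \<longrightarrow>
     integral\<^sup>L (lebesgue_on \<Omega>) (\<lambda>x. u x $ i * partial_deriv j \<psi> x)
       = - integral\<^sup>L (lebesgue_on \<Omega>) (\<lambda>x. G x $ i $ j * \<psi> x))"

text \<open>\<open>H1_fun \<Omega> u G\<close>: the function \<open>u\<close> belongs to \<open>H\<^sup>1(\<Omega>)\<^sup>3\<close> and has the weak gradient \<open>G\<close>.\<close>

definition H1_fun :: "R3 set \<Rightarrow> (R3 \<Rightarrow> R3) \<Rightarrow> (R3 \<Rightarrow> real^3^3) \<Rightarrow> bool" where
  "H1_fun \<Omega> u G \<longleftrightarrow> L2_fun \<Omega> u \<and> L2_fun \<Omega> G \<and> weak_gradient \<Omega> u G"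

text \<open>Bounded operators from \<open>H\<^sup>1(\<Omega>)\<^sup>3\<close> to \<open>L\<^sup>2(\<Omega>)\<^sup>3\<close>, acting on representatives and
  well-defined on classes modulo null sets. Linearity is not imposed; bounded linear operators
  are a special case.\<close>

definition bounded_H1_L2 :: "R3 set \<Rightarrow> ((R3 \<Rightarrow> R3) \<Rightarrow> (R3 \<Rightarrow> R3)) \<Rightarrow> bool" where
  "bounded_H1_L2 \<Omega> \<pi> \<longleftrightarrow>
     (\<forall>u v G. H1_fun \<Omega> u G \<and> (AE x in lebesgue_on \<Omega>. u x = v x)
        \<longrightarrow> (AE x in lebesgue_on \<Omega>. \<pi> u x = \<pi> v x)) \<and>
     (\<exists>c. \<forall>u G. H1_fun \<Omega> u G \<longrightarrow> L2_fun \<Omega> (\<pi> u)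
        \<and> L2_norm \<Omega> (\<pi> u) \<le> c * sqrt ((L2_norm \<Omega> u)\<^sup>2 + (L2_norm \<Omega> G)\<^sup>2))"

section \<open>Domain, mesh, and lowest-order finite elements\<close>

definition bounded_lipschitz_domain :: "R3 set \<Rightarrow> bool" where
  "bounded_lipschitz_domain \<Omega> \<longleftrightarrow>
     open \<Omega> \<and> connected \<Omega> \<and> \<Omega> \<noteq> {} \<and> bounded \<Omega> \<and>
     (\<forall>x\<in>frontier \<Omega>. \<exists>r>0. \<exists>R g L. orthogonal_transformation R \<and> L-lipschitz_on UNIV g \<and>
        \<Omega> \<inter> ball x r
          = {y \<in> ball x r. g (vector [R y $ 1, R y $ 2] :: real^2) < (R y :: R3) $ 3})"

definition tetrahedral_mesh :: "R3 set \<Rightarrow> R3 set set \<Rightarrow> bool" where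
  "tetrahedral_mesh \<Omega> \<T> \<longleftrightarrow>
     triangulation \<T> \<and> (\<forall>K\<in>\<T>. 3 simplex K) \<and> \<Union>\<T> = closure \<Omega>"

definition quasi_uniform :: "real \<Rightarrow> real \<Rightarrow> R3 set set \<Rightarrow> bool" where
  "quasi_uniform C_mesh h \<T> \<longleftrightarrow>
     (\<forall>K\<in>\<T>. h \<le> root 3 (measure lebesgue K) \<and> root 3 (measure lebesgue K) \<le> diameter K
        \<and> diameter K \<le> C_mesh * h)"

definition nodes :: "R3 set set \<Rightarrow> R3 set" where
  "nodes \<T> = {z. \<exists>K\<in>\<T>. z extreme_point_of K}"

definition S_h :: "R3 set set \<Rightarrow> (R3 \<Rightarrow> real) set" where
  "S_h \<T> = {v. continuous_on (\<Union>\<T>) v \<and>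
     (\<forall>K\<in>\<T>. \<exists>A b. linear A \<and> (\<forall>x\<in>K. v x = A x + b))}"

definition S_h3 :: "R3 set set \<Rightarrow> (R3 \<Rightarrow> R3) set" where
  "S_h3 \<T> = {v. \<forall>i. (\<lambda>x. v x $ i) \<in> S_h \<T>}"

definition M_h :: "R3 set set \<Rightarrow> (R3 \<Rightarrow> R3) set" where
  "M_h \<T> = {v \<in> S_h3 \<T>. \<forall>z\<in>nodes \<T>. norm (v z) = 1}"

definition hat_functions ::
    "R3 set set \<Rightarrow> nat \<Rightarrow> (nat \<Rightarrow> R3) \<Rightarrow> (nat \<Rightarrow> R3 \<Rightarrow> real) \<Rightarrow> bool" where
  "hat_functions \<T> N z \<phi> \<longleftrightarrow> bij_betw z {..<N} (nodes \<T>) \<and>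
     (\<forall>j<N. \<phi> j \<in> S_h \<T> \<and> (\<forall>i<N. \<phi> j (z i) = (if i = j then 1 else 0)))"

text \<open>The classical Jacobian; for a finite element function it exists in the interior of every
  element, hence almost everywhere, and is its weak gradient.\<close>

definition grad :: "(R3 \<Rightarrow> R3) \<Rightarrow> R3 \<Rightarrow> real^3^3" where
  "grad v x = jacobian v (at x)"

text \<open>The index \<open>3 * j + l\<close> with \<open>l < 3\<close> belongs to node \<open>j\<close> and to component \<open>l + 1\<close>. In the
  numeral type \<^typ>\<open>3\<close> the component \<open>3\<close> is the same as \<open>0\<close>.\<close>

definition basis_fun :: "(nat \<Rightarrow> R3 \<Rightarrow> real) \<Rightarrow> nat \<Rightarrow> R3 \<Rightarrow> R3" where
  "basis_fun \<phi> i x = \<phi> (i div 3) x *\<^sub>R axis (of_nat (Suc (i mod 3))) 1"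

section \<open>Matrices of the tangent plane scheme\<close>

definition mass_matrix :: "R3 set \<Rightarrow> nat \<Rightarrow> (nat \<Rightarrow> R3 \<Rightarrow> real) \<Rightarrow> real mat" where
  "mass_matrix \<Omega> N \<phi> = Matrix.mat (3*N) (3*N) (\<lambda>(i, j).
     L2_inner \<Omega> (basis_fun \<phi> i) (basis_fun \<phi> j))"

definition weighted_mass_matrix ::
    "R3 set \<Rightarrow> nat \<Rightarrow> (nat \<Rightarrow> R3 \<Rightarrow> real) \<Rightarrow> (R3 \<Rightarrow> real) \<Rightarrow> real mat" where
  "weighted_mass_matrix \<Omega> N \<phi> w = Matrix.mat (3*N) (3*N) (\<lambda>(i, j).
     L2_inner \<Omega> (\<lambda>x. w x *\<^sub>R basis_fun \<phi> i x) (basis_fun \<phi> j))"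

definition stiffness_matrix :: "R3 set \<Rightarrow> nat \<Rightarrow> (nat \<Rightarrow> R3 \<Rightarrow> real) \<Rightarrow> real mat" where
  "stiffness_matrix \<Omega> N \<phi> = Matrix.mat (3*N) (3*N) (\<lambda>(i, j).
     L2_inner \<Omega> (grad (basis_fun \<phi> i)) (grad (basis_fun \<phi> j)))"

definition skew_matrix ::
    "R3 set \<Rightarrow> nat \<Rightarrow> (nat \<Rightarrow> R3 \<Rightarrow> real) \<Rightarrow> (R3 \<Rightarrow> R3) \<Rightarrow> real mat" where
  "skew_matrix \<Omega> N \<phi> m = Matrix.mat (3*N) (3*N) (\<lambda>(i, j).
     L2_inner \<Omega> (\<lambda>x. cross3 (m x) (basis_fun \<phi> i x)) (basis_fun \<phi> j))"

text \<open>From here on, \<open>w\<close> stands for \<open>W\<^sub>k(\<lambda>\<^sub>h\<^sup>n)\<close>, \<open>bk\<close> for \<open>\<beta>(k) k\<close>, and \<open>l\<close> for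
  \<open>L\<^sub>h(m\<^sub>h\<^sup>n, m\<^sub>h\<^sup>n\<^sup>-\<^sup>1)\<close>.\<close>

definition A_matrix ::
    "R3 set \<Rightarrow> nat \<Rightarrow> (nat \<Rightarrow> R3 \<Rightarrow> real) \<Rightarrow> real \<Rightarrow> (R3 \<Rightarrow> real) \<Rightarrow> real \<Rightarrow> (R3 \<Rightarrow> R3) \<Rightarrow> real mat" where
  "A_matrix \<Omega> N \<phi> \<alpha> w bk m =
     \<alpha> \<cdot>\<^sub>m weighted_mass_matrix \<Omega> N \<phi> (\<lambda>x. w x / \<alpha>) + bk \<cdot>\<^sub>m stiffness_matrix \<Omega> N \<phi>
       - skew_matrix \<Omega> N \<phi> m"

definition b_vector ::
    "R3 set \<Rightarrow> nat \<Rightarrow> (nat \<Rightarrow> R3 \<Rightarrow> real) \<Rightarrow> real \<Rightarrow> (R3 \<Rightarrow> R3) \<Rightarrow> (R3 \<Rightarrow> R3) \<Rightarrow> real Matrix.vec" where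
  "b_vector \<Omega> N \<phi> l_ex l m = Matrix.vec (3*N) (\<lambda>j.
     - l_ex\<^sup>2 * L2_inner \<Omega> (grad m) (grad (basis_fun \<phi> j)) + L2_inner \<Omega> l (basis_fun \<phi> j))"

text \<open>The function \<open>\<lambda>\<^sub>h\<^sup>n\<close>, with \<open>ft\<close> for \<open>f(t\<^sub>n)\<close>.\<close>

definition lambda_h ::
    "real \<Rightarrow> (R3 \<Rightarrow> R3) \<Rightarrow> ((R3 \<Rightarrow> R3) \<Rightarrow> (R3 \<Rightarrow> R3)) \<Rightarrow> (R3 \<Rightarrow> R3) \<Rightarrow> R3 \<Rightarrow> real" where
  "lambda_h l_ex ft \<pi> m x =
     - l_ex\<^sup>2 * (norm (grad m x))\<^sup>2 + inner (ft x + \<pi> m x) (m x)"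

definition householder :: "R3 \<Rightarrow> real^3^3" where
  "householder m =
     (if m = - axis 3 1 then transpose (vector [axis 1 1, axis 2 1, - axis 3 1])
      else let w = (m + axis 3 1) /\<^sub>R norm (m + axis 3 1)
           in Finite_Cartesian_Product.mat 1 - 2 *\<^sub>R (\<chi> i j. w $ i * w $ j))"

definition H_block :: "R3 \<Rightarrow> real^2^3" where
  "H_block m = transpose (vector [householder m *v axis 1 1, householder m *v axis 2 1])"

definition Q_matrix ::
    "nat \<Rightarrow> (nat \<Rightarrow> R3) \<Rightarrow> real^3^3 \<Rightarrow> (R3 \<Rightarrow> R3) \<Rightarrow> real mat" where
  "Q_matrix N z Tn \<nu> = Matrix.mat (3*N) (2*N) (\<lambda>(i, j).
     if i div 3 = j div 2
     then (Tn ** H_block (Tn *v \<nu> (z (i div 3)))) $ of_nat (Suc (i mod 3)) $ of_nat (Suc (j mod 2))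
     else 0)"

text \<open>Only used for invertible matrices.\<close>

definition mat_inv :: "real mat \<Rightarrow> real mat" where
  "mat_inv A = the (mat_inverse A)"

definition A_Q ::
    "R3 set \<Rightarrow> nat \<Rightarrow> (nat \<Rightarrow> R3) \<Rightarrow> (nat \<Rightarrow> R3 \<Rightarrow> real) \<Rightarrow> real^3^3 \<Rightarrow> real \<Rightarrow> (R3 \<Rightarrow> real) \<Rightarrow> real
      \<Rightarrow> (R3 \<Rightarrow> R3) \<Rightarrow> real mat" where
  "A_Q \<Omega> N z \<phi> Tn \<alpha> w bk m =
     transpose_mat (Q_matrix N z Tn m) * A_matrix \<Omega> N \<phi> \<alpha> w bk m * Q_matrix N z Tn m"

definition b_Q ::
    "R3 set \<Rightarrow> nat \<Rightarrow> (nat \<Rightarrow> R3) \<Rightarrow> (nat \<Rightarrow> R3 \<Rightarrow> real) \<Rightarrow> real^3^3 \<Rightarrow> real \<Rightarrow> (R3 \<Rightarrow> R3)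
      \<Rightarrow> (R3 \<Rightarrow> R3) \<Rightarrow> real Matrix.vec" where
  "b_Q \<Omega> N z \<phi> Tn l_ex l m =
     transpose_mat (Q_matrix N z Tn m) *\<^sub>v b_vector \<Omega> N \<phi> l_ex l m"

definition P_Q ::
    "R3 set \<Rightarrow> nat \<Rightarrow> (nat \<Rightarrow> R3) \<Rightarrow> (nat \<Rightarrow> R3 \<Rightarrow> real) \<Rightarrow> real^3^3 \<Rightarrow> real \<Rightarrow> real
      \<Rightarrow> (R3 \<Rightarrow> R3) \<Rightarrow> real mat" where
  "P_Q \<Omega> N z \<phi> Tn \<alpha>P bk \<mu> = mat_inv
     (transpose_mat (Q_matrix N z Tn \<mu>) * (\<alpha>P \<cdot>\<^sub>m mass_matrix \<Omega> N \<phi> + bk \<cdot>\<^sub>m stiffness_matrix \<Omega> N \<phi>)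
        * Q_matrix N z Tn \<mu>)"

section \<open>Preconditioned GMRES\<close>

definition prec_norm :: "real mat \<Rightarrow> real Matrix.vec \<Rightarrow> real" where
  "prec_norm P x = sqrt (scalar_prod x (mat_inv P *\<^sub>v x))"

definition prec_residual :: "real mat \<Rightarrow> real mat \<Rightarrow> real Matrix.vec \<Rightarrow> real Matrix.vec \<Rightarrow> real Matrix.vec" where
  "prec_residual P A b x = P *\<^sub>v b - (P * A) *\<^sub>v x"

definition krylov_space :: "real mat \<Rightarrow> real Matrix.vec \<Rightarrow> nat \<Rightarrow> real Matrix.vec set" where
  "krylov_space B r l = LinearCombinations.module.span class_ring (module_vec TYPE(real) (dim_vec r))
     {(B ^\<^sub>m j) *\<^sub>v r | j. j < l}"

definition gmres_iterates ::
    "real mat \<Rightarrow> real mat \<Rightarrow> real Matrix.vec \<Rightarrow> real Matrix.vec \<Rightarrow> (nat \<Rightarrow> real Matrix.vec) \<Rightarrow> bool" where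
  "gmres_iterates P A b x0 x \<longleftrightarrow> (\<forall>l.
     let X = {x0 + v | v. v \<in> krylov_space (P * A) (prec_residual P A b x0) l}
     in x l \<in> X \<and>
        (\<forall>y\<in>X. prec_norm P (prec_residual P A b (x l)) \<le> prec_norm P (prec_residual P A b y)))"

section \<open>Factors in the residual estimates\<close>

text \<open>Here \<open>d\<close> stands for the \<open>L\<^sup>\<infinity>\<close>-distance of \<open>W\<^sub>k(\<lambda>\<^sub>h\<^sup>n)\<close> and \<open>\<alpha>\<^sub>P\<close>. For \<open>C > 1\<close>, \<open>0 < \<alpha> \<le> \<alpha>P\<close>,
  \<open>d \<ge> 0\<close> and \<open>F \<ge> 1\<close> the value lies strictly between 0 and 1, so that \<open>contraction C \<alpha> \<alpha>P d F powr (l / 2)\<close>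
  is the usual power also for \<open>l = 0\<close>.\<close>

definition contraction :: "real \<Rightarrow> real \<Rightarrow> real \<Rightarrow> real \<Rightarrow> real \<Rightarrow> real" where
  "contraction C \<alpha> \<alpha>P d F =
     1 - inverse C * (\<alpha> / \<alpha>P)\<^sup>2 * (1 + 1 / \<alpha>P + d / \<alpha>P) powi (-2) * F powi (-4)"

definition F_nodal ::
    "R3 set set \<Rightarrow> real \<Rightarrow> real^3^3 \<Rightarrow> real \<Rightarrow> real \<Rightarrow> (R3 \<Rightarrow> R3) \<Rightarrow> (R3 \<Rightarrow> R3) \<Rightarrow> real" where
  "F_nodal \<T> h Tn \<alpha>P bk m \<mu> = 1 + bk / (\<alpha>P * h\<^sup>2) *
     (MAX z\<in>nodes \<T>. (onorm ((*v) (H_block (Tn *v m z) - H_block (Tn *v \<mu> z))))\<^sup>2)"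

definition F_gamma ::
    "R3 set \<Rightarrow> real \<Rightarrow> real \<Rightarrow> real \<Rightarrow> (R3 \<Rightarrow> R3) \<Rightarrow> (R3 \<Rightarrow> R3) \<Rightarrow> real" where
  "F_gamma \<Omega> \<gamma> \<alpha>P bk m \<mu> =
     1 + \<gamma> powi (-2) * (Linf_norm (lebesgue_on \<Omega>) (\<lambda>x. m x - \<mu> x))\<^sup>2
       + bk / (\<alpha>P * \<gamma>\<^sup>2) * (Linf_norm (lebesgue_on \<Omega>) (\<lambda>x. grad m x - grad \<mu> x))\<^sup>2
       + bk / (\<alpha>P * \<gamma> ^ 6)
           * ((Linf_norm (lebesgue_on \<Omega>) (grad m))\<^sup>2 + (Linf_norm (lebesgue_on \<Omega>) (grad \<mu>))\<^sup>2)
           * (Linf_norm (lebesgue_on \<Omega>) (\<lambda>x. m x - \<mu> x))\<^sup>2"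

end

theory Submission
  imports Defs
begin

text \<open>Let \<open>|x|\<^sub>\<nu>\<close> be the norm of the finite element function with nodal values
  \<open>T\<^sub>n H[T\<^sub>n \<nu>(z)] x\<^sub>z\<close> induced by \<open>\<alpha>\<^sub>P M + \<beta>(k) k L\<close>. The skew part drops out of
  \<open>x \<bullet> A\<^sub>Q x\<close>, so \<open>A\<^sub>Q\<close> is coercive with constant \<open>\<alpha> / (2 \<alpha>\<^sub>P)\<close> and bounded with constant
  \<open>1 + 1 / \<alpha>\<^sub>P + d / \<alpha>\<^sub>P\<close> in the norm with \<open>\<nu> = m\<close>. The residual estimate of GMRES in the norm with
  \<open>\<nu> = \<mu>\<close> then follows from the equivalence of both squared norms up to a factor \<open>C F\<close>. On every
  element this equivalence only involves nodal values: for an affine function, the squared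
  \<open>L\<^sup>2\<close>-norm is comparable to the volume times the largest squared nodal value, and the gradient is
  bounded by \<open>C / h\<close> times the largest difference of nodal values. The columns of \<open>H[m]\<close> are
  orthonormal, so both functions have the same nodal norms, and the nodal differences are controlled
  by \<open>H[T\<^sub>n m] - H[T\<^sub>n \<mu>]\<close> in (i) and by its increments between nodes in (ii).

  The weight \<open>W\<^sub>k(\<lambda>\<^sub>h)\<close> has to be measurable, which requires \<open>\<pi> m \<in> L\<^sup>2\<close> and hence that the piecewise
  gradient of a finite element function is its weak gradient.\<close>

section \<open>Residual bound for preconditioned GMRES\<close>

text \<open>Both norms belong to the same coefficient vector but to different nodal frames, and the
  coefficients carry no smoothness, because frames at neighbouring nodes may be rotated against each
  other. The gradient of the difference of the two functions is therefore reached only through nodal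
  values and an inverse estimate, which costs \<open>1 / h\<close>. In (i) this loss remains and is
  the \<open>h^2\<close> in the denominator. In (ii) it is compensated by a mixed difference of
  \<open>H_block\<close> over two nodes and two fields, which is of the order of \<open>h\<close>
  times Lipschitz data. The remaining increment of the coefficients is recovered from the increment
  of the function itself, since every frame is an isometry, and is charged to the gradient part of
  the energy; this is the source of the \<open>\<gamma>^-2\<close> term without \<open>bk\<close>.
  Transferring coercivity from the norm of \<open>m\<close> to that of \<open>\<mu>\<close> costs
  one factor \<open>K * F\<close>, transferring boundedness costs another; the square of the
  quotient of the two constants explains \<open>F^-4\<close> and the constant
  \<open>4 * K^4\<close>.\<close>

lemma mat_inv_right_left:
  fixes G :: "real mat"
  assumes G: "G \<in> carrier_mat n n"
    and inj: "\<And>x. x \<in> carrier_vec n \<Longrightarrow> G *\<^sub>v x = 0\<^sub>v n \<Longrightarrow> x = 0\<^sub>v n"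
  shows "mat_inv G \<in> carrier_mat n n" "G * mat_inv G = 1\<^sub>m n" "mat_inv G * G = 1\<^sub>m n"
    "mat_inv (mat_inv G) = G"
proof -
  have "Determinant.det G \<noteq> 0"
    using det_0_iff_vec_prod_zero[OF G] inj by blast
  then have "G \<in> Units (ring_mat TYPE(real) n ())"
    using G by (simp add: det_non_zero_imp_unit)
  then obtain B where B: "mat_inverse G = Some B"
    using mat_inverse(1)[OF G, where b="()"] by blast
  note B' = mat_inverse(2)[OF G B]
  have eq: "mat_inv G = B" by (simp add: mat_inv_def B)
  show "mat_inv G \<in> carrier_mat n n" "G * mat_inv G = 1\<^sub>m n" "mat_inv G * G = 1\<^sub>m n"
    using B' eq by auto
  have Bc: "B \<in> carrier_mat n n" using B' by auto
  have "B \<in> Units (ring_mat TYPE(real) n ())"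
    using B' G Bc unfolding Units_def ring_mat_def by auto
  then obtain D where D: "mat_inverse B = Some D"
    using mat_inverse(1)[OF Bc, where b="()"] by blast
  note D' = mat_inverse(2)[OF Bc D]
  have "D = (G * B) * D" using D' B' left_mult_one_mat[of D n n] by metis
  also have "\<dots> = G * (B * D)" using G Bc D' by (simp add: assoc_mult_mat[of _ n n _ n _ n])
  also have "\<dots> = G" using D' G by simp
  finally show "mat_inv (mat_inv G) = G" by (simp add: mat_inv_def B D eq)
qed

context vec_space
begin

text \<open>Each generator moves to the next power, so \<open>B\<close> maps a Krylov space into the
  next larger one. This puts the residual of the current iterate, and with it a correction along
  that residual, into the space searched by the next iterate.\<close>

lemma krylov_mult:
  assumes B: "B \<in> carrier_mat n n" and r: "r \<in> carrier_vec n"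
    and v: "v \<in> span {(B ^\<^sub>m j) *\<^sub>v r | j. j < l}"
  shows "B *\<^sub>v v \<in> span {(B ^\<^sub>m j) *\<^sub>v r | j. j < Suc l}"
proof -
  let ?S = "\<lambda>l. {(B ^\<^sub>m j) *\<^sub>v r | j. j < l}"
  have Bj: "B ^\<^sub>m j \<in> carrier_mat n n" for j using B by simp
  have Sc: "?S l \<subseteq> carrier_vec n" for l using mult_mat_vec_carrier[OF Bj r] by auto
  from v obtain a W where W: "finite W" "W \<subseteq> ?S l" "v = lincomb a W"
    by (auto simp: span_def)
  have Wc: "W \<subseteq> carrier_vec n" using W Sc by blast
  have step: "B *\<^sub>v u \<in> ?S (Suc l)" if "u \<in> ?S l" for u
  proof -
    from that obtain j where j: "j < l" "u = (B ^\<^sub>m j) *\<^sub>v r" by auto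
    \<comment> \<open>Matrix powers append their factor on the right, so moving \<open>B\<close> to
      the other side takes an induction.\<close>
    have "B * B ^\<^sub>m j = B ^\<^sub>m Suc j"
      using B
    proof (induction j)
      case (Suc j)
      have "B * B ^\<^sub>m Suc j = (B * B ^\<^sub>m j) * B"
        using Bj B by (simp add: assoc_mult_mat[of _ n n _ n _ n])
      then show ?case using Suc by simp
    qed auto
    then have "B *\<^sub>v u = (B ^\<^sub>m Suc j) *\<^sub>v r"
      using j B Bj r by (metis assoc_mult_mat_vec)
    then show ?thesis using j by blast
  qed
  from W(1) Wc W(2) have "B *\<^sub>v lincomb a W \<in> span (?S (Suc l))"
  proof (induction W)
    case empty
    have "B *\<^sub>v 0\<^sub>v n = 0\<^sub>v n" using B by (intro eq_vecI) auto
    then show ?case using span_zero[of "?S (Suc l)"] by (simp add: lincomb_def)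
  next
    case (insert u W)
    have uc: "u \<in> carrier_vec n" "W \<subseteq> carrier_vec n" using insert by auto
    have "lincomb a (insert u W) = a u \<cdot>\<^sub>v u + lincomb a W"
      using insert uc by (subst lincomb_insert2) auto
    then have "B *\<^sub>v lincomb a (insert u W) = a u \<cdot>\<^sub>v (B *\<^sub>v u) + B *\<^sub>v lincomb a W"
      using B uc by (simp add: mult_add_distrib_mat_vec[of _ n n] mult_mat_vec[of _ n n])
    moreover have "a u \<cdot>\<^sub>v (B *\<^sub>v u) \<in> span (?S (Suc l))"
      using step[of u] insert.prems Sc[of "Suc l"]
      by (intro smult_in_span in_own_span[THEN subsetD]) auto
    ultimately show ?case
      using insert uc span_add1[OF Sc[of "Suc l"]] by auto
  qed
  then show ?thesis using W by simp
qed

end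

text \<open>\<open>prec_norm\<close> inverts the preconditioner, which is itself an inverse. The
  double inverse returns \<open>G\<close>, and the norm becomes the energy norm of a matrix that is
  known explicitly.\<close>

lemma prec_norm_mat_inv:
  fixes G :: "real mat"
  assumes "mat_inv (mat_inv G) = G"
  shows "prec_norm (mat_inv G) x = sqrt (x \<bullet> (G *\<^sub>v x))"
  using assms by (simp add: prec_norm_def)

text \<open>One step with the fixed step length \<open>c1 / c2\<^sup>2\<close> already gives the contraction.\<close>

lemma min_residual_step:
  fixes c1 c2 N s u q :: real
  assumes "c1 > 0" "c2 > 0" "N \<ge> 0" "s \<ge> c1 * N" "u \<le> c2\<^sup>2 * N" "1 - (c1 / c2)\<^sup>2 \<le> q"
  shows "N - 2 * (c1 / c2\<^sup>2) * s + (c1 / c2\<^sup>2)\<^sup>2 * u \<le> q * N"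
proof -
  have "N - 2 * (c1 / c2\<^sup>2) * s + (c1 / c2\<^sup>2)\<^sup>2 * u
    \<le> N - 2 * (c1 / c2\<^sup>2) * (c1 * N) + (c1 / c2\<^sup>2)\<^sup>2 * (c2\<^sup>2 * N)"
    using assms by (intro add_mono diff_mono mult_left_mono) auto
  also have "\<dots> = (1 - (c1 / c2)\<^sup>2) * N"
    using assms(2) by (simp add: field_simps power2_eq_square)
  also have "\<dots> \<le> q * N" using assms by (intro mult_right_mono) auto
  finally show ?thesis .
qed

text \<open>The classical field-of-values estimate, in the scalar product of \<open>G\<close>. Since
  \<open>G\<close> times the preconditioned matrix is \<open>A\<close>, the form of \<open>A\<close>
  is exactly the form of the preconditioned matrix in this scalar product. Minimality is used one
  step at a time, against a single correction along the current residual. The bound is stated for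
  any positive \<open>q\<close> above \<open>1 - (c1 / c2)^2\<close>, so that
  \<open>q powr (l / 2)\<close> is an ordinary power for every \<open>l\<close>.\<close>

lemma gmres_residual_bound:
  fixes G A :: "real mat"
  assumes G: "G \<in> carrier_mat n n" and A: "A \<in> carrier_mat n n"
    and b: "b \<in> carrier_vec n" and x0: "x0 \<in> carrier_vec n"
    and sym: "\<And>x y. x \<in> carrier_vec n \<Longrightarrow> y \<in> carrier_vec n \<Longrightarrow> x \<bullet> (G *\<^sub>v y) = y \<bullet> (G *\<^sub>v x)"
    and pos: "\<And>x. x \<in> carrier_vec n \<Longrightarrow> x \<noteq> 0\<^sub>v n \<Longrightarrow> x \<bullet> (G *\<^sub>v x) > 0"
    and coercive: "\<And>x. x \<in> carrier_vec n \<Longrightarrow> c1 * (x \<bullet> (G *\<^sub>v x)) \<le> x \<bullet> (A *\<^sub>v x)"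
    and bounded: "\<And>x y. x \<in> carrier_vec n \<Longrightarrow> y \<in> carrier_vec n \<Longrightarrow>
      y \<bullet> (A *\<^sub>v x) \<le> c2 * sqrt (x \<bullet> (G *\<^sub>v x)) * sqrt (y \<bullet> (G *\<^sub>v y))"
    and c: "c1 > 0" "c2 > 0" and q: "1 - (c1 / c2)\<^sup>2 \<le> q" "q > 0"
    and gmres: "gmres_iterates (mat_inv G) A b x0 x"
  shows "prec_norm (mat_inv G) (prec_residual (mat_inv G) A b (x l))
    \<le> q powr (real l / 2) * prec_norm (mat_inv G) (prec_residual (mat_inv G) A b (x 0))"
proof -
  interpret vec_space "TYPE(real)" n .
  define P where "P = mat_inv G"
  have inj: "x = 0\<^sub>v n" if "x \<in> carrier_vec n" "G *\<^sub>v x = 0\<^sub>v n" for x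
    using pos[OF that(1)] that by force
  have P: "P \<in> carrier_mat n n" and GP: "G * P = 1\<^sub>m n" and inv: "mat_inv (mat_inv G) = G"
    using mat_inv_right_left[OF G inj] by (auto simp: P_def)
  define B where "B = P * A"
  have B: "B \<in> carrier_mat n n" using P A by (simp add: B_def)
  define r where "r = prec_residual P A b"
  have r_eq: "r y = P *\<^sub>v b - B *\<^sub>v y" for y by (simp add: r_def prec_residual_def B_def)
  have r_carrier: "r y \<in> carrier_vec n" if "y \<in> carrier_vec n" for y
    using that P B b by (simp add: r_eq)
  define nn where "nn = (\<lambda>y. y \<bullet> (G *\<^sub>v y))"
  have nn_nonneg: "nn y \<ge> 0" if "y \<in> carrier_vec n" for y
    using pos[OF that] G by (cases "y = 0\<^sub>v n") (auto simp: nn_def)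
  have norm_eq: "prec_norm P y = sqrt (nn y)" for y
    using prec_norm_mat_inv[OF inv] by (simp add: P_def nn_def)
  have GB: "G *\<^sub>v (B *\<^sub>v y) = A *\<^sub>v y" if "y \<in> carrier_vec n" for y
  proof -
    have "G *\<^sub>v (B *\<^sub>v y) = (G * B) *\<^sub>v y" using G B that by (simp add: assoc_mult_mat_vec[of _ n n _ n])
    also have "G * B = A" using G P A GP by (simp add: B_def assoc_mult_mat[of _ n n _ n _ n, symmetric])
    finally show ?thesis .
  qed
  \<comment> \<open>Boundedness is tested with \<open>B *\<^sub>v y\<close> itself. Dividing by the
    norm of that vector, if it is not zero, leaves the operator bound \<open>c2\<close> in the norm
    of \<open>G\<close>.\<close>
  have nn_B: "nn (B *\<^sub>v y) \<le> c2\<^sup>2 * nn y" if y: "y \<in> carrier_vec n" for y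
  proof -
    have By: "B *\<^sub>v y \<in> carrier_vec n" using B y by simp
    have "nn (B *\<^sub>v y) \<le> c2 * sqrt (nn y) * sqrt (nn (B *\<^sub>v y))"
      using bounded[OF y By] GB[OF y] by (simp add: nn_def)
    then have "sqrt (nn (B *\<^sub>v y)) * sqrt (nn (B *\<^sub>v y)) \<le> (c2 * sqrt (nn y)) * sqrt (nn (B *\<^sub>v y))"
      using nn_nonneg[OF By] by simp
    then have "sqrt (nn (B *\<^sub>v y)) \<le> c2 * sqrt (nn y)"
    proof (cases "nn (B *\<^sub>v y) = 0")
      case False
      then have "0 < sqrt (nn (B *\<^sub>v y))" using nn_nonneg[OF By] by simp
      moreover assume "sqrt (nn (B *\<^sub>v y)) * sqrt (nn (B *\<^sub>v y)) \<le> (c2 * sqrt (nn y)) * sqrt (nn (B *\<^sub>v y))"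
      ultimately show ?thesis by (meson mult_right_le_imp_le)
    qed (use nn_nonneg[OF y] c in simp)
    then have "(sqrt (nn (B *\<^sub>v y)))\<^sup>2 \<le> (c2 * sqrt (nn y))\<^sup>2"
      using nn_nonneg[OF By] by (intro power_mono) auto
    then show ?thesis using nn_nonneg[OF By] nn_nonneg[OF y] by (simp add: power_mult_distrib)
  qed
  have B_nn: "c1 * nn y \<le> y \<bullet> (G *\<^sub>v (B *\<^sub>v y))" if y: "y \<in> carrier_vec n" for y
    using coercive[OF y] GB[OF y] by (simp add: nn_def)
  have expand: "nn (y - t \<cdot>\<^sub>v u) = nn y - 2 * t * (y \<bullet> (G *\<^sub>v u)) + t\<^sup>2 * nn u"
    if y: "y \<in> carrier_vec n" and u: "u \<in> carrier_vec n" for y u t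
  proof -
    have "G *\<^sub>v (y - t \<cdot>\<^sub>v u) = G *\<^sub>v y - t \<cdot>\<^sub>v (G *\<^sub>v u)"
      using G y u by (simp add: mult_minus_distrib_mat_vec[of _ n n] mult_mat_vec[of _ n n])
    then have "nn (y - t \<cdot>\<^sub>v u) = (y - t \<cdot>\<^sub>v u) \<bullet> (G *\<^sub>v y - t \<cdot>\<^sub>v (G *\<^sub>v u))"
      by (simp add: nn_def)
    also have "\<dots> = y \<bullet> (G *\<^sub>v y) - t * (u \<bullet> (G *\<^sub>v y)) - t * (y \<bullet> (G *\<^sub>v u)) + t * (t * (u \<bullet> (G *\<^sub>v u)))"
      using G y u by (simp add: minus_scalar_prod_distrib[of _ n] scalar_prod_minus_distrib[of _ n] algebra_simps)
    also have "u \<bullet> (G *\<^sub>v y) = y \<bullet> (G *\<^sub>v u)" using sym y u by blast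
    finally show ?thesis by (simp add: nn_def power2_eq_square)
  qed
  define S where "S = (\<lambda>l. {(B ^\<^sub>m j) *\<^sub>v r x0 | j. j < l})"
  have r0: "r x0 \<in> carrier_vec n" using r_carrier x0 .
  have Bj: "B ^\<^sub>m j *\<^sub>v r x0 \<in> carrier_vec n" for j
    using mult_mat_vec_carrier[OF pow_carrier_mat[OF B] r0] .
  have S: "S l \<subseteq> carrier_vec n" for l using Bj by (auto simp: S_def)
  have krylov: "krylov_space B (r x0) l = span (S l)" for l
    using r0 by (simp add: krylov_space_def S_def)
  have xl: "x l \<in> {x0 + v | v. v \<in> span (S l)}"
    and min: "\<And>y. y \<in> {x0 + v | v. v \<in> span (S l)} \<Longrightarrow> sqrt (nn (r (x l))) \<le> sqrt (nn (r y))" for l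
    using gmres unfolding gmres_iterates_def Let_def P_def[symmetric] B_def[symmetric] r_def[symmetric]
      krylov norm_eq by auto
  have span_carrier: "v \<in> carrier_vec n" if "v \<in> span (S l)" for v l
    using span_closed[OF S] that by blast
  have xc: "x l \<in> carrier_vec n" for l using xl[of l] x0 span_carrier by auto
  have step: "nn (r (x (Suc l))) \<le> q * nn (r (x l))" for l
  proof -
    obtain v where v: "v \<in> span (S l)" "x l = x0 + v" using xl[of l] by blast
    have vc: "v \<in> carrier_vec n" using v span_carrier by blast
    \<comment> \<open>The difference is written as a sum with the multiple by \<open>-1\<close>, the
      form in which closure of a span applies.\<close>
    have rl: "r (x l) = r x0 + (-1) \<cdot>\<^sub>v (B *\<^sub>v v)"
      using v(2) vc x0 B P b by (auto simp: r_eq mult_add_distrib_mat_vec[of _ n n])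
    have sub: "S l \<subseteq> S (Suc l)" by (auto simp: S_def)
    have "r x0 \<in> S (Suc l)" using r0 B unfolding S_def by (intro CollectI exI[of _ 0]) auto
    then have "r x0 \<in> span (S (Suc l))" using in_own_span[OF S] by blast
    moreover have "B *\<^sub>v v \<in> span (S (Suc l))"
      using krylov_mult[OF B r0] v(1) unfolding S_def by blast
    ultimately have rs: "r (x l) \<in> span (S (Suc l))"
      unfolding rl using S by (intro span_add1 smult_in_span) auto
    \<comment> \<open>This \<open>t\<close> minimizes \<open>1 - 2 * t * c1 + t^2 * c2^2\<close>,
      the guaranteed reduction of the squared residual.\<close>
    define t where "t = c1 / c2\<^sup>2"
    have "v + t \<cdot>\<^sub>v r (x l) \<in> span (S (Suc l))"
      using rs S v(1) span_is_monotone[OF sub] by (intro span_add1 smult_in_span) auto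
    moreover have "x l + t \<cdot>\<^sub>v r (x l) = x0 + (v + t \<cdot>\<^sub>v r (x l))"
      using v(2) vc x0 r_carrier[OF xc[of l]] by auto
    ultimately have "sqrt (nn (r (x (Suc l)))) \<le> sqrt (nn (r (x l + t \<cdot>\<^sub>v r (x l))))"
      by (intro min) auto
    then have "nn (r (x (Suc l))) \<le> nn (r (x l + t \<cdot>\<^sub>v r (x l)))" by simp
    also have "r (x l + t \<cdot>\<^sub>v r (x l)) = r (x l) - t \<cdot>\<^sub>v (B *\<^sub>v r (x l))"
    proof -
      have "B *\<^sub>v (x l + t \<cdot>\<^sub>v r (x l)) = B *\<^sub>v x l + t \<cdot>\<^sub>v (B *\<^sub>v r (x l))"
        using B xc[of l] r_carrier[OF xc[of l]]
        by (simp add: mult_add_distrib_mat_vec[of _ n n] mult_mat_vec[of _ n n])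
      then show ?thesis using B P b xc[of l] r_carrier[OF xc[of l]]
        by (subst (1 2) r_eq) auto
    qed
    also have "nn \<dots> \<le> q * nn (r (x l))"
      unfolding expand[OF r_carrier[OF xc] mult_mat_vec_carrier[OF B r_carrier[OF xc]]] t_def
      using r_carrier[OF xc[of l]] c q by (intro min_residual_step nn_nonneg B_nn nn_B)
    finally show ?thesis .
  qed
  have "nn (r (x l)) \<le> q ^ l * nn (r (x 0))"
  proof (induction l)
    case (Suc l)
    have "nn (r (x (Suc l))) \<le> q * (q ^ l * nn (r (x 0)))"
      using step[of l] Suc q(2) by (meson mult_left_mono less_imp_le order_trans)
    then show ?case by simp
  qed simp
  then have "sqrt (nn (r (x l))) \<le> sqrt (q ^ l * nn (r (x 0)))" by simp
  also have "\<dots> = sqrt (q ^ l) * sqrt (nn (r (x 0)))" by (simp add: real_sqrt_mult)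
  also have "sqrt (q ^ l) = q powr (real l / 2)"
    using q(2) by (simp add: powr_half_sqrt[symmetric] powr_realpow[symmetric] powr_powr)
  finally show ?thesis unfolding norm_eq[symmetric] r_def P_def .
qed

section \<open>Householder blocks\<close>

lemma norm_matrix_le_sum:
  fixes A :: "real^'n^'m"
  shows "norm A \<le> (\<Sum>i\<in>UNIV. \<Sum>j\<in>UNIV. \<bar>A $ i $ j\<bar>)"
proof -
  have "norm A \<le> (\<Sum>i\<in>UNIV. norm (A $ i))"
    unfolding norm_vec_def by (intro L2_set_le_sum) auto
  also have "\<dots> \<le> (\<Sum>i\<in>UNIV. \<Sum>j\<in>UNIV. \<bar>A $ i $ j\<bar>)"
    by (intro sum_mono norm_le_l1_cart)
  finally show ?thesis .
qed

lemma norm_matrix_vector_le: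
  fixes A :: "real^'n^'m"
  shows "norm (A *v x) \<le> norm A * norm x"
proof -
  have "norm (A *v x) = L2_set (\<lambda>i. \<bar>inner (A $ i) x\<bar>) UNIV"
    by (simp add: norm_vec_def matrix_vector_mul_component)
  also have "\<dots> \<le> L2_set (\<lambda>i. norm (A $ i) * norm x) UNIV"
    by (intro L2_set_mono Cauchy_Schwarz_ineq2) auto
  also have "\<dots> = norm A * norm x"
    by (simp add: norm_vec_def L2_set_left_distrib)
  finally show ?thesis .
qed

lemma norm_reflection:
  fixes w v :: "'a::real_inner"
  assumes "norm w = 1"
  shows "norm (v - (2 * inner w v) *\<^sub>R w) = norm v"
proof -
  have "inner w w = 1" using assms by (simp add: norm_eq_1)
  then have "inner (v - (2 * inner w v) *\<^sub>R w) (v - (2 * inner w v) *\<^sub>R w) = inner v v"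
    by (simp add: inner_diff_left inner_diff_right inner_commute[of v w])
  then show ?thesis by (simp add: norm_eq_sqrt_inner)
qed

lemma outer_product_mult:
  fixes w v :: "real^'n"
  shows "(\<chi> i j. w $ i * w $ j) *v v = inner w v *\<^sub>R w"
  by (simp add: Finite_Cartesian_Product.vec_eq_iff matrix_vector_mult_def inner_vec_def sum_distrib_left mult_ac)

text \<open>The exceptional value at \<open>- axis 3 1\<close> is the diagonal matrix with entries
  1, 1, -1, which is the reflection with \<open>w = axis 3 1\<close>. Norm preservation can then be
  shown without distinguishing cases.\<close>

lemma householder_eq_reflection:
  obtains w where "norm w = 1" "householder m = Finite_Cartesian_Product.mat 1 - 2 *\<^sub>R (\<chi> i j. w $ i * w $ j)"
proof (cases "m = - axis 3 1")
  case True
  have "(transpose (vector [axis 1 1, axis 2 1, - axis 3 1]) :: real^3^3) $ i $ j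
    = (Finite_Cartesian_Product.mat 1 - 2 *\<^sub>R (\<chi> i j. axis 3 1 $ i * axis 3 1 $ j)) $ i $ j" for i j
    using exhaust_3[of i] exhaust_3[of j]
    by (auto simp: transpose_def vector_3 axis_def Finite_Cartesian_Product.mat_def)
  then have "(transpose (vector [axis 1 1, axis 2 1, - axis 3 1]) :: real^3^3)
    = Finite_Cartesian_Product.mat 1 - 2 *\<^sub>R (\<chi> i j. axis 3 1 $ i * axis 3 1 $ j)"
    by (metis Finite_Cartesian_Product.vec_eq_iff)
  then show ?thesis using True by (intro that[of "axis 3 1"]) (auto simp: householder_def)
next
  case False
  then have "m + axis 3 1 \<noteq> 0" by (metis add.commute add_eq_0_iff minus_minus)
  then show ?thesis using False
    by (intro that[of "(m + axis 3 1) /\<^sub>R norm (m + axis 3 1)"]) (simp_all add: householder_def Let_def)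
qed

lemma norm_householder: "norm (householder m *v v) = norm v"
proof -
  obtain w where w: "norm w = 1" "householder m = Finite_Cartesian_Product.mat 1 - 2 *\<^sub>R (\<chi> i j. w $ i * w $ j)"
    by (rule householder_eq_reflection)
  have "householder m *v v = v - (2 * inner w v) *\<^sub>R w"
    by (simp add: w(2) matrix_vector_mult_diff_rdistrib scaleR_matrix_vector_assoc[symmetric] outer_product_mult)
  then show ?thesis using norm_reflection[OF w(1)] by simp
qed

lemma H_block_mult:
  "H_block m *v x = householder m *v (x $ 1 *\<^sub>R axis 1 1 + x $ 2 *\<^sub>R axis 2 1)"
  by (simp add: H_block_def Finite_Cartesian_Product.vec_eq_iff matrix_vector_mult_def transpose_def sum_2 sum_3 forall_3
      axis_def vector_2 algebra_simps)

text \<open>The block embeds the plane into the first two coordinates and then reflects. Hence the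
  nodal norm depends on the coefficients alone, and coefficients can be estimated through the
  function they represent.\<close>

lemma norm_H_block: "norm (H_block m *v x) = norm x"
proof -
  have "norm (x $ 1 *\<^sub>R axis 1 1 + x $ 2 *\<^sub>R axis 2 1 :: R3) = norm x"
    by (simp add: norm_vec_def L2_set_def sum_2 sum_3 axis_def)
  then show ?thesis by (simp add: H_block_mult norm_householder)
qed

text \<open>The squared norm of \<open>m + axis 3 1\<close> is \<open>2 * s\<close> for a unit
  vector, so the normalization by a square root disappears and the entries are rational in
  \<open>m\<close>. In the last row the third component of \<open>m + axis 3 1\<close> cancels the
  denominator; only the upper four entries are singular as \<open>s\<close> tends to 0.\<close>

lemma H_block_entries:
  assumes "norm m = 1" "1 + m $ 3 > 0"
  defines "s \<equiv> 1 + m $ 3"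
  shows "H_block m $ 1 $ 1 = 1 - m $ 1 * m $ 1 / s" "H_block m $ 1 $ 2 = - (m $ 1 * m $ 2 / s)"
    "H_block m $ 2 $ 1 = - (m $ 2 * m $ 1 / s)" "H_block m $ 2 $ 2 = 1 - m $ 2 * m $ 2 / s"
    "H_block m $ 3 $ 1 = - (m $ 1)" "H_block m $ 3 $ 2 = - (m $ 2)"
proof -
  have ne: "m \<noteq> - axis 3 1" using assms by (auto simp: axis_def)
  have "inner m m = 1" using assms by (simp add: norm_eq_1)
  then have sq: "m $ 1 * m $ 1 + m $ 2 * m $ 2 + m $ 3 * m $ 3 = 1"
    by (simp add: inner_vec_def sum_3)
  define d where "d = norm (m + axis 3 1)"
  have "d\<^sup>2 = inner (m + axis 3 1) (m + axis 3 1)" by (simp add: d_def power2_norm_eq_inner)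
  also have "\<dots> = 2 * s" using sq by (simp add: inner_vec_def sum_3 axis_def s_def algebra_simps)
  finally have d: "d * d = 2 * s" by (simp add: power2_eq_square)
  have s: "s > 0" using assms by simp
  have d0: "d \<noteq> 0" using d s by auto
  have e: "2 * ((a / d) * (b / d)) = a * b / s" for a b
    using d d0 s by (simp add: field_simps)
  have ent: "householder m $ i $ j = (if i = j then 1 else 0) - (m + axis 3 1) $ i * (m + axis 3 1) $ j / s" for i j
    using ne e[of "(m + axis 3 1) $ i" "(m + axis 3 1) $ j"]
    by (simp add: householder_def Let_def d_def[symmetric] Finite_Cartesian_Product.mat_def divide_inverse mult_ac)
  have H: "H_block m $ i $ 1 = householder m $ i $ 1" "H_block m $ i $ 2 = householder m $ i $ 2" for i
    by (simp_all add: H_block_def transpose_def vector_2 matrix_vector_mult_def axis_def sum_3)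
  show "H_block m $ 1 $ 1 = 1 - m $ 1 * m $ 1 / s" "H_block m $ 1 $ 2 = - (m $ 1 * m $ 2 / s)"
    "H_block m $ 2 $ 1 = - (m $ 2 * m $ 1 / s)" "H_block m $ 2 $ 2 = 1 - m $ 2 * m $ 2 / s"
    "H_block m $ 3 $ 1 = - (m $ 1)" "H_block m $ 3 $ 2 = - (m $ 2)"
    using s by (simp_all add: H ent axis_def) (auto simp: s_def field_simps)
qed

text \<open>The quotients \<open>q = p / s\<close> are bounded although \<open>s\<close> may be small; differencing \<open>q * s = p\<close>
  instead of the quotient saves a power of \<open>1 / \<gamma>\<close>.\<close>

lemma quotient_difference:
  fixes p p' s s' \<gamma> \<epsilon> :: real
  assumes "\<gamma> > 0" "s \<ge> \<gamma>" "s' \<ge> \<gamma>" "\<bar>p'\<bar> \<le> 2 * s'" "\<bar>p - p'\<bar> \<le> 2 * \<epsilon>" "\<bar>s - s'\<bar> \<le> \<epsilon>"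
  shows "\<bar>p / s - p' / s'\<bar> \<le> 4 * \<epsilon> / \<gamma>"
proof -
  define q q' where "q = p / s" and "q' = p' / s'"
  have pq: "p = q * s" "p' = q' * s'" using assms by (auto simp: q_def q'_def)
  have q': "\<bar>q'\<bar> \<le> 2" using assms by (simp add: q'_def abs_divide field_simps)
  have "\<epsilon> \<ge> 0" using assms by linarith
  have "\<bar>q - q'\<bar> * \<gamma> \<le> \<bar>q - q'\<bar> * s" using assms by (intro mult_left_mono) auto
  also have "\<bar>q - q'\<bar> * s = \<bar>(q - q') * s\<bar>" using assms by (simp add: abs_mult)
  also have "(q - q') * s = (p - p') - q' * (s - s')" by (simp add: pq algebra_simps)
  also have "\<bar>(p - p') - q' * (s - s')\<bar> \<le> \<bar>p - p'\<bar> + \<bar>q' * (s - s')\<bar>" by linarith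
  also have "\<dots> \<le> \<bar>p - p'\<bar> + \<bar>q'\<bar> * \<bar>s - s'\<bar>" by (simp add: abs_mult)
  also have "\<dots> \<le> 2 * \<epsilon> + 2 * \<epsilon>" using assms q' \<open>\<epsilon> \<ge> 0\<close> by (intro add_mono mult_mono) auto
  finally show ?thesis using assms by (simp add: q_def q'_def field_simps)
qed

text \<open>A product rule for the second difference over four points \<open>a\<close>,
  \<open>b\<close>, \<open>c\<close>, \<open>d\<close>. The second claim solves the same identity
  for the term with the mixed difference of \<open>x\<close>; with \<open>x\<close> a quotient and
  \<open>y\<close> its denominator, it turns control of the numerators into control of the
  quotients.\<close>

lemma product_mixed_difference:
  fixes xa :: real
  assumes "\<bar>xd\<bar> \<le> K" "\<bar>ya\<bar> \<le> L" "\<bar>xa - xb - xc + xd\<bar> \<le> X" "\<bar>ya - yb - yc + yd\<bar> \<le> Y"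
    "\<bar>xb - xd\<bar> \<le> e1" "\<bar>ya - yb\<bar> \<le> D1" "\<bar>xc - xd\<bar> \<le> D2" "\<bar>ya - yc\<bar> \<le> e2"
  shows "\<bar>xa * ya - xb * yb - xc * yc + xd * yd\<bar> \<le> X * L + e1 * D1 + D2 * e2 + K * Y"
    (is "?P \<le> _") and
    "\<bar>(xa - xb - xc + xd) * ya\<bar> \<le> \<bar>xa * ya - xb * yb - xc * yc + xd * yd\<bar> + e1 * D1 + D2 * e2 + K * Y"
proof -
  have id: "xa * ya - xb * yb - xc * yc + xd * yd = (xa - xb - xc + xd) * ya + (xb - xd) * (ya - yb)
    + (xc - xd) * (ya - yc) + xd * (ya - yb - yc + yd)"
    by (simp add: algebra_simps)
  have 1: "\<bar>(xa - xb - xc + xd) * ya\<bar> \<le> X * L" using assms unfolding abs_mult by (intro mult_mono) auto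
  have 2: "\<bar>(xb - xd) * (ya - yb)\<bar> \<le> e1 * D1" using assms unfolding abs_mult by (intro mult_mono) auto
  have 3: "\<bar>(xc - xd) * (ya - yc)\<bar> \<le> D2 * e2" using assms unfolding abs_mult by (intro mult_mono) auto
  have 4: "\<bar>xd * (ya - yb - yc + yd)\<bar> \<le> K * Y" using assms unfolding abs_mult by (intro mult_mono) auto
  show "?P \<le> X * L + e1 * D1 + D2 * e2 + K * Y" unfolding id using 1 2 3 4 by linarith
  show "\<bar>(xa - xb - xc + xd) * ya\<bar> \<le> ?P + e1 * D1 + D2 * e2 + K * Y" using id 2 3 4 by linarith
qed

text \<open>The second form of the product rule is applied to the quotients and their denominators,
  where the products are just the numerators. The two products of first differences contribute
  \<open>8 * \<epsilon> * D / \<gamma>\<close>; a final division by \<gamma> gives the square in the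
  denominator.\<close>

lemma quotient_mixed_difference:
  fixes pa :: real
  assumes g: "\<gamma> > 0" "\<gamma> \<le> 2" and s: "sa \<ge> \<gamma>" "sb \<ge> \<gamma>" "sc \<ge> \<gamma>" "sd \<ge> \<gamma>"
    and p: "\<bar>pd\<bar> \<le> 2 * sd" and P: "\<bar>pa - pb - pc + pd\<bar> \<le> 2 * \<eta> + 2 * \<epsilon> * D"
    and S: "\<bar>sa - sb - sc + sd\<bar> \<le> \<eta>"
    and d: "\<bar>pb - pd\<bar> \<le> 2 * \<epsilon>" "\<bar>sb - sd\<bar> \<le> \<epsilon>" "\<bar>sa - sb\<bar> \<le> D"
      "\<bar>pc - pd\<bar> \<le> 2 * D" "\<bar>sc - sd\<bar> \<le> D" "\<bar>sa - sc\<bar> \<le> \<epsilon>"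
  shows "\<bar>pa / sa - pb / sb - pc / sc + pd / sd\<bar> \<le> 4 * \<eta> / \<gamma> + 12 * \<epsilon> * D / \<gamma>\<^sup>2"
proof -
  define q where "q = pa / sa - pb / sb - pc / sc + pd / sd"
  have e: "\<epsilon> \<ge> 0" "D \<ge> 0" using d by linarith+
  have qd: "\<bar>pd / sd\<bar> \<le> 2" using p s g by (simp add: abs_divide field_simps)
  have b: "\<bar>pb / sb - pd / sd\<bar> \<le> 4 * \<epsilon> / \<gamma>" using g s p d by (intro quotient_difference) auto
  have c: "\<bar>pc / sc - pd / sd\<bar> \<le> 4 * D / \<gamma>" using g s p d by (intro quotient_difference) auto
  have "\<bar>q\<bar> * \<gamma> \<le> \<bar>q * sa\<bar>" using g s by (simp add: abs_mult mult_left_mono)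
  also have "\<dots> \<le> \<bar>pa / sa * sa - pb / sb * sb - pc / sc * sc + pd / sd * sd\<bar>
    + (4 * \<epsilon> / \<gamma>) * D + (4 * D / \<gamma>) * \<epsilon> + 2 * \<eta>"
    unfolding q_def using product_mixed_difference(2)[OF qd order_refl order_refl S b d(3) c d(6)] .
  also have "\<dots> = \<bar>pa - pb - pc + pd\<bar> + 8 * \<epsilon> * D / \<gamma> + 2 * \<eta>" using g s by simp
  also have "\<dots> \<le> 4 * \<eta> + 2 * \<epsilon> * D + 8 * \<epsilon> * D / \<gamma>" using P by simp
  \<comment> \<open>The bound \<open>\<gamma> \<le> 2\<close> merges the contribution of the
    numerators with \<open>8 * \<epsilon> * D / \<gamma>\<close>, which explains the constant
    12.\<close>
  also have "2 * \<epsilon> * D \<le> 4 * \<epsilon> * D / \<gamma>"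
    using g mult_right_mono[of \<gamma> 2 "\<epsilon> * D"] e by (simp add: field_simps)
  finally have "\<bar>q\<bar> * \<gamma> \<le> 4 * \<eta> + 12 * \<epsilon> * D / \<gamma>" by (simp add: algebra_simps)
  then show ?thesis using g unfolding q_def[symmetric] by (simp add: field_simps power2_eq_square)
qed

text \<open>On the unit sphere \<open>m1^2 + m2^2 = (1 - m3) * (1 + m3)\<close>. The numerators thus
  vanish together with the denominator near \<open>- axis 3 1\<close>, and the quotients in
  \<open>H_block\<close> stay bounded by 2 independently of \<gamma>.\<close>

lemma unit_products_le:
  fixes m :: R3
  assumes "norm m = 1" "i \<in> {1, 2}" "j \<in> {1, 2}"
  shows "\<bar>m $ i * m $ j\<bar> \<le> 2 * (1 + m $ 3)"
proof -
  have "inner m m = 1" using assms by (simp add: norm_eq_1)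
  then have sq: "m $ 1 * m $ 1 + m $ 2 * m $ 2 = (1 - m $ 3) * (1 + m $ 3)"
    by (simp add: inner_vec_def sum_3 algebra_simps)
  have m3: "\<bar>m $ 3\<bar> \<le> 1" using component_le_norm_cart[of m 3] assms by simp
  have "\<bar>m $ i * m $ j\<bar> \<le> m $ 1 * m $ 1 + m $ 2 * m $ 2"
  proof -
    have "2 * (\<bar>m $ 1\<bar> * \<bar>m $ 2\<bar>) \<le> m $ 1 * m $ 1 + m $ 2 * m $ 2"
      using sum_squares_bound[of "\<bar>m $ 1\<bar>" "\<bar>m $ 2\<bar>"] by (simp add: power2_eq_square mult.assoc)
    moreover have "0 \<le> \<bar>m $ 1\<bar> * \<bar>m $ 2\<bar>" by simp
    ultimately have "\<bar>m $ 1 * m $ 2\<bar> \<le> m $ 1 * m $ 1 + m $ 2 * m $ 2" unfolding abs_mult by linarith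
    then show ?thesis using assms(2,3) by (auto simp: mult.commute abs_mult)
  qed
  also have "\<dots> \<le> 2 * (1 + m $ 3)" unfolding sq using m3 by (intro mult_right_mono) auto
  finally show ?thesis .
qed

lemma product_difference_le:
  fixes x y :: real
  assumes "\<bar>x\<bar> \<le> 1" "\<bar>y'\<bar> \<le> 1" "\<bar>x - x'\<bar> \<le> e" "\<bar>y - y'\<bar> \<le> e"
  shows "\<bar>x * y - x' * y'\<bar> \<le> 2 * e"
proof -
  have "x * y - x' * y' = x * (y - y') + (x - x') * y'" by (simp add: algebra_simps)
  moreover have "\<bar>x * (y - y')\<bar> \<le> 1 * e" unfolding abs_mult using assms by (intro mult_mono) auto
  moreover have "\<bar>(x - x') * y'\<bar> \<le> e * 1" unfolding abs_mult using assms by (intro mult_mono) auto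
  ultimately show ?thesis by linarith
qed

lemma component_bounds:
  fixes a b :: R3
  shows "norm a = 1 \<Longrightarrow> \<bar>a $ i\<bar> \<le> 1" "norm (a - b) \<le> e \<Longrightarrow> \<bar>a $ i - b $ i\<bar> \<le> e"
  using component_le_norm_cart[of a i] component_le_norm_cart[of "a - b" i] by auto

text \<open>Because the quotients are bounded, a single power of \<open>1 / \<gamma>\<close>
  suffices. The constant 24 is the number of entries times the bound 4 for one quotient.\<close>

lemma H_block_lipschitz:
  assumes m: "norm m = 1" "norm \<mu> = 1" and g: "\<gamma> > 0" "1 + m $ 3 \<ge> \<gamma>" "1 + \<mu> $ 3 \<ge> \<gamma>"
    and e: "norm (\<mu> - m) \<le> \<epsilon>"
  shows "norm (H_block \<mu> - H_block m) \<le> 24 * \<epsilon> / \<gamma>"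
proof -
  have pos: "1 + m $ 3 > 0" "1 + \<mu> $ 3 > 0" using g by linarith+
  note H = H_block_entries[OF m(1) pos(1)] H_block_entries[OF m(2) pos(2)]
  have q: "\<bar>\<mu> $ i * \<mu> $ j / (1 + \<mu> $ 3) - m $ i * m $ j / (1 + m $ 3)\<bar> \<le> 4 * \<epsilon> / \<gamma>"
    if "i \<in> {1, 2}" "j \<in> {1, 2}" for i j
    using g m e unit_products_le[OF m(1) that] component_bounds(2)[OF e]
    by (intro quotient_difference product_difference_le component_bounds) auto
  \<comment> \<open>The third component of a unit vector is at most 1. This lets the linear entries
    of the last row share the bound of the quotients.\<close>
  have "\<gamma> \<le> 2" using g component_bounds(1)[OF m(1), of 3] by linarith
  moreover have "\<epsilon> \<ge> 0" using e norm_ge_zero order_trans by blast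
  ultimately have "\<epsilon> * \<gamma> \<le> \<epsilon> * 4" by (intro mult_left_mono) auto
  then have e': "\<epsilon> \<le> 4 * \<epsilon> / \<gamma>" using g by (simp add: field_simps)
  have l: "\<bar>\<mu> $ i - m $ i\<bar> \<le> 4 * \<epsilon> / \<gamma>" for i
    using component_bounds(2)[OF e, of i] e' by linarith
  have "norm (H_block \<mu> - H_block m) \<le> (\<Sum>i\<in>UNIV. \<Sum>j\<in>UNIV. \<bar>(H_block \<mu> - H_block m) $ i $ j\<bar>)"
    by (rule norm_matrix_le_sum)
  also have "\<dots> \<le> 6 * (4 * \<epsilon> / \<gamma>)"
    using q[of 1 1] q[of 1 2] q[of 2 1] q[of 2 2] l[of 1] l[of 2]
    by (simp add: sum_2 sum_3 H abs_minus_commute)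
  finally show ?thesis by simp
qed

text \<open>Here \<open>a\<close>, \<open>b\<close> are the values of one field at two nodes and
  \<open>c\<close>, \<open>d\<close> those of the other field. The distance of the fields is
  measured by \<epsilon>, their variation between the nodes by \<open>D\<close>, and the variation
  of their difference by \<eta>. The term with \<eta> is of first order; the product
  \<open>\<epsilon> * D\<close> accounts for the curvature of the map from a unit vector to its
  block.\<close>

lemma H_block_mixed_difference:
  fixes a b c d :: R3
  assumes n: "norm a = 1" "norm b = 1" "norm c = 1" "norm d = 1"
    and g: "\<gamma> > 0" "1 + a $ 3 \<ge> \<gamma>" "1 + b $ 3 \<ge> \<gamma>" "1 + c $ 3 \<ge> \<gamma>" "1 + d $ 3 \<ge> \<gamma>"
    and e: "norm (a - c) \<le> \<epsilon>" "norm (b - d) \<le> \<epsilon>"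
    and D: "norm (a - b) \<le> D" "norm (c - d) \<le> D"
    and h: "norm (a - b - c + d) \<le> \<eta>"
  shows "norm (H_block a - H_block b - H_block c + H_block d) \<le> 24 * \<eta> / \<gamma> + 72 * \<epsilon> * D / \<gamma>\<^sup>2"
proof -
  have pos: "1 + a $ 3 > 0" "1 + b $ 3 > 0" "1 + c $ 3 > 0" "1 + d $ 3 > 0" using g by linarith+
  note H = H_block_entries[OF n(1) pos(1)] H_block_entries[OF n(2) pos(2)]
    H_block_entries[OF n(3) pos(3)] H_block_entries[OF n(4) pos(4)]
  have \<gamma>2: "\<gamma> \<le> 2" using g component_bounds(1)[OF n(1), of 3] by linarith
  have nn: "\<epsilon> \<ge> 0" "D \<ge> 0" "\<eta> \<ge> 0" using e D h norm_ge_zero order_trans by blast+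
  have h': "\<bar>a $ i - b $ i - c $ i + d $ i\<bar> \<le> \<eta>" for i
    using component_le_norm_cart[of "a - b - c + d" i] h by simp
  note cb = component_bounds(2)[OF e(1)] component_bounds(2)[OF e(2)]
    component_bounds(2)[OF D(1)] component_bounds(2)[OF D(2)]
  have q: "\<bar>a $ i * a $ j / (1 + a $ 3) - b $ i * b $ j / (1 + b $ 3) - c $ i * c $ j / (1 + c $ 3)
      + d $ i * d $ j / (1 + d $ 3)\<bar> \<le> 4 * \<eta> / \<gamma> + 12 * \<epsilon> * D / \<gamma>\<^sup>2"
    if "i \<in> {1, 2}" "j \<in> {1, 2}" for i j
  proof (rule quotient_mixed_difference)
    have "\<bar>a $ i * a $ j - b $ i * b $ j - c $ i * c $ j + d $ i * d $ j\<bar> \<le> \<eta> * 1 + \<epsilon> * D + D * \<epsilon> + 1 * \<eta>"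
      by (rule product_mixed_difference(1)[OF component_bounds(1)[OF n(4)] component_bounds(1)[OF n(1)]
        h' h' cb(2) cb(3) cb(4) cb(1)])
    then show "\<bar>a $ i * a $ j - b $ i * b $ j - c $ i * c $ j + d $ i * d $ j\<bar> \<le> 2 * \<eta> + 2 * \<epsilon> * D"
      by (simp add: mult_ac)
    show "\<bar>b $ i * b $ j - d $ i * d $ j\<bar> \<le> 2 * \<epsilon>" "\<bar>c $ i * c $ j - d $ i * d $ j\<bar> \<le> 2 * D"
      using n cb by (intro product_difference_le component_bounds(1); simp)+
    show "\<bar>d $ i * d $ j\<bar> \<le> 2 * (1 + d $ 3)" using unit_products_le[OF n(4) that] .
  qed (use g \<gamma>2 h'[of 3] cb[of 3] in auto)
  have "\<eta> * \<gamma> \<le> \<eta> * 4" using nn \<gamma>2 by (intro mult_left_mono) auto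
  then have "\<eta> \<le> 4 * \<eta> / \<gamma>" using g by (simp add: field_simps)
  moreover have "0 \<le> 12 * \<epsilon> * D / \<gamma>\<^sup>2" using nn by simp
  ultimately have l: "\<bar>a $ i - b $ i - c $ i + d $ i\<bar> \<le> 4 * \<eta> / \<gamma> + 12 * \<epsilon> * D / \<gamma>\<^sup>2" for i
    using h'[of i] by linarith
  define B where "B = 4 * \<eta> / \<gamma> + 12 * \<epsilon> * D / \<gamma>\<^sup>2"
  define M where "M = H_block a - H_block b - H_block c + H_block d"
  have M: "M $ 1 $ 1 = - (a $ 1 * a $ 1 / (1 + a $ 3) - b $ 1 * b $ 1 / (1 + b $ 3) - c $ 1 * c $ 1 / (1 + c $ 3) + d $ 1 * d $ 1 / (1 + d $ 3))"
    "M $ 1 $ 2 = - (a $ 1 * a $ 2 / (1 + a $ 3) - b $ 1 * b $ 2 / (1 + b $ 3) - c $ 1 * c $ 2 / (1 + c $ 3) + d $ 1 * d $ 2 / (1 + d $ 3))"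
    "M $ 2 $ 1 = - (a $ 2 * a $ 1 / (1 + a $ 3) - b $ 2 * b $ 1 / (1 + b $ 3) - c $ 2 * c $ 1 / (1 + c $ 3) + d $ 2 * d $ 1 / (1 + d $ 3))"
    "M $ 2 $ 2 = - (a $ 2 * a $ 2 / (1 + a $ 3) - b $ 2 * b $ 2 / (1 + b $ 3) - c $ 2 * c $ 2 / (1 + c $ 3) + d $ 2 * d $ 2 / (1 + d $ 3))"
    "M $ 3 $ 1 = - (a $ 1 - b $ 1 - c $ 1 + d $ 1)" "M $ 3 $ 2 = - (a $ 2 - b $ 2 - c $ 2 + d $ 2)"
    by (simp_all add: M_def H)
  have ent: "\<bar>M $ 1 $ 1\<bar> \<le> B" "\<bar>M $ 1 $ 2\<bar> \<le> B" "\<bar>M $ 2 $ 1\<bar> \<le> B" "\<bar>M $ 2 $ 2\<bar> \<le> B"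
    "\<bar>M $ 3 $ 1\<bar> \<le> B" "\<bar>M $ 3 $ 2\<bar> \<le> B"
    unfolding M abs_minus_cancel B_def by (rule q l; simp)+
  have "norm M \<le> (\<Sum>i\<in>UNIV. \<Sum>j\<in>UNIV. \<bar>M $ i $ j\<bar>)" by (rule norm_matrix_le_sum)
  also have "\<dots> \<le> 6 * B" using ent by (simp add: sum_2 sum_3)
  finally show ?thesis by (simp add: M_def B_def)
qed

text \<open>The vectors \<open>x\<close> and \<open>x'\<close> are the coefficients at the two
  nodes. The difference of the two frames acts on a common \<open>x\<close> through the mixed
  difference, and on \<open>x - x'\<close> through the Lipschitz bound at one node. The constant 648
  is \<open>72 + 24 * 24\<close>, the second summand coming from the estimate of
  \<open>x - x'\<close>.\<close>

lemma H_block_pair_difference: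
  fixes m m' \<mu> \<mu>' :: R3 and x x' :: "real^2"
  assumes n: "norm m = 1" "norm m' = 1" "norm \<mu> = 1" "norm \<mu>' = 1"
    and g: "\<gamma> > 0" "1 + m $ 3 \<ge> \<gamma>" "1 + m' $ 3 \<ge> \<gamma>" "1 + \<mu> $ 3 \<ge> \<gamma>" "1 + \<mu>' $ 3 \<ge> \<gamma>"
    and e: "norm (\<mu> - m) \<le> \<epsilon>" "norm (\<mu>' - m') \<le> \<epsilon>"
    and D: "norm (m - m') \<le> D" "norm (\<mu> - \<mu>') \<le> D"
    and h: "norm ((\<mu> - m) - (\<mu>' - m')) \<le> \<eta>"
  shows "norm ((H_block \<mu> *v x - H_block m *v x) - (H_block \<mu>' *v x' - H_block m' *v x'))
    \<le> (24 * \<eta> / \<gamma> + 648 * \<epsilon> * D / \<gamma>\<^sup>2) * norm x + 24 * \<epsilon> / \<gamma> * norm (H_block m *v x - H_block m' *v x')"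
proof -
  define G G' where "G = H_block \<mu> - H_block m" and "G' = H_block \<mu>' - H_block m'"
  have nn: "\<epsilon> \<ge> 0" "D \<ge> 0" "\<eta> \<ge> 0" using e D h norm_ge_zero order_trans by blast+
  have "norm (\<mu> - \<mu>' - m + m') \<le> \<eta>" using h by (simp add: algebra_simps)
  then have "norm (H_block \<mu> - H_block \<mu>' - H_block m + H_block m') \<le> 24 * \<eta> / \<gamma> + 72 * \<epsilon> * D / \<gamma>\<^sup>2"
    using n g e D by (intro H_block_mixed_difference) auto
  also have "H_block \<mu> - H_block \<mu>' - H_block m + H_block m' = G - G'" by (simp add: G_def G'_def)
  finally have 1: "norm (G - G') \<le> 24 * \<eta> / \<gamma> + 72 * \<epsilon> * D / \<gamma>\<^sup>2" .
  have 2: "norm G' \<le> 24 * \<epsilon> / \<gamma>" unfolding G'_def using n g e by (intro H_block_lipschitz) auto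
  have 3: "norm (H_block m' - H_block m) \<le> 24 * D / \<gamma>"
    using n g D by (intro H_block_lipschitz) (auto simp: norm_minus_commute)
  \<comment> \<open>The isometry turns the increment of the coefficients into an increment of the
    represented function, up to the rotation of the frame between the nodes.\<close>
  have "norm (x - x') = norm (H_block m' *v (x - x'))" by (simp add: norm_H_block)
  also have "H_block m' *v (x - x') = (H_block m' - H_block m) *v x + (H_block m *v x - H_block m' *v x')"
    by (simp add: matrix_vector_mult_diff_distrib matrix_vector_mult_diff_rdistrib)
  also have "norm \<dots> \<le> norm ((H_block m' - H_block m) *v x) + norm (H_block m *v x - H_block m' *v x')"
    by (rule norm_triangle_ineq)
  also have "norm ((H_block m' - H_block m) *v x) \<le> 24 * D / \<gamma> * norm x"
    using norm_matrix_vector_le[of "H_block m' - H_block m" x] 3 by (meson mult_right_mono norm_ge_zero order_trans)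
  finally have 4: "norm (x - x') \<le> 24 * D / \<gamma> * norm x + norm (H_block m *v x - H_block m' *v x')" by simp
  have "(H_block \<mu> *v x - H_block m *v x) - (H_block \<mu>' *v x' - H_block m' *v x') = (G - G') *v x + G' *v (x - x')"
    by (simp add: G_def G'_def matrix_vector_mult_diff_distrib matrix_vector_mult_diff_rdistrib)
  also have "norm \<dots> \<le> norm ((G - G') *v x) + norm (G' *v (x - x'))" by (rule norm_triangle_ineq)
  also have "\<dots> \<le> norm (G - G') * norm x + norm G' * norm (x - x')"
    by (intro add_mono norm_matrix_vector_le)
  also have "\<dots> \<le> (24 * \<eta> / \<gamma> + 72 * \<epsilon> * D / \<gamma>\<^sup>2) * norm x
    + 24 * \<epsilon> / \<gamma> * (24 * D / \<gamma> * norm x + norm (H_block m *v x - H_block m' *v x'))"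
    using 1 2 4 nn g by (intro add_mono mult_mono) auto
  also have "\<dots> = (24 * \<eta> / \<gamma> + 648 * \<epsilon> * D / \<gamma>\<^sup>2) * norm x + 24 * \<epsilon> / \<gamma> * norm (H_block m *v x - H_block m' *v x')"
    by (simp add: algebra_simps power2_eq_square)
  finally show ?thesis .
qed

section \<open>Affine functions on convex sets\<close>

lemma measurable_lebesgue_spike:
  fixes f F :: "R3 \<Rightarrow> 'b::euclidean_space"
  assumes F: "F \<in> borel_measurable lebesgue" and N: "negligible N" and eq: "\<And>x. x \<notin> N \<Longrightarrow> f x = F x"
  shows "f \<in> borel_measurable lebesgue"
proof (rule measurableI)
  fix B :: "'b set" assume B: "B \<in> sets borel"
  have "negligible (f -` B \<inter> N)" using N negligible_subset by blast
  then have 1: "f -` B \<inter> N \<in> sets lebesgue" by (simp add: negligible_imp_sets)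
  have "F -` B \<in> sets lebesgue" using measurable_sets[OF F B] by simp
  then have 2: "F -` B - N \<in> sets lebesgue" using N negligible_imp_sets by blast
  have *: "f -` B \<inter> space lebesgue = (f -` B \<inter> N) \<union> (F -` B - N)" using eq by auto
  show "f -` B \<inter> space lebesgue \<in> sets lebesgue" unfolding * by (intro sets.Un 1 2)
qed auto

lemma measurable_lebesgue_on_spike:
  fixes f F :: "R3 \<Rightarrow> 'b::euclidean_space"
  assumes "S \<in> sets lebesgue" and F: "F \<in> borel_measurable lebesgue" and N: "negligible N"
    and eq: "\<And>x. x \<in> S - N \<Longrightarrow> f x = F x"
  shows "f \<in> borel_measurable (lebesgue_on S)"
proof (rule borel_measurable_if_D, rule measurable_lebesgue_spike[OF _ N])
  show "(\<lambda>x. if x \<in> S then F x else 0) \<in> borel_measurable lebesgue"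
    using borel_measurable_if_I[OF measurable_restrict_space1[OF F] assms(1)] .
qed (use eq in auto)

lemma AE_lebesgue_onI:
  assumes "S \<in> sets lebesgue" "negligible N" "\<And>x. x \<in> S - N \<Longrightarrow> P x"
  shows "AE x in lebesgue_on S. P x"
proof -
  have "N \<in> null_sets lebesgue" using assms(2) by (simp add: negligible_iff_null_sets)
  then have "AE x in lebesgue. x \<notin> N" by (rule AE_not_in)
  then have "AE x in lebesgue. x \<in> S \<longrightarrow> P x" using assms(3) by (auto elim!: eventually_mono)
  then show ?thesis using assms(1) by (subst AE_restrict_space_iff) auto
qed

text \<open>An essential bound excludes the value infinity, which the conversion to reals would send
  to 0, and a space of positive measure excludes negative values. Between these limits
  \<open>Linf_norm\<close> is the true essential supremum.\<close>

lemma Linf_norm_props: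
  assumes f: "f \<in> borel_measurable M" and B: "AE x in M. norm (f x) \<le> B" and ne: "emeasure M (space M) \<noteq> 0"
  shows "Linf_norm M f \<ge> 0" "AE x in M. norm (f x) \<le> Linf_norm M f"
proof -
  let ?g = "\<lambda>x. ereal (norm (f x))"
  have g: "?g \<in> borel_measurable M" using f by measurable
  have "esssup M (\<lambda>x. 0::ereal) \<le> esssup M ?g" by (rule esssup_mono) auto
  then have 0: "0 \<le> esssup M ?g" using esssup_const[OF ne, where c="0::ereal"] by simp
  have 1: "esssup M ?g \<le> ereal B" using B by (intro esssup_I g) auto
  show "Linf_norm M f \<ge> 0" using 0 by (simp add: Linf_norm_def real_of_ereal_pos)
  have eq: "ereal (Linf_norm M f) = esssup M ?g"
    unfolding Linf_norm_def using 0 1 by (intro ereal_real') auto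
  show "AE x in M. norm (f x) \<le> Linf_norm M f"
    using esssup_AE[where f="?g" and M=M] unfolding eq[symmetric] by simp
qed

lemma integrable_continuous_compact:
  fixes f :: "R3 \<Rightarrow> 'b::euclidean_space"
  assumes K: "compact K" and f: "continuous_on UNIV f"
  shows "integrable (lebesgue_on K) f"
proof -
  have Km: "K \<in> lmeasurable" using K by (simp add: lmeasurable_compact)
  interpret finite_measure "lebesgue_on K" using Km by (rule finite_measure_lebesgue_on)
  have fK: "continuous_on K f" using f continuous_on_subset by blast
  then obtain B where "\<And>x. x \<in> K \<Longrightarrow> norm (f x) \<le> B"
    using compact_continuous_image[OF fK K] compact_imp_bounded bounded_iff by (metis imageI)
  then show ?thesis
    using continuous_imp_measurable_on_sets_lebesgue[OF fK] Km
    by (intro integrable_const_bound[of _ B]) (auto simp: fmeasurableD)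
qed

section \<open>Volume estimates for affine functions\<close>

lemma prod_UNIV_3: "prod f (UNIV :: 3 set) = f 1 * f 2 * (f 3 :: real)"
  unfolding UNIV_3 by simp

text \<open>\<open>K\<close> lies in a slab of width \<open>2 * S / norm a\<close>, intersected with a ball of radius \<open>d\<close>.\<close>

lemma slab_measure:
  fixes K :: "R3 set" and a :: R3
  assumes K: "K \<in> lmeasurable" and p: "p \<in> K" and d: "\<And>x. x \<in> K \<Longrightarrow> norm (x - p) \<le> d"
    and S: "\<And>x. x \<in> K \<Longrightarrow> \<bar>inner a x + b\<bar> \<le> S"
  shows "measure lebesgue K * norm a \<le> 8 * S * d\<^sup>2"
proof (cases "a = 0")
  case True
  have "S \<ge> 0" using S[OF p] by linarith
  then show ?thesis using True by simp
next
  case False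
  define e :: R3 where "e = axis 1 1"
  have "norm (a /\<^sub>R norm a) = 1" "norm e = 1" using False by (auto simp: e_def)
  then obtain f :: "R3 \<Rightarrow> R3" where f: "orthogonal_transformation f" "f (a /\<^sub>R norm a) = e"
    using orthogonal_transformation_exists_1 by blast
  have lin: "linear f" using f(1) by (simp add: orthogonal_transformation_def)
  have f1: "f x $ 1 = inner a x / norm a" for x
  proof -
    have "f x $ 1 = inner (f (a /\<^sub>R norm a)) (f x)" unfolding f(2) by (simp add: e_def inner_axis')
    also have "\<dots> = inner (a /\<^sub>R norm a) x" using f(1) by (simp add: orthogonal_transformation_def)
    finally show ?thesis by (simp add: divide_inverse mult.commute)
  qed
  have d0: "d \<ge> 0" using d[OF p] norm_ge_zero order_trans by blast
  have S0: "S \<ge> 0" using S[OF p] by linarith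
  \<comment> \<open>The isometry \<open>f\<close> turns the normal of the slab into the first axis.
    The image then fits into a box of side \<open>2 * S / norm a\<close> in that direction and
    \<open>2 * d\<close> in the other two, which gives the factor 8.\<close>
  define l u :: R3 where
    "l = vector [(- b - S) / norm a, f p $ 2 - d, f p $ 3 - d]" and
    "u = vector [(- b + S) / norm a, f p $ 2 + d, f p $ 3 + d]"
  have "f ` K \<subseteq> cbox l u"
  proof
    fix y assume "y \<in> f ` K"
    then obtain x where x: "x \<in> K" "y = f x" by blast
    have "\<bar>(f x - f p) $ i\<bar> \<le> d" for i
    proof -
      have "\<bar>(f x - f p) $ i\<bar> \<le> norm (f (x - p))"
        using component_le_norm_cart linear_diff[OF lin] by metis
      also have "\<dots> \<le> d" using d[OF x(1)] orthogonal_transformation_norm[OF f(1)] by simp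
      finally show ?thesis .
    qed
    from this[of 2] this[of 3] have "\<bar>f x $ 2 - f p $ 2\<bar> \<le> d" "\<bar>f x $ 3 - f p $ 3\<bar> \<le> d" by auto
    then show "y \<in> cbox l u" using S[OF x(1)] False
      unfolding x(2) mem_box_cart forall_3 l_def u_def vector_3 f1
      by (auto intro!: divide_right_mono)
  qed
  then have "measure lebesgue (f ` K) \<le> measure lebesgue (cbox l u)"
    using measurable_orthogonal_image[OF f(1) K] by (intro measure_mono_fmeasurable) auto
  moreover have "measure lebesgue (f ` K) = measure lebesgue K"
    using measure_orthogonal_image[OF f(1) K] .
  moreover have "l $ i \<le> u $ i" for i
    using exhaust_3[of i] S0 d0 False by (auto simp: l_def u_def vector_3 divide_right_mono)
  then have "cbox l u \<noteq> {}" by (simp add: interval_ne_empty_cart)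
  then have "measure lebesgue (cbox l u) = (2 * S / norm a) * (2 * d) * (2 * d)"
  proof -
    have "u $ 1 - l $ 1 = 2 * S / norm a" "u $ 2 - l $ 2 = 2 * d" "u $ 3 - l $ 3 = 2 * d"
      using False by (simp_all add: l_def u_def vector_3 field_simps)
    moreover have "measure lebesgue (cbox l u) = measure lborel (cbox l u)" by simp
    ultimately show ?thesis unfolding content_cbox_cart[OF \<open>cbox l u \<noteq> {}\<close>] prod_UNIV_3 by (simp only:)
  qed
  ultimately have "measure lebesgue K \<le> (2 * S / norm a) * (2 * d) * (2 * d)" by simp
  then show ?thesis using False by (simp add: field_simps power2_eq_square)
qed

text \<open>The slab estimate for each of the three rows. Together with a volume of at least
  \<open>h^3\<close> and a diameter of order \<open>h\<close>, it becomes the inverse estimate;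
  shape regularity enters through the volume alone.\<close>

lemma affine_map_gradient_bound:
  fixes K :: "R3 set" and A :: "real^3^3"
  assumes K: "K \<in> lmeasurable" and p: "p \<in> K" and d: "\<And>x. x \<in> K \<Longrightarrow> norm (x - p) \<le> d"
    and S: "\<And>x. x \<in> K \<Longrightarrow> norm (A *v x + b) \<le> S"
  shows "measure lebesgue K * norm A \<le> 24 * S * d\<^sup>2"
proof -
  have "measure lebesgue K * norm A \<le> measure lebesgue K * (\<Sum>i\<in>UNIV. norm (A $ i))"
    unfolding norm_vec_def[of A] by (intro mult_left_mono L2_set_le_sum) auto
  also have "\<dots> = (\<Sum>i\<in>UNIV. measure lebesgue K * norm (A $ i))" by (simp add: sum_distrib_left)
  also have "\<dots> \<le> (\<Sum>i\<in>(UNIV::3 set). 8 * S * d\<^sup>2)"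
  proof (intro sum_mono slab_measure[OF K p d])
    fix i x assume "x \<in> K"
    then show "\<bar>inner (A $ i) x + b $ i\<bar> \<le> S"
      using S[of x] component_le_norm_cart[of "A *v x + b" i]
      by (simp add: matrix_vector_mul_component)
  qed
  finally show ?thesis by simp
qed

text \<open>On the copy of \<open>K\<close> shrunk by the factor 1/4 towards a vertex with maximal nodal value,
  the affine function stays above half of that value.\<close>

lemma affine_map_L2_lower_bound:
  fixes K :: "R3 set" and A :: "real^3^3"
  assumes K: "compact K" "convex K" and p: "p \<in> K"
    and S: "\<And>x. x \<in> K \<Longrightarrow> norm (A *v x + b) \<le> norm (A *v p + b)"
  shows "measure lebesgue K * (norm (A *v p + b))\<^sup>2 / 256
    \<le> integral\<^sup>L (lebesgue_on K) (\<lambda>x. (norm (A *v x + b))\<^sup>2)"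
proof -
  define S where "S = norm (A *v p + b)"
  define f where "f = (\<lambda>y. (1/4) *\<^sub>R y + (3/4) *\<^sub>R p)"
  have fK: "f ` K \<subseteq> K"
    using K(2) p by (auto simp: f_def intro!: convexD)
  have m: "measure lebesgue (f ` K) = measure lebesgue K / 64"
    using measure_lebesgue_affine[of "1/4" "(3/4) *\<^sub>R p" K] by (simp add: f_def power3_eq_cube)
  have "compact (f ` K)" unfolding f_def using K(1) by (intro compact_continuous_image continuous_intros)
  then have fKm: "f ` K \<in> lmeasurable" by (simp add: lmeasurable_compact)
  have Km: "K \<in> lmeasurable" using K(1) by (simp add: lmeasurable_compact)
  interpret finite_measure "lebesgue_on K" using Km by (rule finite_measure_lebesgue_on)
  have lower: "S / 2 \<le> norm (A *v x + b)" if "x \<in> f ` K" for x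
  proof -
    from that obtain y where y: "y \<in> K" "x = f y" by blast
    \<comment> \<open>An affine map respects the convex combination, so the norm is at least 3/4 of
      the maximum minus 1/4 of it.\<close>
    have eq: "A *v x + b = (3/4) *\<^sub>R (A *v p + b) + (1/4) *\<^sub>R (A *v y + b)"
      unfolding y f_def matrix_vector_right_distrib
      by (simp add: matrix_vector_mult_scaleR scaleR_right_distrib algebra_simps flip: scaleR_left_distrib)
    have "norm ((3/4) *\<^sub>R (A *v p + b)) - norm ((1/4) *\<^sub>R (A *v y + b)) \<le> norm (A *v x + b)"
      unfolding eq using norm_diff_ineq by blast
    then show ?thesis using S[OF y(1)] by (simp add: S_def)
  qed
  have meas: "f ` K \<in> sets (lebesgue_on K)" using fK fKm by (simp add: sets_restrict_space_iff Km fmeasurableD)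
  \<comment> \<open>The constant 256 is 64 from the volume of the shrunken copy times 4 from
    squaring one half.\<close>
  have "measure lebesgue K * S\<^sup>2 / 256 = (S / 2)\<^sup>2 * measure (lebesgue_on K) (f ` K)"
    proof -
    have "measure (lebesgue_on K) (f ` K) = measure lebesgue (f ` K)"
      using fK Km by (intro measure_restrict_space) (auto simp: fmeasurableD)
    then show ?thesis unfolding m by (simp only: power2_eq_square) simp
  qed
  also have "\<dots> = integral\<^sup>L (lebesgue_on K) (\<lambda>x. (S / 2)\<^sup>2 * indicator (f ` K) x)"
    using meas fK by (simp add: Int_absorb2)
  also have "\<dots> \<le> integral\<^sup>L (lebesgue_on K) (\<lambda>x. (norm (A *v x + b))\<^sup>2)"
  proof (rule integral_mono)
    show "integrable (lebesgue_on K) (\<lambda>x. (S / 2)\<^sup>2 * indicator (f ` K) x)"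
      using meas by (intro integrable_mult_right integrable_indicator) (auto simp: less_top[symmetric])
    show "integrable (lebesgue_on K) (\<lambda>x. (norm (A *v x + b))\<^sup>2)"
      by (intro integrable_continuous_compact K(1) continuous_intros)
    show "(S / 2)\<^sup>2 * indicator (f ` K) x \<le> (norm (A *v x + b))\<^sup>2" for x
      using lower[of x] S_def by (auto simp: indicator_def intro!: power_mono)
  qed
  finally show ?thesis by (simp add: S_def)
qed

text \<open>A Lipschitz domain lies on one side of its boundary graph, so there are no slits that
  its closure would fill. The mesh covers the closure, and this is what places the interiors of the
  elements in the domain itself.\<close>

lemma bounded_lipschitz_domain_interior_closure:
  assumes "bounded_lipschitz_domain \<Omega>"
  shows "interior (closure \<Omega>) \<subseteq> \<Omega>"
proof
  fix x assume x: "x \<in> interior (closure \<Omega>)"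
  show "x \<in> \<Omega>"
  proof (rule ccontr)
    assume nx: "x \<notin> \<Omega>"
    have "open \<Omega>" using assms by (simp add: bounded_lipschitz_domain_def)
    then have "x \<in> frontier \<Omega>" using x nx interior_subset by (auto simp: frontier_def interior_open)
    then obtain r R g L where r: "r > 0" and R: "orthogonal_transformation R" and g: "L-lipschitz_on UNIV g"
      and eq: "\<Omega> \<inter> ball x r = {y \<in> ball x r. g (vector [R y $ 1, R y $ 2] :: real^2) < (R y :: R3) $ 3}"
      using assms unfolding bounded_lipschitz_domain_def by blast
    obtain e where e: "e > 0" "ball x e \<subseteq> closure \<Omega>" using x by (auto simp: mem_interior)
    have lin: "linear R" using R by (simp add: orthogonal_transformation_def)
    obtain u where u: "R u = axis 3 1" using orthogonal_transformation_surj[OF R] by (metis surjD)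
    have nu: "norm u = 1" using orthogonal_transformation_norm[OF R, of u] u by simp
    define t where "t = min e r / 2"
    have t: "t > 0" "t < e" "t < r" using e r by (auto simp: t_def)
    \<comment> \<open>The vector \<open>u\<close> is mapped to the vertical direction of the graph,
      so \<open>y\<close> is the point \<open>x\<close> moved strictly below the graph while staying
      in both balls.\<close>
    define y where "y = x - t *\<^sub>R u"
    have Ry: "R y = R x - t *\<^sub>R axis 3 1" by (simp add: y_def linear_diff[OF lin] linear_scale[OF lin] u)
    have dist: "dist x y = t" using t nu by (simp add: y_def dist_norm)
    have "g (vector [R x $ 1, R x $ 2]) \<ge> R x $ 3"
      using eq nx r by (metis (mono_tags, lifting) Int_iff centre_in_ball linorder_not_less mem_Collect_eq)
    then have less: "R y $ 3 < g (vector [R y $ 1, R y $ 2])" using t by (simp add: Ry axis_def)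
    \<comment> \<open>An open neighbourhood of \<open>y\<close> below the graph. It misses \<Omega>,
      so \<open>y\<close> cannot belong to the closure, contrary to the choice of
      \<open>e\<close>.\<close>
    define U where "U = ball x r \<inter> {p. R p $ 3 < g (vector [R p $ 1, R p $ 2])}"
    have contR: "continuous_on UNIV R" using lin linear_continuous_on linear_conv_bounded_linear by blast
    have "continuous_on UNIV (\<lambda>p. vector [R p $ 1, R p $ 2] :: real^2)"
    proof -
      have "(\<lambda>p. vector [R p $ 1, R p $ 2] :: real^2) = (\<lambda>p. \<chi> i. if i = 1 then R p $ 1 else R p $ 2)"
        by (intro ext) (simp add: Finite_Cartesian_Product.vec_eq_iff forall_2)
      moreover have "continuous_on UNIV (\<lambda>p. if i = 1 then R p $ 1 else R p $ 2)" for i :: 2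
        by (cases "i = 1") (auto intro!: continuous_on_component contR)
      then have "continuous_on UNIV (\<lambda>p. (\<chi> i. if i = 1 then R p $ 1 else R p $ 2) :: real^2)"
        by (rule continuous_on_vec_lambda)
      ultimately show ?thesis by (simp only:)
    qed
    then have "continuous_on UNIV (\<lambda>p. g (vector [R p $ 1, R p $ 2]))"
      using lipschitz_on_continuous_on[OF g] continuous_on_compose2 by blast
    then have "open U" unfolding U_def
      by (intro open_Int open_Collect_less continuous_on_component contR) auto
    moreover have "y \<in> U" using less dist t by (simp add: U_def)
    moreover have "U \<inter> \<Omega> = {}"
    proof (intro equals0I)
      fix p assume p: "p \<in> U \<inter> \<Omega>"
      then have "p \<in> \<Omega> \<inter> ball x r" by (simp add: U_def)
      then show False using p unfolding eq U_def by simp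
    qed
    ultimately have "y \<notin> closure \<Omega>" by (metis IntI empty_iff open_Int_closure_eq_empty)
    then show False using e dist t by (auto simp: subset_iff)
  qed
qed

section \<open>Piecewise continuous functions on a mesh\<close>

locale fe_mesh =
  fixes \<Omega> :: "R3 set" and \<T> :: "R3 set set" and h c :: real
  assumes lipschitz: "bounded_lipschitz_domain \<Omega>" and mesh: "tetrahedral_mesh \<Omega> \<T>"
    and h: "h > 0" and quasi: "quasi_uniform c h \<T>"
begin

abbreviation vert :: "R3 set \<Rightarrow> R3 set" where
  "vert K \<equiv> {z. z extreme_point_of K}"

abbreviation vol :: "R3 set \<Rightarrow> real" where
  "vol K \<equiv> measure lebesgue K"

lemma domain: "open \<Omega>" "\<Omega> \<noteq> {}" "bounded \<Omega>"
  using lipschitz by (auto simp: bounded_lipschitz_domain_def)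

lemma domain_lmeasurable: "\<Omega> \<in> lmeasurable" "\<Omega> \<in> sets lebesgue"
  using domain lmeasurable_open fmeasurableD by blast+

sublocale dom: finite_measure "lebesgue_on \<Omega>"
  using domain_lmeasurable(1) by (rule finite_measure_lebesgue_on)

lemma domain_nonnull: "emeasure (lebesgue_on \<Omega>) (space (lebesgue_on \<Omega>)) \<noteq> 0"
proof -
  have "\<not> negligible \<Omega>" using domain open_not_negligible by blast
  then have "\<Omega> \<notin> null_sets lebesgue" by (simp add: negligible_iff_null_sets)
  then show ?thesis using domain_lmeasurable
    by (auto simp: emeasure_restrict_space space_restrict_space null_sets_def)
qed

lemma finite_mesh: "finite \<T>"
  using mesh by (simp add: tetrahedral_mesh_def triangulation_def)

lemma Union_mesh: "\<Union>\<T> = closure \<Omega>"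
  using mesh by (simp add: tetrahedral_mesh_def)

text \<open>Quasi-uniformity enters the estimates through two of these facts: the volume is at least
  \<open>h^3\<close>, and points of an element have distance at most \<open>c * h\<close>.\<close>

lemma element:
  assumes "K \<in> \<T>"
  shows "compact K" "convex K" "K \<in> lmeasurable" "K = convex hull vert K" "finite (vert K)" "K \<noteq> {}" "vert K \<noteq> {}"
    "interior K \<noteq> {}" "vol K \<ge> h ^ 3" "vol K > 0" "\<And>x y. x \<in> K \<Longrightarrow> y \<in> K \<Longrightarrow> norm (x - y) \<le> c * h"
proof -
  have K: "3 simplex K" using mesh assms by (simp add: tetrahedral_mesh_def)
  then obtain C where C: "finite C" "K = convex hull C" by (auto simp: simplex)
  show cK: "compact K" "convex K" using K compact_simplex convex_simplex by blast+
  then show mK: "K \<in> lmeasurable" by (simp add: lmeasurable_compact)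
  show hull: "K = convex hull vert K" using Krein_Milman_Minkowski cK by blast
  have "vert K \<subseteq> C" using extreme_points_of_convex_hull C by blast
  then show "finite (vert K)" using C finite_subset by blast
  have hr: "h \<le> root 3 (vol K)" and dm: "diameter K \<le> c * h"
    using quasi assms by (auto simp: quasi_uniform_def)
  have "h ^ 3 \<le> root 3 (vol K) ^ 3" using hr h by (intro power_mono) auto
  then show v: "vol K \<ge> h ^ 3" by (simp add: real_root_pow_pos2)
  moreover have "h ^ 3 > 0" using h by simp
  ultimately show v0: "vol K > 0" by linarith
  then show "K \<noteq> {}" by auto
  then show "vert K \<noteq> {}" using hull by auto
  show "interior K \<noteq> {}"
  proof
    assume "interior K = {}"
    then have "K \<subseteq> frontier K" using closure_subset by (auto simp: frontier_def)
    then have "negligible K" using negligible_convex_frontier[OF cK(2)] negligible_subset by blast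
    then show False using v0 negligible_imp_measure0 by fastforce
  qed
  show "norm (x - y) \<le> c * h" if "x \<in> K" "y \<in> K" for x y
    using diameter_bounded_bound[OF compact_imp_bounded[OF cK(1)] that] dm by (simp add: dist_norm)
qed

lemma mesh_nonempty: "\<T> \<noteq> {}"
  using Union_mesh domain closure_subset[of \<Omega>] by auto

lemma c_ge_1: "c \<ge> 1"
proof -
  obtain K where K: "K \<in> \<T>" using mesh_nonempty by blast
  then have "h \<le> c * h" using quasi by (force simp: quasi_uniform_def)
  then show ?thesis using h by simp
qed

lemma nodes_eq: "nodes \<T> = (\<Union>K\<in>\<T>. vert K)"
  by (auto simp: nodes_def)

lemma nodes_finite: "finite (nodes \<T>)" "nodes \<T> \<noteq> {}"
  using finite_mesh element(5,7) mesh_nonempty by (auto simp: nodes_eq)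

lemma vert_subset: "vert K \<subseteq> K" by (auto simp: extreme_point_of_def)

lemma closed_element: "K \<in> \<T> \<Longrightarrow> closed K"
  using element(1) compact_imp_closed by blast

lemma interior_element_subset:
  assumes "K \<in> \<T>"
  shows "interior K \<subseteq> \<Omega>"
proof -
  have "K \<subseteq> closure \<Omega>" using assms Union_mesh by blast
  then have "interior K \<subseteq> interior (closure \<Omega>)" by (rule interior_mono)
  then show ?thesis using bounded_lipschitz_domain_interior_closure[OF lipschitz] by blast
qed

text \<open>The intersection is a face of \<open>K\<close> that meets its interior, hence all of
  \<open>K\<close>. Then \<open>K\<close> is a proper face of \<open>K'\<close> and lies in the
  boundary of \<open>K'\<close>, although its interior is open and contained in
  \<open>K'\<close>.\<close>

lemma interior_element_unique:
  assumes "K \<in> \<T>" "K' \<in> \<T>" "x \<in> interior K" "x \<in> K'"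
  shows "K' = K"
proof (rule ccontr)
  assume ne: "K' \<noteq> K"
  have "(K \<inter> K') face_of K" "(K' \<inter> K) face_of K'"
    using mesh assms by (auto simp: tetrahedral_mesh_def triangulation_def)
  then have faces: "(K \<inter> K') face_of K" "(K \<inter> K') face_of K'" by (simp_all add: Int_commute)
  have "x \<in> K \<inter> K'" using assms interior_subset by blast
  then have "K \<inter> K' = K" using face_of_disjoint_interior[OF faces(1)] assms by blast
  then have sub: "K \<subseteq> K'" and "K face_of K'" using faces by auto
  then have "K \<inter> interior K' = {}" using face_of_disjoint_interior ne by blast
  moreover have "x \<in> interior K'" using sub assms interior_mono by blast
  ultimately show False using assms interior_subset by blast
qed

lemma negligible_skeleton: "negligible (\<Union>K\<in>\<T>. frontier K)"
  using finite_mesh element(2) by (intro negligible_Union) (auto intro: negligible_convex_frontier)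

lemma off_skeleton:
  assumes "x \<in> closure \<Omega> - (\<Union>K\<in>\<T>. frontier K)"
  obtains K where "K \<in> \<T>" "x \<in> interior K"
proof -
  obtain K where K: "K \<in> \<T>" "x \<in> K" using assms Union_mesh by blast
  then have "x \<in> interior K" using assms closure_subset by (auto simp: frontier_def)
  then show ?thesis using that K by blast
qed

text \<open>The pieces are continuous on the whole space, which makes measurability and
  integrability on each element immediate. Values of \<open>f\<close> on the faces are left free,
  since gradients jump there.\<close>

definition piecewise :: "(R3 \<Rightarrow> 'b::euclidean_space) \<Rightarrow> (R3 set \<Rightarrow> R3 \<Rightarrow> 'b) \<Rightarrow> bool" where
  "piecewise f g \<longleftrightarrow> (\<forall>K\<in>\<T>. continuous_on UNIV (g K) \<and> (\<forall>x\<in>interior K. f x = g K x))"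

lemma piecewise_eq_sum:
  assumes f: "piecewise f g" and x: "x \<in> \<Omega> - (\<Union>K\<in>\<T>. frontier K)"
  shows "f x = (\<Sum>K\<in>\<T>. indicator K x *\<^sub>R g K x)"
proof -
  have "x \<in> closure \<Omega> - (\<Union>K\<in>\<T>. frontier K)" using x closure_subset by blast
  then obtain K where K: "K \<in> \<T>" "x \<in> interior K" by (rule off_skeleton)
  have "(\<Sum>K'\<in>\<T> - {K}. indicator K' x *\<^sub>R g K' x) = 0"
    using interior_element_unique[OF K(1) _ K(2)] by (intro sum.neutral) (auto simp: indicator_def)
  then have "(\<Sum>K'\<in>\<T>. indicator K' x *\<^sub>R g K' x) = indicator K x *\<^sub>R g K x"
    using sum.remove[OF finite_mesh K(1), of "\<lambda>K'. indicator K' x *\<^sub>R g K' x"] by simp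
  also have "\<dots> = g K x" using K(2) interior_subset[of K] by (simp add: subset_iff)
  also have "\<dots> = f x" using K f by (simp add: piecewise_def)
  finally show ?thesis by simp
qed

lemma piecewise_sum_measurable:
  assumes f: "piecewise f g"
  shows "(\<lambda>x. \<Sum>K\<in>\<T>. indicator K x *\<^sub>R g K x) \<in> borel_measurable lebesgue"
proof (intro borel_measurable_sum borel_measurable_scaleR)
  fix K assume K: "K \<in> \<T>"
  show "indicator K \<in> borel_measurable lebesgue"
    using element(3)[OF K] by (simp add: fmeasurableD borel_measurable_indicator)
  have "g K \<in> borel_measurable borel" using f K by (auto simp: piecewise_def borel_measurable_continuous_onI)
  then show "g K \<in> borel_measurable lebesgue" by (simp add: measurable_completion)
qed

lemma piecewise_measurable:
  assumes f: "piecewise f g"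
  shows "f \<in> borel_measurable (lebesgue_on \<Omega>)"
  by (rule measurable_lebesgue_on_spike[OF domain_lmeasurable(2) piecewise_sum_measurable[OF f] negligible_skeleton])
     (use piecewise_eq_sum[OF f] in auto)

lemma AE_interior:
  assumes "\<And>K x. K \<in> \<T> \<Longrightarrow> x \<in> interior K \<Longrightarrow> P x"
  shows "AE x in lebesgue_on \<Omega>. P x"
proof (rule AE_lebesgue_onI[OF domain_lmeasurable(2) negligible_skeleton])
  fix x assume "x \<in> \<Omega> - (\<Union>K\<in>\<T>. frontier K)"
  then have "x \<in> closure \<Omega> - (\<Union>K\<in>\<T>. frontier K)" using closure_subset by blast
  then show "P x" using assms by (metis off_skeleton)
qed

lemma piecewise_bounded:
  assumes f: "piecewise f g"
  obtains B where "AE x in lebesgue_on \<Omega>. norm (f x) \<le> B"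
proof -
  have "\<forall>K\<in>\<T>. \<exists>B. \<forall>x\<in>K. norm (g K x) \<le> B"
  proof
    fix K assume K: "K \<in> \<T>"
    have "continuous_on K (g K)"
      using f K continuous_on_subset[OF _ subset_UNIV] by (auto simp: piecewise_def)
    then have "bounded (g K ` K)" using compact_continuous_image element(1)[OF K] compact_imp_bounded by blast
    then show "\<exists>B. \<forall>x\<in>K. norm (g K x) \<le> B" by (auto simp: bounded_iff)
  qed
  then obtain B where B: "\<And>K x. K \<in> \<T> \<Longrightarrow> x \<in> K \<Longrightarrow> norm (g K x) \<le> B K" by metis
  have "norm (f x) \<le> Max (B ` \<T>)" if K: "K \<in> \<T>" "x \<in> interior K" for K x
  proof -
    have "norm (f x) \<le> B K" using f K B[OF K(1)] interior_subset[of K] by (auto simp: piecewise_def)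
    also have "\<dots> \<le> Max (B ` \<T>)" using finite_mesh K by simp
    finally show ?thesis .
  qed
  then show ?thesis by (intro that[of "Max (B ` \<T>)"] AE_interior)
qed

lemma bounded_times_piecewise_integrable:
  fixes w :: "R3 \<Rightarrow> real"
  assumes f: "piecewise f g" and w: "w \<in> borel_measurable (lebesgue_on \<Omega>)"
    and B: "AE x in lebesgue_on \<Omega>. \<bar>w x\<bar> \<le> B"
  shows "integrable (lebesgue_on \<Omega>) (\<lambda>x. w x *\<^sub>R f x)"
proof -
  obtain B' where B': "AE x in lebesgue_on \<Omega>. norm (f x) \<le> B'" using piecewise_bounded[OF f] .
  have "AE x in lebesgue_on \<Omega>. norm (w x *\<^sub>R f x) \<le> \<bar>B\<bar> * \<bar>B'\<bar>"
    using B B'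
  proof eventually_elim
    case (elim x)
    have "\<bar>w x\<bar> \<le> \<bar>B\<bar>" "norm (f x) \<le> \<bar>B'\<bar>" using elim by auto
    then show ?case by (simp add: mult_mono)
  qed
  then show ?thesis using piecewise_measurable[OF f] w by (intro dom.integrable_const_bound) auto
qed

lemma piecewise_integrable:
  assumes f: "piecewise f g"
  shows "integrable (lebesgue_on \<Omega>) f"
  using bounded_times_piecewise_integrable[OF f, of "\<lambda>_. 1" 1] by simp

text \<open>Up to the null set of element frontiers, the elements partition \<Omega>: a point
  outside \<Omega> and off the frontiers belongs to no element, because element interiors lie in
  \<Omega>.\<close>

lemma piecewise_integral:
  assumes f: "piecewise f g"
  shows "integral\<^sup>L (lebesgue_on \<Omega>) f = (\<Sum>K\<in>\<T>. integral\<^sup>L (lebesgue_on K) (g K))"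
proof -
  have int: "integrable (lebesgue_on K) (g K)" if "K \<in> \<T>" for K
    using f element(1) that by (auto simp: piecewise_def intro: integrable_continuous_compact)
  have int': "integrable lebesgue (\<lambda>x. indicator K x *\<^sub>R g K x)" if "K \<in> \<T>" for K
    using int[OF that] element(3)[OF that] by (simp add: integrable_restrict_space fmeasurableD set_integrable_def)
  have "AE x in lebesgue. x \<notin> (\<Union>K\<in>\<T>. frontier K)"
    using negligible_skeleton by (intro AE_not_in) (simp add: negligible_iff_null_sets)
  then have ae: "AE x in lebesgue. indicator \<Omega> x *\<^sub>R f x = (\<Sum>K\<in>\<T>. indicator K x *\<^sub>R g K x)"
  proof eventually_elim
    case (elim x)
    show ?case
    proof (cases "x \<in> \<Omega>")
      case True
      then show ?thesis using piecewise_eq_sum[OF f, of x] elim by simp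
    next
      case False
      then have "x \<notin> K" if "K \<in> \<T>" for K
        using elim interior_element_subset[OF that] that closure_subset[of K] by (auto simp: frontier_def)
      then show ?thesis using False by (simp add: indicator_def)
    qed
  qed
  have meas: "(\<lambda>x. indicator \<Omega> x *\<^sub>R f x) \<in> borel_measurable lebesgue"
    using borel_measurable_if_I[OF piecewise_measurable[OF f] domain_lmeasurable(2)]
    by (rule measurable_cong[THEN iffD1, rotated]) (simp add: indicator_def)
  have "integral\<^sup>L (lebesgue_on \<Omega>) f = integral\<^sup>L lebesgue (\<lambda>x. indicator \<Omega> x *\<^sub>R f x)"
    using domain_lmeasurable by (intro integral_restrict_space) simp
  also have "\<dots> = integral\<^sup>L lebesgue (\<lambda>x. \<Sum>K\<in>\<T>. indicator K x *\<^sub>R g K x)"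
    using ae meas piecewise_sum_measurable[OF f] by (intro integral_cong_AE)
  also have "\<dots> = (\<Sum>K\<in>\<T>. integral\<^sup>L lebesgue (\<lambda>x. indicator K x *\<^sub>R g K x))"
    using int' by (rule Bochner_Integration.integral_sum)
  also have "\<dots> = (\<Sum>K\<in>\<T>. integral\<^sup>L (lebesgue_on K) (g K))"
    using element(3) by (intro sum.cong refl integral_restrict_space[symmetric]) (simp add: fmeasurableD)
  finally show ?thesis .
qed

text \<open>Nodes form a null set, so an essential bound says nothing about them directly. By
  continuity of the piece, the part of the interior where the bound fails is open; being null it is
  empty, and the closure of the interior is all of \<open>K\<close>.\<close>

lemma piecewise_le_Linf_norm:
  assumes f: "piecewise f g" and K: "K \<in> \<T>" and x: "x \<in> K"
  shows "norm (g K x) \<le> Linf_norm (lebesgue_on \<Omega>) f"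
proof -
  define L where "L = Linf_norm (lebesgue_on \<Omega>) f"
  obtain B where B: "AE x in lebesgue_on \<Omega>. norm (f x) \<le> B" using piecewise_bounded[OF f] .
  have ae: "AE x in lebesgue_on \<Omega>. norm (f x) \<le> L"
    unfolding L_def using Linf_norm_props(2)[OF piecewise_measurable[OF f] B domain_nonnull] .
  have cont: "continuous_on UNIV (g K)" using f K by (auto simp: piecewise_def)
  define U where "U = interior K \<inter> {x. L < norm (g K x)}"
  have "open U" unfolding U_def by (intro open_Int open_interior open_Collect_less continuous_intros cont)
  have "AE x in lebesgue. x \<in> \<Omega> \<longrightarrow> norm (f x) \<le> L"
    using ae domain_lmeasurable by (subst (asm) AE_restrict_space_iff) auto
  then have "AE x in lebesgue. x \<notin> U"
    using f K interior_element_subset[OF K] by (auto simp: U_def piecewise_def elim!: eventually_mono)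
  then have "U \<in> null_sets lebesgue"
    using \<open>open U\<close> by (subst (asm) AE_iff_null_sets[symmetric]) auto
  then have "U = {}" using \<open>open U\<close> open_not_negligible by (auto simp: negligible_iff_null_sets)
  then have "interior K \<subseteq> {x. norm (g K x) \<le> L}" by (auto simp: U_def)
  moreover have "closed {x. norm (g K x) \<le> L}" by (intro closed_Collect_le continuous_intros cont)
  ultimately have "closure (interior K) \<subseteq> {x. norm (g K x) \<le> L}" by (rule closure_minimal)
  moreover have "closure (interior K) = K"
    using convex_closure_interior[OF element(2,8)[OF K]] closed_element[OF K] by simp
  ultimately show ?thesis using x by (auto simp: L_def)
qed

lemma piecewise_Linf_norm_nonneg:
  assumes "piecewise f g"
  shows "Linf_norm (lebesgue_on \<Omega>) f \<ge> 0"
proof -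
  obtain K x where "K \<in> \<T>" "x \<in> K" using mesh_nonempty element(6) by blast
  then show ?thesis using piecewise_le_Linf_norm[OF assms] norm_ge_zero order_trans by blast
qed

end

section \<open>Finite element functions and their energy\<close>

lemma grad_affine:
  assumes "x \<in> interior K" "\<And>y. y \<in> K \<Longrightarrow> v y = A *v y + b"
  shows "grad v x = A"
proof -
  have "((\<lambda>y. A *v y + b) has_derivative (\<lambda>y. A *v y)) (at x)"
    by (auto intro!: derivative_eq_intros bounded_linear.has_derivative[OF matrix_vector_mul_bounded_linear])
  then have "(v has_derivative (\<lambda>y. A *v y)) (at x)"
    by (rule has_derivative_transform_within_open[OF _ open_interior assms(1)])
      (simp add: assms(2)[OF subsetD[OF interior_subset]])
  then have "frechet_derivative v (at x) = (\<lambda>y. A *v y)" using frechet_derivative_at by metis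
  then show ?thesis by (simp add: grad_def jacobian_def)
qed

context fe_mesh
begin

lemma S_h3_affine:
  assumes v: "v \<in> S_h3 \<T>" and K: "K \<in> \<T>"
  shows "\<exists>A b. \<forall>x\<in>K. v x = A *v x + b"
proof -
  have "\<forall>i. \<exists>A b. linear A \<and> (\<forall>x\<in>K. v x $ i = A x + b)"
    using v K by (auto simp: S_h3_def S_h_def)
  then obtain A b where A: "\<And>i. linear (A i)" and eq: "\<And>i x. x \<in> K \<Longrightarrow> v x $ i = A i x + b i"
    by metis
  define L where "L = (\<lambda>x. (\<chi> i. A i x) :: R3)"
  have "linear L" unfolding L_def
    by (intro linearI) (simp_all add: Finite_Cartesian_Product.vec_eq_iff linear_add[OF A] linear_scale[OF A])
  then have "matrix L *v x = L x" for x using matrix_works[of L x] by (simp add: linear_matrix_vector_mul_eq)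
  then have "\<forall>x\<in>K. v x = matrix L *v x + (\<chi> i. b i)"
    using eq by (simp add: Finite_Cartesian_Product.vec_eq_iff L_def)
  then show ?thesis by blast
qed

text \<open>The constant Jacobian on one element, as a choice. For finite element functions the
  choice is immaterial, because it agrees with \<open>grad v\<close> in the interior of the
  element.\<close>

definition gmat :: "(R3 \<Rightarrow> R3) \<Rightarrow> R3 set \<Rightarrow> real^3^3" where
  "gmat v K = (SOME A. \<exists>b. \<forall>x\<in>K. v x = A *v x + b)"

text \<open>The affine extension of one piece to the whole space, in the form that
  \<open>piecewise\<close> expects.\<close>

definition aff :: "(R3 \<Rightarrow> R3) \<Rightarrow> R3 set \<Rightarrow> R3 \<Rightarrow> R3" where
  "aff v K x = gmat v K *v x + (SOME b. \<forall>x\<in>K. v x = gmat v K *v x + b)"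

lemma aff_eq:
  assumes "v \<in> S_h3 \<T>" "K \<in> \<T>" "x \<in> K"
  shows "aff v K x = v x"
proof -
  have "\<exists>b. \<forall>x\<in>K. v x = gmat v K *v x + b"
    unfolding gmat_def using S_h3_affine[OF assms(1,2)] by (rule someI_ex)
  then have "\<forall>x\<in>K. v x = gmat v K *v x + (SOME b. \<forall>x\<in>K. v x = gmat v K *v x + b)"
    by (rule someI_ex)
  then have "v x = gmat v K *v x + (SOME b. \<forall>x\<in>K. v x = gmat v K *v x + b)"
    using assms(3) by (rule bspec)
  then show ?thesis unfolding aff_def by (rule sym)
qed

lemma aff_cases:
  obtains b where "aff v K = (\<lambda>x. gmat v K *v x + b)"
  by (rule that[OF ext], rule aff_def)

lemma continuous_aff: "continuous_on A (aff v K)"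
  unfolding aff_def by (intro continuous_intros)

lemma aff_diff: "aff v K x - aff v K y = gmat v K *v (x - y)"
  by (simp add: aff_def matrix_vector_mult_diff_distrib)

lemma grad_eq_gmat:
  assumes "v \<in> S_h3 \<T>" "K \<in> \<T>" "x \<in> interior K"
  shows "grad v x = gmat v K"
proof -
  obtain b where "aff v K = (\<lambda>x. gmat v K *v x + b)" by (rule aff_cases)
  then have "\<And>y. y \<in> K \<Longrightarrow> v y = gmat v K *v y + b" using aff_eq[OF assms(1,2)] by metis
  then show ?thesis by (rule grad_affine[OF assms(3)])
qed

lemma S_h3_diff:
  assumes "u \<in> S_h3 \<T>" "v \<in> S_h3 \<T>"
  shows "(\<lambda>x. u x - v x) \<in> S_h3 \<T>"
  unfolding S_h3_def S_h_def mem_Collect_eq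
proof (intro allI conjI ballI)
  fix i
  show "continuous_on (\<Union>\<T>) (\<lambda>x. (u x - v x) $ i)"
    using assms by (simp add: S_h3_def S_h_def continuous_on_diff)
  fix K assume K: "K \<in> \<T>"
  obtain A b where "linear A" "\<forall>x\<in>K. u x $ i = A x + b"
    using assms(1) K unfolding S_h3_def S_h_def by blast
  moreover obtain A' b' where "linear A'" "\<forall>x\<in>K. v x $ i = A' x + b'"
    using assms(2) K unfolding S_h3_def S_h_def by blast
  ultimately show "\<exists>A b. linear A \<and> (\<forall>x\<in>K. (u x - v x) $ i = A x + b)"
    by (intro exI[of _ "\<lambda>x. A x - A' x"] exI[of _ "b - b'"]) (auto intro: linear_compose_sub)
qed

text \<open>Linearity is not visible from a choice; comparing Jacobians at one interior point of the
  element provides it.\<close>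

lemma gmat_diff:
  assumes "u \<in> S_h3 \<T>" "v \<in> S_h3 \<T>" "K \<in> \<T>"
  shows "gmat (\<lambda>x. u x - v x) K = gmat u K - gmat v K"
proof -
  obtain x where x: "x \<in> interior K" using element(8)[OF assms(3)] by blast
  obtain b b' where b: "aff u K = (\<lambda>x. gmat u K *v x + b)" "aff v K = (\<lambda>x. gmat v K *v x + b')"
    by (metis aff_cases)
  have "u y - v y = (gmat u K - gmat v K) *v y + (b - b')" if "y \<in> K" for y
  proof -
    have "u y = gmat u K *v y + b" "v y = gmat v K *v y + b'"
      using aff_eq[OF assms(1,3) that] aff_eq[OF assms(2,3) that] b by metis+
    then show ?thesis by (simp only: matrix_vector_mult_diff_rdistrib) simp
  qed
  then have "grad (\<lambda>x. u x - v x) x = gmat u K - gmat v K" by (intro grad_affine[OF x])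
  then show ?thesis using grad_eq_gmat[OF S_h3_diff[OF assms(1,2)] assms(3) x] by simp
qed

lemma piecewise_value: "v \<in> S_h3 \<T> \<Longrightarrow> piecewise v (aff v)"
  using aff_eq continuous_aff interior_subset by (fastforce simp: piecewise_def)

lemma piecewise_grad: "v \<in> S_h3 \<T> \<Longrightarrow> piecewise (grad v) (\<lambda>K x. gmat v K)"
  using grad_eq_gmat by (auto simp: piecewise_def)

lemma piecewise_inner:
  "piecewise f g \<Longrightarrow> piecewise f' g' \<Longrightarrow> piecewise (\<lambda>x. inner (f x) (f' x)) (\<lambda>K x. inner (g K x) (g' K x))"
  by (auto simp: piecewise_def intro!: continuous_intros)

lemma piecewise_diff:
  "piecewise f g \<Longrightarrow> piecewise f' g' \<Longrightarrow> piecewise (\<lambda>x. f x - f' x) (\<lambda>K x. g K x - g' K x)"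
  by (auto simp: piecewise_def intro!: continuous_intros)

lemma L2_inner_value:
  "v \<in> S_h3 \<T> \<Longrightarrow> L2_inner \<Omega> v v = (\<Sum>K\<in>\<T>. integral\<^sup>L (lebesgue_on K) (\<lambda>x. (norm (aff v K x))\<^sup>2))"
  unfolding L2_inner_def power2_norm_eq_inner
  using piecewise_integral[OF piecewise_inner[OF piecewise_value piecewise_value]] by blast

lemma L2_inner_grad:
  assumes "v \<in> S_h3 \<T>"
  shows "L2_inner \<Omega> (grad v) (grad v) = (\<Sum>K\<in>\<T>. vol K * (norm (gmat v K))\<^sup>2)"
proof -
  have "L2_inner \<Omega> (grad v) (grad v) = (\<Sum>K\<in>\<T>. integral\<^sup>L (lebesgue_on K) (\<lambda>x. inner (gmat v K) (gmat v K)))"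
    unfolding L2_inner_def
    using piecewise_integral[OF piecewise_inner[OF piecewise_grad[OF assms] piecewise_grad[OF assms]]] .
  also have "\<dots> = (\<Sum>K\<in>\<T>. vol K * (norm (gmat v K))\<^sup>2)"
    using element(3) by (intro sum.cong refl)
      (simp add: power2_norm_eq_inner measure_restrict_space space_restrict_space fmeasurableD)
  finally show ?thesis .
qed

text \<open>The points where an affine map has distance at most \<open>S\<close> from
  \<open>a\<close> form a convex set, and an element is the hull of its vertices. The centre
  \<open>a\<close> allows values to be measured relative to a single node.\<close>

lemma element_max_principle:
  assumes v: "v \<in> S_h3 \<T>" and K: "K \<in> \<T>" and S: "\<And>z. z \<in> vert K \<Longrightarrow> norm (v z - a) \<le> S" and x: "x \<in> K"
  shows "norm (v x - a) \<le> S"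
proof -
  obtain b where b: "aff v K = (\<lambda>x. gmat v K *v x + b)" by (rule aff_cases)
  have "convex ((\<lambda>x. gmat v K *v x) -` cball (a - b) S)"
    by (intro convex_linear_vimage convex_cball matrix_vector_mul_linear)
  also have "(\<lambda>x. gmat v K *v x) -` cball (a - b) S = {x. norm (aff v K x - a) \<le> S}"
    by (auto simp: b dist_norm norm_minus_commute algebra_simps)
  finally have "convex {x. norm (aff v K x - a) \<le> S}" .
  moreover have "vert K \<subseteq> {x. norm (aff v K x - a) \<le> S}"
    using S aff_eq[OF v K] vert_subset by fastforce
  ultimately have "convex hull vert K \<subseteq> {x. norm (aff v K x - a) \<le> S}" by (simp add: hull_minimal)
  then show ?thesis using x element(4)[OF K] aff_eq[OF v K x] by auto
qed

lemma element_L2_bounds: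
  assumes v: "v \<in> S_h3 \<T>" and K: "K \<in> \<T>"
  obtains S where "S \<ge> 0" "\<And>z. z \<in> vert K \<Longrightarrow> norm (v z) \<le> S"
    "vol K * S\<^sup>2 \<le> 256 * integral\<^sup>L (lebesgue_on K) (\<lambda>x. (norm (aff v K x))\<^sup>2)"
proof -
  define S where "S = Max ((\<lambda>z. norm (v z)) ` vert K)"
  have le: "norm (v z) \<le> S" if "z \<in> vert K" for z
    using element(5)[OF K] that by (simp add: S_def)
  obtain p where p: "p \<in> vert K" "S = norm (v p)"
  proof -
    have "S \<in> (\<lambda>z. norm (v z)) ` vert K"
      unfolding S_def using element(5,7)[OF K] by (intro Max_in finite_imageI) blast+
    then show ?thesis using that by blast
  qed
  have pK: "p \<in> K" using p vert_subset by blast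
  obtain b where b: "aff v K = (\<lambda>x. gmat v K *v x + b)" by (rule aff_cases)
  have "norm (aff v K x) \<le> norm (aff v K p)" if "x \<in> K" for x
    using element_max_principle[OF v K, of 0 S x] le that p(2) aff_eq[OF v K that] aff_eq[OF v K pK] by simp
  then have "vol K * (norm (aff v K p))\<^sup>2 / 256 \<le> integral\<^sup>L (lebesgue_on K) (\<lambda>x. (norm (aff v K x))\<^sup>2)"
    unfolding b using affine_map_L2_lower_bound[OF element(1,2)[OF K] pK] by blast
  then have "vol K * S\<^sup>2 \<le> 256 * integral\<^sup>L (lebesgue_on K) (\<lambda>x. (norm (aff v K x))\<^sup>2)"
    using aff_eq[OF v K pK] p(2) by simp
  then show ?thesis using le p(2) by (intro that[of S]) auto
qed

lemma element_L2_upper: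
  assumes v: "v \<in> S_h3 \<T>" and K: "K \<in> \<T>" and S: "\<And>z. z \<in> vert K \<Longrightarrow> norm (v z) \<le> S"
  shows "integral\<^sup>L (lebesgue_on K) (\<lambda>x. (norm (aff v K x))\<^sup>2) \<le> vol K * S\<^sup>2"
proof -
  interpret finite_measure "lebesgue_on K" using element(3)[OF K] by (rule finite_measure_lebesgue_on)
  have "integral\<^sup>L (lebesgue_on K) (\<lambda>x. (norm (aff v K x))\<^sup>2) \<le> integral\<^sup>L (lebesgue_on K) (\<lambda>x. S\<^sup>2)"
  proof (rule integral_mono)
    show "integrable (lebesgue_on K) (\<lambda>x. (norm (aff v K x))\<^sup>2)"
      by (intro integrable_continuous_compact element(1)[OF K] continuous_intros continuous_aff)
    fix x assume "x \<in> space (lebesgue_on K)"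
    then have x: "x \<in> K" by (simp add: space_restrict_space)
    show "(norm (aff v K x))\<^sup>2 \<le> S\<^sup>2"
      using element_max_principle[OF v K, of 0 S x] S x aff_eq[OF v K x] by (intro power_mono) auto
  qed auto
  also have "\<dots> = vol K * S\<^sup>2"
    using element(3)[OF K] by (simp add: measure_restrict_space space_restrict_space fmeasurableD)
  finally show ?thesis .
qed

text \<open>Constants have no gradient, so the nodal values may be shifted by any \<open>a\<close>.
  The factor is \<open>24 * (c * h)^2 / h^3\<close>, with the lower volume bound in the
  denominator.\<close>

lemma inverse_estimate:
  assumes v: "v \<in> S_h3 \<T>" and K: "K \<in> \<T>" and S: "\<And>z. z \<in> vert K \<Longrightarrow> norm (v z - a) \<le> S"
  shows "norm (gmat v K) \<le> 24 * c\<^sup>2 / h * S"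
proof -
  obtain b where b: "aff v K = (\<lambda>x. gmat v K *v x + b)" by (rule aff_cases)
  obtain p where p: "p \<in> K" using element(6)[OF K] by blast
  have S': "norm (gmat v K *v x + (b - a)) \<le> S" if "x \<in> K" for x
    using element_max_principle[OF v K S that] aff_eq[OF v K that] by (simp add: b algebra_simps)
  have "vol K * norm (gmat v K) \<le> 24 * S * (c * h)\<^sup>2"
    using p element(11)[OF K] S' by (intro affine_map_gradient_bound[OF element(3)[OF K]])
  moreover have "h ^ 3 * norm (gmat v K) \<le> vol K * norm (gmat v K)"
    using element(9)[OF K] by (intro mult_right_mono) auto
  ultimately have "h\<^sup>2 * (h * norm (gmat v K)) \<le> h\<^sup>2 * (24 * S * c\<^sup>2)"
    by (simp add: power2_eq_square power3_eq_cube mult_ac)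
  then have "h * norm (gmat v K) \<le> 24 * S * c\<^sup>2" using h by (subst (asm) mult_le_cancel_left_pos) auto
  then show ?thesis using h by (simp add: field_simps)
qed

lemma increment_bound:
  assumes v: "v \<in> S_h3 \<T>" and K: "K \<in> \<T>" and x: "x \<in> K" "y \<in> K" and G: "norm (gmat v K) \<le> G"
  shows "norm (v x - v y) \<le> G * (c * h)"
proof -
  have "norm (v x - v y) = norm (gmat v K *v (x - y))"
    using aff_diff[of v K x y] aff_eq[OF v K] x by simp
  also have "\<dots> \<le> norm (gmat v K) * norm (x - y)" by (rule norm_matrix_vector_le)
  also have "\<dots> \<le> G * (c * h)" using G element(11)[OF K x] norm_ge_zero[of "gmat v K"]
    by (intro mult_mono) (auto intro: order_trans[OF norm_ge_zero])
  finally show ?thesis .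
qed

text \<open>In the bound for nodal differences the \<open>h\<close> next to \<open>p\<close> cancels
  the \<open>1 / h\<close> of the inverse estimate, while the term with \<open>q\<close> becomes the
  gradient of \<open>v\<close>, since increments of \<open>v\<close> are at most
  \<open>c * h\<close> times that gradient. The constant is \<open>256 * 4 * 24^2\<close>: the 256
  is the comparison of nodal values with the integral, the 4 comes from two uses of
  \<open>(x + y)^2 \<le> 2 * x^2 + 2 * y^2\<close>.\<close>

lemma element_energy_comparison:
  fixes p q a b :: real
  assumes u: "u \<in> S_h3 \<T>" and v: "v \<in> S_h3 \<T>" and K: "K \<in> \<T>" and ab: "a > 0" "b \<ge> 0" and pq: "p \<ge> 0" "q \<ge> 0"
    and le: "\<And>z. z \<in> vert K \<Longrightarrow> norm (u z) \<le> norm (v z)"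
    and diff: "\<And>S z z'. (\<And>z. z \<in> vert K \<Longrightarrow> norm (v z) \<le> S) \<Longrightarrow> z \<in> vert K \<Longrightarrow> z' \<in> vert K \<Longrightarrow>
      norm ((u z - v z) - (u z' - v z')) \<le> p * h * S + q * norm (v z - v z')"
  shows "a * integral\<^sup>L (lebesgue_on K) (\<lambda>x. (norm (aff u K x))\<^sup>2) + b * (vol K * (norm (gmat u K))\<^sup>2)
    \<le> 589824 * c ^ 6 * (1 + q\<^sup>2 + b * p\<^sup>2 / a)
      * (a * integral\<^sup>L (lebesgue_on K) (\<lambda>x. (norm (aff v K x))\<^sup>2) + b * (vol K * (norm (gmat v K))\<^sup>2))"
proof -
  define Iu Iv where "Iu = integral\<^sup>L (lebesgue_on K) (\<lambda>x. (norm (aff u K x))\<^sup>2)"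
    and "Iv = integral\<^sup>L (lebesgue_on K) (\<lambda>x. (norm (aff v K x))\<^sup>2)"
  define V gu gv gd where "V = vol K" and "gu = norm (gmat u K)" and "gv = norm (gmat v K)"
    and "gd = norm (gmat (\<lambda>x. u x - v x) K)"
  have V: "V > 0" using element(10)[OF K] by (simp add: V_def)
  have c: "c \<ge> 1" by (rule c_ge_1)
  obtain S where S: "S \<ge> 0" "\<And>z. z \<in> vert K \<Longrightarrow> norm (v z) \<le> S" "V * S\<^sup>2 \<le> 256 * Iv"
    unfolding V_def Iv_def using element_L2_bounds[OF v K] by blast
  have "Iu \<le> V * S\<^sup>2" unfolding Iu_def V_def using le S(2) order_trans by (intro element_L2_upper[OF u K]) blast
  then have Iu: "Iu \<le> 256 * Iv" using S(3) by linarith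
  have Iv: "Iv \<ge> 0" unfolding Iv_def by (intro Bochner_Integration.integral_nonneg) auto
  obtain z0 where z0: "z0 \<in> vert K" using element(7)[OF K] by blast
  have "norm ((u z - v z) - (u z0 - v z0)) \<le> p * h * S + q * (gv * (c * h))" if z: "z \<in> vert K" for z
  proof -
    have "norm (v z - v z0) \<le> gv * (c * h)"
      using z z0 vert_subset unfolding gv_def by (intro increment_bound[OF v K]) auto
    then show ?thesis using diff[OF S(2) z z0] pq mult_left_mono by fastforce
  qed
  then have "gd \<le> 24 * c\<^sup>2 / h * (p * h * S + q * (gv * (c * h)))"
    unfolding gd_def by (intro inverse_estimate[OF S_h3_diff[OF u v] K])
  also have "\<dots> = 24 * c\<^sup>2 * (p * S + q * c * gv)" using h by (simp add: field_simps)
  finally have gd: "gd \<le> 24 * c\<^sup>2 * (p * S + q * c * gv)" .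
  have sq: "(x + y)\<^sup>2 \<le> 2 * x\<^sup>2 + 2 * y\<^sup>2" for x y :: real
    using zero_le_power2[of "x - y"] by (simp add: power2_sum power2_diff)
  have "gd\<^sup>2 \<le> (24 * c\<^sup>2 * (p * S + q * c * gv))\<^sup>2" using gd by (intro power_mono) (auto simp: gd_def)
  also have "\<dots> = 576 * c ^ 4 * (p * S + q * c * gv)\<^sup>2" by (simp add: power_mult_distrib flip: power_mult)
  also have "\<dots> \<le> 576 * c ^ 4 * (2 * (p * S)\<^sup>2 + 2 * (q * c * gv)\<^sup>2)"
    using sq by (intro mult_left_mono) auto
  finally have gd2: "gd\<^sup>2 \<le> 1152 * c ^ 4 * (p\<^sup>2 * S\<^sup>2 + q\<^sup>2 * c\<^sup>2 * gv\<^sup>2)"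
    by (simp add: power_mult_distrib algebra_simps)
  have "gmat u K = gmat v K + gmat (\<lambda>x. u x - v x) K" using gmat_diff[OF u v K] by simp
  then have "gu \<le> gv + gd" unfolding gu_def gv_def gd_def using norm_triangle_ineq by metis
  then have "gu\<^sup>2 \<le> (gv + gd)\<^sup>2" by (intro power_mono) (auto simp: gu_def)
  then have gu2: "gu\<^sup>2 \<le> 2 * gv\<^sup>2 + 2304 * c ^ 4 * (p\<^sup>2 * S\<^sup>2 + q\<^sup>2 * c\<^sup>2 * gv\<^sup>2)"
    using sq[of gv gd] gd2 by linarith
  have "V * gu\<^sup>2 \<le> V * (2 * gv\<^sup>2 + 2304 * c ^ 4 * (p\<^sup>2 * S\<^sup>2 + q\<^sup>2 * c\<^sup>2 * gv\<^sup>2))"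
    using gu2 V by (intro mult_left_mono) auto
  also have "\<dots> = 2 * (V * gv\<^sup>2) + 2304 * c ^ 4 * p\<^sup>2 * (V * S\<^sup>2) + 2304 * c ^ 6 * q\<^sup>2 * (V * gv\<^sup>2)"
    by (simp add: algebra_simps flip: power_add)
  \<comment> \<open>Nodal values are traded for the integral of \<open>v\<close>. The contribution
    of \<open>p\<close> thereby moves from the gradient part with weight \<open>b\<close> to the
    \<open>L2\<close> part with weight \<open>a\<close>, hence the combination
    \<open>b * p^2 / a\<close>.\<close>
  also have "\<dots> \<le> 2 * (V * gv\<^sup>2) + 2304 * c ^ 4 * p\<^sup>2 * (256 * Iv) + 2304 * c ^ 6 * q\<^sup>2 * (V * gv\<^sup>2)"
    using S(3) by (intro add_mono mult_left_mono order_refl) auto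
  finally have Vgu: "V * gu\<^sup>2 \<le> 2 * (V * gv\<^sup>2) + 589824 * c ^ 4 * p\<^sup>2 * Iv + 2304 * c ^ 6 * q\<^sup>2 * (V * gv\<^sup>2)"
    by simp
  define X where "X = b * p\<^sup>2 / a"
  have X: "X \<ge> 0" using ab by (simp add: X_def)
  define F where "F = 1 + q\<^sup>2 + X"
  have c6: "c ^ 6 \<ge> 1" "c ^ 4 \<le> c ^ 6" using c by (auto intro: power_increasing one_le_power)
  have "a * Iu + b * (V * gu\<^sup>2) \<le> a * (256 * Iv)
    + b * (2 * (V * gv\<^sup>2) + 589824 * c ^ 4 * p\<^sup>2 * Iv + 2304 * c ^ 6 * q\<^sup>2 * (V * gv\<^sup>2))"
    using Iu Vgu ab by (intro add_mono mult_left_mono) auto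
  also have "\<dots> = (256 + 589824 * c ^ 4 * X) * (a * Iv) + (2 + 2304 * c ^ 6 * q\<^sup>2) * (b * (V * gv\<^sup>2))"
    using ab by (simp add: X_def field_simps)
  also have "\<dots> \<le> (589824 * c ^ 6 * F) * (a * Iv) + (589824 * c ^ 6 * F) * (b * (V * gv\<^sup>2))"
  proof (intro add_mono mult_right_mono)
    have F: "589824 * c ^ 6 * F = 589824 * c ^ 6 * 1 + 589824 * c ^ 6 * q\<^sup>2 + 589824 * c ^ 6 * X"
      by (simp add: F_def distrib_left)
    have nn: "0 \<le> 589824 * c ^ 6 * X" "0 \<le> 589824 * c ^ 6 * q\<^sup>2"
      using c6 X by (auto intro!: mult_nonneg_nonneg)
    have "256 + 589824 * c ^ 4 * X \<le> 589824 * c ^ 6 * 1 + 589824 * c ^ 6 * X"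
      using c6 X by (intro add_mono mult_right_mono) auto
    then show "256 + 589824 * c ^ 4 * X \<le> 589824 * c ^ 6 * F" using F nn by linarith
    have "2 + 2304 * c ^ 6 * q\<^sup>2 \<le> 589824 * c ^ 6 * 1 + 589824 * c ^ 6 * q\<^sup>2"
      using c6 by (intro add_mono mult_right_mono) auto
    then show "2 + 2304 * c ^ 6 * q\<^sup>2 \<le> 589824 * c ^ 6 * F" using F nn by linarith
  qed (use ab Iv V in auto)
  also have "\<dots> = 589824 * c ^ 6 * F * (a * Iv + b * (V * gv\<^sup>2))" by (simp only: distrib_left)
  finally show ?thesis unfolding F_def X_def Iu_def Iv_def V_def gu_def gv_def .
qed

section \<open>The energy on the whole mesh\<close>

lemma S_h3_continuous:
  assumes "v \<in> S_h3 \<T>"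
  shows "continuous_on (closure \<Omega>) v"
proof -
  have "continuous_on (closure \<Omega>) (\<lambda>x. \<chi> i. v x $ i)"
    using assms Union_mesh by (intro continuous_on_vec_lambda) (auto simp: S_h3_def S_h_def)
  then show ?thesis by simp
qed

definition energy :: "real \<Rightarrow> real \<Rightarrow> (R3 \<Rightarrow> R3) \<Rightarrow> real" where
  "energy a b v = a * L2_inner \<Omega> v v + b * L2_inner \<Omega> (grad v) (grad v)"

lemma energy_eq_sum:
  "v \<in> S_h3 \<T> \<Longrightarrow> energy a b v = (\<Sum>K\<in>\<T>. a * integral\<^sup>L (lebesgue_on K) (\<lambda>x. (norm (aff v K x))\<^sup>2)
    + b * (vol K * (norm (gmat v K))\<^sup>2))"
  by (simp add: energy_def L2_inner_value L2_inner_grad sum_distrib_left sum.distrib)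

lemma energy_comparison:
  fixes p q a b :: real
  assumes u: "u \<in> S_h3 \<T>" and v: "v \<in> S_h3 \<T>" and ab: "a > 0" "b \<ge> 0" and pq: "p \<ge> 0" "q \<ge> 0"
    and le: "\<And>z. z \<in> nodes \<T> \<Longrightarrow> norm (u z) \<le> norm (v z)"
    and diff: "\<And>K S z z'. K \<in> \<T> \<Longrightarrow> (\<And>z. z \<in> vert K \<Longrightarrow> norm (v z) \<le> S) \<Longrightarrow> z \<in> vert K \<Longrightarrow> z' \<in> vert K \<Longrightarrow>
      norm ((u z - v z) - (u z' - v z')) \<le> p * h * S + q * norm (v z - v z')"
  shows "energy a b u \<le> 589824 * c ^ 6 * (1 + q\<^sup>2 + b * p\<^sup>2 / a) * energy a b v"
  unfolding energy_eq_sum[OF u] energy_eq_sum[OF v] sum_distrib_left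
  by (intro sum_mono element_energy_comparison u v ab pq le diff) (auto simp: nodes_eq)

text \<open>A nonzero nodal value already gives a positive integral on one adjacent element. This
  makes the matrix of the preconditioner positive definite and thus invertible.\<close>

lemma energy_pos:
  assumes v: "v \<in> S_h3 \<T>" and ab: "a > 0" "b \<ge> 0" and z: "z \<in> nodes \<T>" "v z \<noteq> 0"
  shows "energy a b v > 0"
proof -
  obtain K where K: "K \<in> \<T>" "z \<in> vert K" using z by (auto simp: nodes_eq)
  obtain S where S: "S \<ge> 0" "\<And>z. z \<in> vert K \<Longrightarrow> norm (v z) \<le> S"
    "vol K * S\<^sup>2 \<le> 256 * integral\<^sup>L (lebesgue_on K) (\<lambda>x. (norm (aff v K x))\<^sup>2)"
    using element_L2_bounds[OF v K(1)] by blast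
  have "S > 0" using S(2)[OF K(2)] z(2) by (metis less_le_trans zero_less_norm_iff)
  then have "0 < vol K * S\<^sup>2" using element(10)[OF K(1)] by simp
  then have pos: "0 < integral\<^sup>L (lebesgue_on K) (\<lambda>x. (norm (aff v K x))\<^sup>2)" using S(3) by linarith
  show ?thesis unfolding energy_eq_sum[OF v]
  proof (rule sum_pos2[OF finite_mesh K(1)])
    show "0 < a * integral\<^sup>L (lebesgue_on K) (\<lambda>x. (norm (aff v K x))\<^sup>2) + b * (vol K * (norm (gmat v K))\<^sup>2)"
      using pos ab by (intro add_pos_nonneg) auto
    show "0 \<le> a * integral\<^sup>L (lebesgue_on L) (\<lambda>x. (norm (aff v L x))\<^sup>2) + b * (vol L * (norm (gmat v L))\<^sup>2)" for L
      using ab by (intro add_nonneg_nonneg mult_nonneg_nonneg Bochner_Integration.integral_nonneg) auto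
  qed
qed

end

section \<open>Weak gradients of finite element functions\<close>

context fe_mesh
begin

text \<open>The domain may be nonconvex, so a Lipschitz bound is available only along segments
  inside the closure. Such a segment is covered by finitely many closed parameter sets, one for each
  element, and a bound on every part passes to the interval.\<close>

lemma lipschitz_along_segment:
  assumes v: "v \<in> S_h3 \<T>" and e: "norm e = 1" and t: "t > 0"
    and seg: "\<And>s. 0 \<le> s \<Longrightarrow> s \<le> t \<Longrightarrow> x + s *\<^sub>R e \<in> closure \<Omega>"
  shows "norm (v (x + t *\<^sub>R e) - v x) \<le> (\<Sum>K\<in>\<T>. norm (gmat v K)) * t"
proof -
  define L where "L = (\<Sum>K\<in>\<T>. norm (gmat v K))"
  define U where "U = (\<lambda>K. {s. x + s *\<^sub>R e \<in> K})"
  have "L-lipschitz_on (U K) (\<lambda>s. v (x + s *\<^sub>R e))" if K: "K \<in> \<T>" for K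
  proof (rule lipschitz_onI)
    fix s s' assume s: "s \<in> U K" "s' \<in> U K"
    have "v (x + s *\<^sub>R e) - v (x + s' *\<^sub>R e) = gmat v K *v ((x + s *\<^sub>R e) - (x + s' *\<^sub>R e))"
      using aff_eq[OF v K, of "x + s *\<^sub>R e"] aff_eq[OF v K, of "x + s' *\<^sub>R e"] s
        aff_diff[of v K "x + s *\<^sub>R e" "x + s' *\<^sub>R e"] by (simp add: U_def)
    also have "(x + s *\<^sub>R e) - (x + s' *\<^sub>R e) = (s - s') *\<^sub>R e" by (simp add: scaleR_diff_left)
    finally have "dist (v (x + s *\<^sub>R e)) (v (x + s' *\<^sub>R e)) = norm (gmat v K *v ((s - s') *\<^sub>R e))"
      by (simp add: dist_norm)
    also have "\<dots> \<le> norm (gmat v K) * dist s s'"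
      using norm_matrix_vector_le[of "gmat v K" "(s - s') *\<^sub>R e"] e by (simp add: dist_real_def)
    also have "\<dots> \<le> L * dist s s'"
      unfolding L_def using finite_mesh K by (intro mult_right_mono member_le_sum) auto
    finally show "dist (v (x + s *\<^sub>R e)) (v (x + s' *\<^sub>R e)) \<le> L * dist s s'" .
  qed (simp add: L_def sum_nonneg)
  moreover have "closed (U K)" if "K \<in> \<T>" for K
  proof -
    have "closed ((\<lambda>s. x + s *\<^sub>R e) -` K)"
      using closed_element[OF that] by (intro continuous_closed_vimage) (auto intro!: continuous_intros)
    then show ?thesis by (simp add: U_def vimage_def)
  qed
  moreover have "{0..t} \<subseteq> (\<Union>K\<in>\<T>. U K)" using seg Union_mesh by (fastforce simp: U_def)
  ultimately have "L-lipschitz_on {0..t} (\<lambda>s. v (x + s *\<^sub>R e))"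
    using finite_mesh by (intro lipschitz_on_closed_Union[where I = \<T> and U = U]) (auto simp: L_def sum_nonneg)
  then have "dist (v (x + t *\<^sub>R e)) (v (x + 0 *\<^sub>R e)) \<le> L * dist t 0"
    using t by (intro lipschitz_onD) auto
  then show ?thesis using t by (simp add: dist_norm L_def)
qed

end

lemma test_function_props:
  assumes "test_function \<Omega> \<psi>"
  shows "continuous_on UNIV \<psi>" "continuous_on UNIV (partial_deriv j \<psi>)"
    "((\<lambda>s. \<psi> (x + s *\<^sub>R axis j 1)) has_field_derivative partial_deriv j \<psi> (x + s *\<^sub>R axis j 1)) (at s)"
    "\<exists>B. \<forall>x. \<bar>\<psi> x\<bar> \<le> B" "\<exists>B. \<forall>x. \<bar>partial_deriv j \<psi> x\<bar> \<le> B"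
proof -
  have C: "C_k n \<psi>" for n using assms by (simp add: test_function_def)
  define K where "K = closure {x. \<psi> x \<noteq> 0}"
  have K: "compact K" using assms by (simp add: test_function_def K_def)
  show 1: "continuous_on UNIV \<psi>" using C[of 0] by simp
  have "C_k 1 \<psi>" by (rule C)
  then show 2: "continuous_on UNIV (partial_deriv j \<psi>)" by simp
  have diff: "\<psi> differentiable at x" for x using C[of 1] by (simp add: differentiable_on_def)
  have D: "(\<psi> has_derivative frechet_derivative \<psi> (at x)) (at x)" for x
    using diff frechet_derivative_works by blast
  have lin: "linear (frechet_derivative \<psi> (at x))" for x using D has_derivative_linear by blast
  have "((\<lambda>s. x + s *\<^sub>R axis j 1) has_derivative (\<lambda>s. s *\<^sub>R axis j 1)) (at s)"
    by (auto intro!: derivative_eq_intros)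
  then have "((\<lambda>s. \<psi> (x + s *\<^sub>R axis j 1)) has_derivative
    (\<lambda>h. frechet_derivative \<psi> (at (x + s *\<^sub>R axis j 1)) (h *\<^sub>R axis j 1))) (at s)"
    using has_derivative_compose D by blast
  also have "(\<lambda>h. frechet_derivative \<psi> (at (x + s *\<^sub>R axis j 1)) (h *\<^sub>R axis j 1)) = (*) (partial_deriv j \<psi> (x + s *\<^sub>R axis j 1))"
    by (simp add: partial_deriv_def linear_scale[OF lin] mult.commute fun_eq_iff)
  finally show "((\<lambda>s. \<psi> (x + s *\<^sub>R axis j 1)) has_field_derivative partial_deriv j \<psi> (x + s *\<^sub>R axis j 1)) (at s)"
    by (simp add: has_field_derivative_def)
  have bnd: "\<exists>B. \<forall>x. \<bar>f x\<bar> \<le> B" if "continuous_on UNIV f" "\<And>x. x \<notin> K \<Longrightarrow> f x = 0" for f :: "R3 \<Rightarrow> real"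
  proof -
    have "continuous_on K f" using that(1) continuous_on_subset by blast
    then have "bounded (f ` K)" using compact_continuous_image K compact_imp_bounded by blast
    then obtain B where B: "\<And>x. x \<in> K \<Longrightarrow> \<bar>f x\<bar> \<le> B" by (auto simp: bounded_iff)
    have "\<bar>f x\<bar> \<le> \<bar>B\<bar>" for x using B[of x] that(2)[of x] by (cases "x \<in> K") auto
    then show ?thesis by blast
  qed
  have off: "\<psi> x = 0" if "x \<notin> K" for x using that closure_subset[of "{x. \<psi> x \<noteq> 0}"] by (auto simp: K_def)
  show "\<exists>B. \<forall>x. \<bar>\<psi> x\<bar> \<le> B" using bnd[OF 1] off by blast
  have "partial_deriv j \<psi> x = 0" if x: "x \<notin> K" for x
  proof -
    have op: "open (- K)" using compact_imp_closed[OF K] by (rule open_Compl)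
    then have "(\<psi> has_derivative (\<lambda>_. 0)) (at x)"
      using x off by (intro has_derivative_transform_within_open[OF has_derivative_const op]) auto
    then have "frechet_derivative \<psi> (at x) = (\<lambda>_. 0)" using frechet_derivative_at by metis
    then show ?thesis by (simp add: partial_deriv_def)
  qed
  then show "\<exists>B. \<forall>x. \<bar>partial_deriv j \<psi> x\<bar> \<le> B" using bnd[OF 2] by blast
qed

context fe_mesh
begin

text \<open>Difference quotients are moved from \<open>v\<close> to the test function by translation invariance;
  they converge boundedly on both sides because \<open>v\<close> is Lipschitz continuous along short segments.\<close>

lemma weak_gradient_S_h3:
  assumes v: "v \<in> S_h3 \<T>"
  shows "weak_gradient \<Omega> v (grad v)"
  unfolding weak_gradient_def
proof (intro allI impI)
  fix \<psi> i j assume \<psi>: "test_function \<Omega> \<psi>"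
  note \<psi>_props = test_function_props[OF \<psi>]
  define e :: R3 where "e = axis j 1"
  have e: "norm e = 1" by (simp add: e_def)
  define S where "S = closure {x. \<psi> x \<noteq> 0}"
  have S: "compact S" "S \<subseteq> \<Omega>" using \<psi> by (auto simp: test_function_def S_def)
  have off: "\<psi> x = 0" if "x \<notin> S" for x using that closure_subset[of "{x. \<psi> x \<noteq> 0}"] by (auto simp: S_def)
  \<comment> \<open>Points of the support moved by less than \<delta> stay in the domain, together
    with the segment in between.\<close>
  obtain \<delta> where \<delta>: "\<delta> > 0" "(\<Union>x\<in>S. ball x \<delta>) \<subseteq> \<Omega>"
    using compact_subset_open_imp_ball_epsilon_subset[OF S(1) domain(1) S(2)] by blast
  obtain B where B: "\<And>x. \<bar>\<psi> x\<bar> \<le> B" using \<psi>_props(4) by blast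
  obtain B' where B': "\<And>x. \<bar>partial_deriv j \<psi> x\<bar> \<le> B'" using \<psi>_props(5) by blast
  \<comment> \<open>The double successor makes all steps strictly smaller than \<delta>.\<close>
  define t where "t = (\<lambda>n::nat. \<delta> * inverse (real (Suc (Suc n))))"
  have t: "t n > 0" "t n < \<delta>" for n
  proof -
    show "t n > 0" using \<delta>(1) by (simp add: t_def)
    have "inverse (real (Suc (Suc n))) < 1" by (rule inverse_less_1_iff[THEN iffD2]) simp
    then show "t n < \<delta>" using mult_strict_left_mono[OF _ \<delta>(1)] by (fastforce simp: t_def)
  qed
  have t0: "t \<longlonglongrightarrow> 0" unfolding t_def
    by (intro tendsto_mult_right_zero LIMSEQ_Suc[OF LIMSEQ_inverse_real_of_nat])
  \<comment> \<open>Extension by zero makes the integrals global, as translation invariance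
    requires. Its jump at the boundary is never differenced where the test function is nonzero, by
    the choice of \<delta>.\<close>
  define F where "F = (\<lambda>x. indicator \<Omega> x *\<^sub>R (v x $ i))"
  have cont: "continuous_on (closure \<Omega>) (\<lambda>x. v x $ i)"
    using S_h3_continuous[OF v] by (rule continuous_on_component)
  have F_borel[measurable]: "F \<in> borel_measurable borel" unfolding F_def
    using continuous_on_subset[OF cont closure_subset] domain(1)
    by (intro borel_measurable_continuous_on_indicator) auto
  have \<psi>_borel[measurable]: "\<psi> \<in> borel_measurable borel" "partial_deriv j \<psi> \<in> borel_measurable borel"
    using \<psi>_props(1,2) by (auto intro: borel_measurable_continuous_onI)
  have "bounded ((\<lambda>x. v x $ i) ` closure \<Omega>)"
    using compact_continuous_image[OF cont] domain(3) compact_closure compact_imp_bounded by blast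
  then obtain C where C: "\<And>x. x \<in> \<Omega> \<Longrightarrow> \<bar>v x $ i\<bar> \<le> C"
    using closure_subset by (fastforce simp: bounded_iff)
  obtain x0 where "x0 \<in> \<Omega>" using domain(2) by blast
  then have C0: "C \<ge> 0" using C[of x0] by linarith
  have FC: "\<bar>F x\<bar> \<le> C" for x using C[of x] C0 by (simp add: F_def indicator_def)
  \<comment> \<open>\<open>D\<close> takes the difference quotient of the function, \<open>E\<close>
    that of the test function with the opposite shift. Their integrals agree, and their limits are
    the two sides of the integration by parts.\<close>
  define D where "D = (\<lambda>n x. (F (x + t n *\<^sub>R e) - F x) / t n * \<psi> x)"
  define E where "E = (\<lambda>n x. F x * ((\<psi> (x - t n *\<^sub>R e) - \<psi> x) / t n))"
  have ind: "integrable lborel (\<lambda>x. indicator S x *\<^sub>R (1::real))"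
    using S(1) emeasure_compact_finite[OF S(1)]
    by (intro integrable_scaleR_left integrable_real_indicator) (auto simp: borel_compact)
  have \<psi>_int: "integrable lborel (\<lambda>x. f x * \<psi> x)" if [measurable]: "f \<in> borel_measurable borel" and "\<And>x. \<bar>f x\<bar> \<le> C" for f
  proof (rule Bochner_Integration.integrable_bound)
    show "integrable lborel (\<lambda>x. (C * B) * (indicator S x *\<^sub>R (1::real)))" using ind by (rule integrable_mult_right)
    show "AE x in lborel. norm (f x * \<psi> x) \<le> norm ((C * B) * (indicator S x *\<^sub>R (1::real)))"
    proof (intro AE_I2)
      fix x
      have "\<bar>f x\<bar> * \<bar>\<psi> x\<bar> \<le> C * B" using that(2)[of x] B[of x] C0 by (intro mult_mono) auto
      then show "norm (f x * \<psi> x) \<le> norm ((C * B) * (indicator S x *\<^sub>R (1::real)))"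
        using off[of x] C0 order_trans[OF abs_ge_zero B[of x]] by (cases "x \<in> S") (auto simp: abs_mult)
    qed
  qed simp
  have shift: "integral\<^sup>L lborel (\<lambda>x. F (x + a) * \<psi> x) = integral\<^sup>L lborel (\<lambda>x. F x * \<psi> (x - a))"
    "integrable lborel (\<lambda>x. F x * \<psi> (x - a))" for a
  proof -
    have m: "(\<lambda>x. F (x + a) * \<psi> x) \<in> borel_measurable borel" by measurable
    have d: "lborel = distr lborel borel (\<lambda>x. x - a)"
    proof -
      have "(+) (- a) = (\<lambda>x. x - a)" by (simp add: fun_eq_iff)
      then show ?thesis using lborel_distr_plus[of "- a"] by simp
    qed
    have "integral\<^sup>L lborel (\<lambda>x. F (x + a) * \<psi> x) = integral\<^sup>L (distr lborel borel (\<lambda>x. x - a)) (\<lambda>x. F (x + a) * \<psi> x)"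
      using d by simp
    also have "\<dots> = integral\<^sup>L lborel (\<lambda>x. F x * \<psi> (x - a))"
      using m by (subst integral_distr) auto
    finally show "integral\<^sup>L lborel (\<lambda>x. F (x + a) * \<psi> x) = integral\<^sup>L lborel (\<lambda>x. F x * \<psi> (x - a))" .
    have "integrable lborel (\<lambda>x. F (x + a) * \<psi> x)" using FC by (intro \<psi>_int) auto
    then have "integrable (distr lborel borel (\<lambda>x. x - a)) (\<lambda>x. F (x + a) * \<psi> x)" using d by simp
    then show "integrable lborel (\<lambda>x. F x * \<psi> (x - a))" using m by (subst (asm) integrable_distr_eq) auto
  qed
  have DE: "integral\<^sup>L lebesgue (D n) = integral\<^sup>L lebesgue (E n)" for n
  proof -
    have [measurable]: "D n \<in> borel_measurable borel" "E n \<in> borel_measurable borel"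
      unfolding D_def E_def by measurable
    have "integral\<^sup>L lborel (D n) = integral\<^sup>L lborel (\<lambda>x. (F (x + t n *\<^sub>R e) * \<psi> x - F x * \<psi> x) / t n)"
      by (simp add: D_def algebra_simps diff_divide_distrib)
    also have "\<dots> = (integral\<^sup>L lborel (\<lambda>x. F (x + t n *\<^sub>R e) * \<psi> x) - integral\<^sup>L lborel (\<lambda>x. F x * \<psi> x)) / t n"
      using FC by (subst integral_divide_zero, subst Bochner_Integration.integral_diff) (auto intro!: \<psi>_int)
    also have "\<dots> = (integral\<^sup>L lborel (\<lambda>x. F x * \<psi> (x - t n *\<^sub>R e)) - integral\<^sup>L lborel (\<lambda>x. F x * \<psi> x)) / t n"
      by (simp add: shift)
    also have "\<dots> = integral\<^sup>L lborel (\<lambda>x. (F x * \<psi> (x - t n *\<^sub>R e) - F x * \<psi> x) / t n)"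
      using FC by (subst integral_divide_zero, subst Bochner_Integration.integral_diff) (auto intro!: \<psi>_int shift(2))
    also have "\<dots> = integral\<^sup>L lborel (E n)" by (simp add: E_def algebra_simps diff_divide_distrib)
    finally show ?thesis by (simp add: integral_completion)
  qed
  define L where "L = (\<Sum>K\<in>\<T>. norm (gmat v K))"
  have L0: "L \<ge> 0" by (simp add: L_def sum_nonneg)
  define G where "G = (\<lambda>x. if x \<in> \<Omega> then grad v x $ i $ j else 0)"
  have ind\<Omega>: "integrable lebesgue (\<lambda>x. a * indicator \<Omega> x :: real)" for a
    using domain_lmeasurable by (intro integrable_mult_right integrable_real_indicator) (auto simp: fmeasurable_def)
  have "piecewise (\<lambda>x. grad v x $ i $ j) (\<lambda>K x. gmat v K $ i $ j)"
    using grad_eq_gmat[OF v] by (simp add: piecewise_def)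
  then have "(\<lambda>x. grad v x $ i $ j) \<in> borel_measurable (lebesgue_on \<Omega>)" by (rule piecewise_measurable)
  then have G_meas: "G \<in> borel_measurable lebesgue"
    unfolding G_def using borel_measurable_if_I domain_lmeasurable(2) by blast
  have borel_leb: "f \<in> borel_measurable lebesgue" if "f \<in> borel_measurable borel" for f :: "R3 \<Rightarrow> real"
    using that by (simp add: measurable_completion)
  have "(\<lambda>n. integral\<^sup>L lebesgue (D n)) \<longlonglongrightarrow> integral\<^sup>L lebesgue (\<lambda>x. G x * \<psi> x)"
  proof (rule integral_dominated_convergence[OF _ _ ind\<Omega>[of "L * B"]])
    show "(\<lambda>x. G x * \<psi> x) \<in> borel_measurable lebesgue"
      using G_meas borel_leb[OF \<psi>_borel(1)] by (rule borel_measurable_times)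
    show "D n \<in> borel_measurable lebesgue" for n
      by (rule borel_leb) (unfold D_def, measurable)
    show "AE x in lebesgue. norm (D n x) \<le> L * B * indicator \<Omega> x" for n
    proof (intro AE_I2)
      fix x
      show "norm (D n x) \<le> L * B * indicator \<Omega> x"
      proof (cases "x \<in> S")
        case True
        have seg: "x + s *\<^sub>R e \<in> \<Omega>" if "0 \<le> s" "s \<le> t n" for s
        proof -
          have "x + s *\<^sub>R e \<in> ball x \<delta>" using that t(2)[of n] e by (simp add: dist_norm)
          then show ?thesis using \<delta>(2) True by blast
        qed
        have "norm (v (x + t n *\<^sub>R e) - v x) \<le> L * t n"
          unfolding L_def using seg closure_subset by (intro lipschitz_along_segment[OF v e t(1)]) blast
        then have "\<bar>v (x + t n *\<^sub>R e) $ i - v x $ i\<bar> \<le> L * t n"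
          using component_le_norm_cart[of "v (x + t n *\<^sub>R e) - v x" i] by simp
        moreover have "x \<in> \<Omega>" "x + t n *\<^sub>R e \<in> \<Omega>" using seg[of 0] seg[of "t n"] t(1)[of n] by auto
        ultimately have "\<bar>F (x + t n *\<^sub>R e) - F x\<bar> \<le> L * t n" by (simp add: F_def)
        then have "\<bar>(F (x + t n *\<^sub>R e) - F x) / t n\<bar> \<le> L"
          using t(1)[of n] by (simp add: abs_divide pos_divide_le_eq)
        then have "\<bar>(F (x + t n *\<^sub>R e) - F x) / t n\<bar> * \<bar>\<psi> x\<bar> \<le> L * B"
          using B[of x] L0 by (intro mult_mono) auto
        then show ?thesis using \<open>x \<in> \<Omega>\<close> by (simp add: D_def abs_mult)
      next
        case False
        have "L \<ge> 0" "B \<ge> 0" using B[of x] by (auto simp: L_def sum_nonneg)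
        then show ?thesis using off[OF False] by (simp add: D_def)
      qed
    qed
    have "AE x in lebesgue. x \<notin> (\<Union>K\<in>\<T>. frontier K)"
      using negligible_skeleton by (intro AE_not_in) (simp add: negligible_iff_null_sets)
    then show "AE x in lebesgue. (\<lambda>n. D n x) \<longlonglongrightarrow> G x * \<psi> x"
    proof eventually_elim
      case (elim x)
      show ?case
      proof (cases "x \<in> \<Omega>")
        case True
        then have "x \<in> closure \<Omega> - (\<Union>K\<in>\<T>. frontier K)" using elim closure_subset by blast
        then obtain K where K: "K \<in> \<T>" "x \<in> interior K" by (rule off_skeleton)
        have Gx: "G x = gmat v K $ i $ j" using True grad_eq_gmat[OF v K] by (simp add: G_def)
        \<comment> \<open>For small steps both points lie in the same element, so the quotient is
          not merely close to the entry of \<open>gmat\<close> but equal to it.\<close>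
        have "(\<lambda>n. x + t n *\<^sub>R e) \<longlonglongrightarrow> x + 0 *\<^sub>R e" by (intro tendsto_intros t0)
        then have "\<forall>\<^sub>F n in sequentially. x + t n *\<^sub>R e \<in> interior K"
          using K(2) by (intro topological_tendstoD) auto
        then have "\<forall>\<^sub>F n in sequentially. G x * \<psi> x = D n x"
        proof eventually_elim
          case (elim n)
          have "x + t n *\<^sub>R e \<in> \<Omega>" using elim interior_element_subset[OF K(1)] by blast
          moreover have "v (x + t n *\<^sub>R e) - v x = gmat v K *v (t n *\<^sub>R e)"
            using aff_diff[of v K "x + t n *\<^sub>R e" x] aff_eq[OF v K(1)] elim K(2) interior_subset[of K]
            by (simp add: subset_iff)
          then have "v (x + t n *\<^sub>R e) $ i - v x $ i = t n * gmat v K $ i $ j"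
            by (simp add: e_def matrix_vector_mult_scaleR matrix_vector_mult_basis column_def flip: vector_minus_component)
          ultimately show ?case using True t(1)[of n] Gx by (simp add: D_def F_def)
        qed
        then show ?thesis by (rule tendsto_eventually[OF eventually_mono]) simp
      next
        case False
        then have "\<psi> x = 0" using off[of x] S(2) by blast
        then show ?thesis by (simp add: D_def)
      qed
    qed
  qed
  moreover have "(\<lambda>n. integral\<^sup>L lebesgue (E n)) \<longlonglongrightarrow> integral\<^sup>L lebesgue (\<lambda>x. F x * - partial_deriv j \<psi> x)"
  proof (rule integral_dominated_convergence[OF _ _ ind\<Omega>[of "C * B'"]])
    show "(\<lambda>x. F x * - partial_deriv j \<psi> x) \<in> borel_measurable lebesgue"
      by (rule borel_leb) measurable
    show "E n \<in> borel_measurable lebesgue" for n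
      by (rule borel_leb) (unfold E_def, measurable)
    have der: "((\<lambda>s. \<psi> (x + s *\<^sub>R e)) has_field_derivative partial_deriv j \<psi> (x + s *\<^sub>R e)) (at s)" for x s
      using \<psi>_props(3) by (simp add: e_def)
    show "AE x in lebesgue. norm (E n x) \<le> C * B' * indicator \<Omega> x" for n
    proof (intro AE_I2)
      fix x
      have "norm (\<psi> (x + (- t n) *\<^sub>R e) - \<psi> (x + 0 *\<^sub>R e)) \<le> B' * norm (- t n - 0)"
        using B' by (intro field_differentiable_bound[where S = UNIV and f' = "\<lambda>s. partial_deriv j \<psi> (x + s *\<^sub>R e)"])
          (auto intro: der)
      then have "\<bar>(\<psi> (x - t n *\<^sub>R e) - \<psi> x) / t n\<bar> \<le> B'"
        using t(1)[of n] by (simp add: abs_divide pos_divide_le_eq)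
      then have "\<bar>F x\<bar> * \<bar>(\<psi> (x - t n *\<^sub>R e) - \<psi> x) / t n\<bar> \<le> C * B'"
        using FC[of x] C0 by (intro mult_mono) auto
      then show "norm (E n x) \<le> C * B' * indicator \<Omega> x"
        by (cases "x \<in> \<Omega>") (auto simp: E_def abs_mult F_def)
    qed
    show "AE x in lebesgue. (\<lambda>n. E n x) \<longlonglongrightarrow> F x * - partial_deriv j \<psi> x"
    proof (intro AE_I2)
      fix x
      have "((\<lambda>s. (\<psi> (x + (0 + s) *\<^sub>R e) - \<psi> (x + 0 *\<^sub>R e)) / s) \<longlongrightarrow> partial_deriv j \<psi> (x + 0 *\<^sub>R e)) (at 0)"
        using der[of x 0] unfolding DERIV_def .
      \<comment> \<open>The translation has changed sign on its way to the test function.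
        Approaching the derivative along \<open>- t n\<close> produces the minus sign in the
        definition of the weak gradient.\<close>
      moreover have "filterlim (\<lambda>n. - t n) (at 0) sequentially"
        using t(1) tendsto_minus[OF t0] by (intro filterlim_atI) (auto simp: less_imp_neq[symmetric] intro!: always_eventually)
      ultimately have "(\<lambda>n. (\<psi> (x + (0 + - t n) *\<^sub>R e) - \<psi> (x + 0 *\<^sub>R e)) / - t n) \<longlonglongrightarrow> partial_deriv j \<psi> (x + 0 *\<^sub>R e)"
        by (rule filterlim_compose)
      then have "(\<lambda>n. F x * - ((\<psi> (x + (0 + - t n) *\<^sub>R e) - \<psi> (x + 0 *\<^sub>R e)) / - t n)) \<longlonglongrightarrow> F x * - partial_deriv j \<psi> (x + 0 *\<^sub>R e)"
        by (intro tendsto_mult_left tendsto_minus)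
      then show "(\<lambda>n. E n x) \<longlonglongrightarrow> F x * - partial_deriv j \<psi> x" by (simp add: E_def)
    qed
  qed
  ultimately have "integral\<^sup>L lebesgue (\<lambda>x. G x * \<psi> x) = integral\<^sup>L lebesgue (\<lambda>x. F x * - partial_deriv j \<psi> x)"
    unfolding DE using LIMSEQ_unique by blast
  also have "\<dots> = - integral\<^sup>L lebesgue (\<lambda>x. indicator \<Omega> x *\<^sub>R (v x $ i * partial_deriv j \<psi> x))"
    by (simp add: F_def mult.assoc)
  also have "\<dots> = - integral\<^sup>L (lebesgue_on \<Omega>) (\<lambda>x. v x $ i * partial_deriv j \<psi> x)"
    using domain_lmeasurable by (subst integral_restrict_space) auto
  also have "integral\<^sup>L lebesgue (\<lambda>x. G x * \<psi> x) = integral\<^sup>L lebesgue (\<lambda>x. indicator \<Omega> x *\<^sub>R (grad v x $ i $ j * \<psi> x))"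
    by (intro Bochner_Integration.integral_cong) (auto simp: G_def)
  also have "\<dots> = integral\<^sup>L (lebesgue_on \<Omega>) (\<lambda>x. grad v x $ i $ j * \<psi> x)"
    using domain_lmeasurable by (subst integral_restrict_space) auto
  finally show "integral\<^sup>L (lebesgue_on \<Omega>) (\<lambda>x. v x $ i * partial_deriv j \<psi> x)
    = - integral\<^sup>L (lebesgue_on \<Omega>) (\<lambda>x. grad v x $ i $ j * \<psi> x)"
    by simp
qed

lemma piecewise_L2_fun:
  assumes "piecewise f g"
  shows "L2_fun \<Omega> f"
  using piecewise_measurable[OF assms] piecewise_integrable[OF piecewise_inner[OF assms assms]]
  by (simp add: L2_fun_def power2_norm_eq_inner)

lemma H1_fun_S_h3: "v \<in> S_h3 \<T> \<Longrightarrow> H1_fun \<Omega> v (grad v)"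
  by (simp add: H1_fun_def weak_gradient_S_h3 piecewise_L2_fun[OF piecewise_value] piecewise_L2_fun[OF piecewise_grad])

end

section \<open>Matrices as bilinear forms\<close>

lemma scalar_prod_mat_mult_vec:
  fixes x y :: "real Matrix.vec"
  assumes "x \<in> carrier_vec n" "y \<in> carrier_vec n"
  shows "y \<bullet> (Matrix.mat n n f *\<^sub>v x) = (\<Sum>i<n. \<Sum>j<n. (vec_index y i * vec_index x j) * f (i, j))"
  using assms by (simp add: scalar_prod_def sum_distrib_left atLeast0LessThan mult_ac)

lemma scalar_prod_congruence:
  fixes x y :: "real Matrix.vec"
  assumes Q: "Q \<in> carrier_mat n k" and B: "B \<in> carrier_mat n n"
    and x: "x \<in> carrier_vec k" and y: "y \<in> carrier_vec k"
  shows "y \<bullet> ((transpose_mat Q * B * Q) *\<^sub>v x) = (Q *\<^sub>v y) \<bullet> (B *\<^sub>v (Q *\<^sub>v x))"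
proof -
  have "(transpose_mat Q * B * Q) *\<^sub>v x = transpose_mat Q *\<^sub>v (B *\<^sub>v (Q *\<^sub>v x))"
    using Q B x by (simp add: assoc_mult_mat_vec[of _ k n _ k] assoc_mult_mat_vec[of _ k n _ n])
  moreover have "(transpose_mat Q *\<^sub>v (B *\<^sub>v (Q *\<^sub>v x))) \<bullet> y = (B *\<^sub>v (Q *\<^sub>v x)) \<bullet> (Q *\<^sub>v y)"
    using Q B x y by (intro transpose_vec_mult_scalar[of _ n k]) auto
  ultimately show ?thesis using Q B x y
    by (simp add: comm_scalar_prod[of _ k] comm_scalar_prod[of _ n])
qed

lemma double_sum_integral:
  fixes q :: "nat \<Rightarrow> nat \<Rightarrow> 'a \<Rightarrow> real"
  assumes "\<And>i j. i < n \<Longrightarrow> j < n \<Longrightarrow> integrable M (q i j)"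
  shows "(\<Sum>i<n. \<Sum>j<n. (a i * b j) * integral\<^sup>L M (q i j)) = integral\<^sup>L M (\<lambda>x. \<Sum>i<n. \<Sum>j<n. (a i * b j) * q i j x)"
proof -
  have "integral\<^sup>L M (\<lambda>x. \<Sum>i<n. \<Sum>j<n. (a i * b j) * q i j x) = (\<Sum>i<n. integral\<^sup>L M (\<lambda>x. \<Sum>j<n. (a i * b j) * q i j x))"
    using assms by (intro Bochner_Integration.integral_sum Bochner_Integration.integrable_sum integrable_mult_right) auto
  also have "\<dots> = (\<Sum>i<n. \<Sum>j<n. integral\<^sup>L M (\<lambda>x. (a i * b j) * q i j x))"
    using assms by (intro sum.cong refl Bochner_Integration.integral_sum integrable_mult_right) auto
  finally show ?thesis by simp
qed

lemma sum_matrix_vector_mult: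
  fixes f :: "'i \<Rightarrow> real^'n^'m"
  shows "(\<Sum>i\<in>A. f i) *v x = (\<Sum>i\<in>A. f i *v x)"
  by (induction A rule: infinite_finite_induct) (simp_all add: matrix_vector_mult_add_rdistrib)

lemma sum_lessThan_3_times:
  fixes f :: "nat \<Rightarrow> 'a::comm_monoid_add"
  shows "(\<Sum>i<3 * n. f i) = (\<Sum>j<n. f (3 * j) + f (3 * j + 1) + f (3 * j + 2))"
  by (induction n) (simp_all add: add_ac numeral_eq_Suc)

lemma sum_lessThan_2_times:
  fixes f :: "nat \<Rightarrow> 'a::comm_monoid_add"
  shows "(\<Sum>i<2 * n. f i) = (\<Sum>j<n. f (2 * j) + f (2 * j + 1))"
  by (induction n) (simp_all add: add_ac numeral_eq_Suc)

section \<open>Coefficient vectors and the functions they represent\<close>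

locale fe_basis = fe_mesh +
  fixes N :: nat and z :: "nat \<Rightarrow> R3" and \<phi> :: "nat \<Rightarrow> R3 \<Rightarrow> real"
  assumes hat: "hat_functions \<T> N z \<phi>"
begin

lemma hat_props:
  "bij_betw z {..<N} (nodes \<T>)" "j < N \<Longrightarrow> \<phi> j \<in> S_h \<T>"
  "i < N \<Longrightarrow> j < N \<Longrightarrow> \<phi> j (z i) = (if i = j then 1 else 0)"
  using hat by (auto simp: hat_functions_def)

lemma node_index: "j < N \<Longrightarrow> z j \<in> nodes \<T>" "y \<in> nodes \<T> \<Longrightarrow> \<exists>j<N. y = z j"
  using hat_props(1) by (auto simp: bij_betw_def)

lemma basis_fun_S_h3:
  assumes "i < 3 * N"
  shows "basis_fun \<phi> i \<in> S_h3 \<T>"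
proof -
  have "\<phi> (i div 3) \<in> S_h \<T>" using assms by (intro hat_props) auto
  then have cont: "continuous_on (\<Union>\<T>) (\<phi> (i div 3))"
    and aff: "\<And>K. K \<in> \<T> \<Longrightarrow> \<exists>A b. linear A \<and> (\<forall>x\<in>K. \<phi> (i div 3) x = A x + b)"
    by (auto simp: S_h_def)
  show ?thesis unfolding S_h3_def S_h_def mem_Collect_eq
  proof (intro allI conjI ballI)
    fix l
    show "continuous_on (\<Union>\<T>) (\<lambda>x. basis_fun \<phi> i x $ l)"
      unfolding basis_fun_def vector_scaleR_component by (intro continuous_intros cont)
    fix K assume "K \<in> \<T>"
    then obtain A b where A: "linear A" "\<forall>x\<in>K. \<phi> (i div 3) x = A x + b" using aff by blast
    define t :: real where "t = (axis (of_nat (Suc (i mod 3))) 1 :: R3) $ l"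
    have "linear (\<lambda>x. A x * t)"
      using linear_compose_scale_right[OF A(1), of t] by (simp add: mult.commute)
    then show "\<exists>A b. linear A \<and> (\<forall>x\<in>K. basis_fun \<phi> i x $ l = A x + b)"
      using A(2) by (intro exI[of _ "\<lambda>x. A x * t"] exI[of _ "b * t"]) (simp add: basis_fun_def t_def distrib_right)
  qed
qed

definition fe :: "real Matrix.vec \<Rightarrow> R3 \<Rightarrow> R3" where
  "fe y x = (\<Sum>i<3*N. vec_index y i *\<^sub>R basis_fun \<phi> i x)"

lemma fe_aff:
  assumes "K \<in> \<T>" "x \<in> K"
  shows "fe y x = (\<Sum>i<3*N. vec_index y i *\<^sub>R gmat (basis_fun \<phi> i) K) *v x
    + (\<Sum>i<3*N. vec_index y i *\<^sub>R aff (basis_fun \<phi> i) K 0)"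
proof -
  have "basis_fun \<phi> i x = gmat (basis_fun \<phi> i) K *v x + aff (basis_fun \<phi> i) K 0" if "i < 3 * N" for i
    using aff_diff[of "basis_fun \<phi> i" K x 0] aff_eq[OF basis_fun_S_h3[OF that] assms] by (simp add: algebra_simps)
  moreover have "(\<Sum>i<3*N. vec_index y i *\<^sub>R gmat (basis_fun \<phi> i) K) *v x
    = (\<Sum>i<3*N. vec_index y i *\<^sub>R (gmat (basis_fun \<phi> i) K *v x))"
    by (simp add: sum_matrix_vector_mult scaleR_matrix_vector_assoc)
  ultimately show ?thesis by (simp add: fe_def sum.distrib scaleR_right_distrib)
qed

lemma S_h3_I:
  assumes "continuous_on (\<Union>\<T>) v" "\<And>K. K \<in> \<T> \<Longrightarrow> \<exists>A b. \<forall>x\<in>K. v x = A *v x + b"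
  shows "v \<in> S_h3 \<T>"
  unfolding S_h3_def S_h_def mem_Collect_eq
proof (intro allI conjI ballI)
  fix i
  show "continuous_on (\<Union>\<T>) (\<lambda>x. v x $ i)" using assms(1) by (rule continuous_on_component)
  fix K assume "K \<in> \<T>"
  then obtain A b where "\<forall>x\<in>K. v x = A *v x + b" using assms(2) by blast
  moreover have "linear (\<lambda>x. (A *v x) $ i)"
    by (intro linearI) (simp_all add: matrix_vector_right_distrib matrix_vector_mult_scaleR)
  ultimately show "\<exists>A b. linear A \<and> (\<forall>x\<in>K. v x $ i = A x + b)"
    by (intro exI[of _ "\<lambda>x. (A *v x) $ i"] exI[of _ "b $ i"]) simp
qed

lemma fe_S_h3: "fe y \<in> S_h3 \<T>"
proof (rule S_h3_I)
  have "continuous_on (closure \<Omega>) (\<lambda>x. \<Sum>i<3*N. vec_index y i *\<^sub>R basis_fun \<phi> i x)"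
    using basis_fun_S_h3 by (intro continuous_intros S_h3_continuous) auto
  then show "continuous_on (\<Union>\<T>) (fe y)" by (simp add: Union_mesh fe_def[abs_def])
  show "\<exists>A b. \<forall>x\<in>K. fe y x = A *v x + b" if "K \<in> \<T>" for K
    using fe_aff[OF that] by blast
qed

lemma grad_fe:
  assumes "K \<in> \<T>" "x \<in> interior K"
  shows "grad (fe y) x = (\<Sum>i<3*N. vec_index y i *\<^sub>R grad (basis_fun \<phi> i) x)"
proof -
  have "grad (fe y) x = (\<Sum>i<3*N. vec_index y i *\<^sub>R gmat (basis_fun \<phi> i) K)"
    using grad_affine[OF assms(2) fe_aff[OF assms(1)]] .
  also have "\<dots> = (\<Sum>i<3*N. vec_index y i *\<^sub>R grad (basis_fun \<phi> i) x)"
    using grad_eq_gmat[OF basis_fun_S_h3 assms] by (intro sum.cong) auto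
  finally show ?thesis .
qed

text \<open>A common expansion for the mass, weighted mass, stiffness and skew forms;
  \<open>d\<close> holds the basis functions or their gradients. The expansion of \<open>F\<close>
  is asked for only in element interiors, where gradients are classical, and that is enough almost
  everywhere.\<close>

lemma form_expansion:
  fixes B :: "R3 \<Rightarrow> 'c::real_vector \<Rightarrow> 'c \<Rightarrow> real"
  assumes lin: "\<And>x u. linear (\<lambda>v. B x u v)" "\<And>x v. linear (\<lambda>u. B x u v)"
    and int: "\<And>i j. i < 3*N \<Longrightarrow> j < 3*N \<Longrightarrow> integrable (lebesgue_on \<Omega>) (\<lambda>x. B x (d i x) (d j x))"
    and int': "integrable (lebesgue_on \<Omega>) (\<lambda>x. B x (F y' x) (F y x))"
    and F: "\<And>y K x. K \<in> \<T> \<Longrightarrow> x \<in> interior K \<Longrightarrow> F y x = (\<Sum>i<3*N. vec_index y i *\<^sub>R d i x)"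
  shows "(\<Sum>i<3*N. \<Sum>j<3*N. (vec_index y' i * vec_index y j) * integral\<^sup>L (lebesgue_on \<Omega>) (\<lambda>x. B x (d i x) (d j x)))
    = integral\<^sup>L (lebesgue_on \<Omega>) (\<lambda>x. B x (F y' x) (F y x))"
proof -
  have "(\<Sum>i<3*N. \<Sum>j<3*N. (vec_index y' i * vec_index y j) * integral\<^sup>L (lebesgue_on \<Omega>) (\<lambda>x. B x (d i x) (d j x)))
    = integral\<^sup>L (lebesgue_on \<Omega>) (\<lambda>x. \<Sum>i<3*N. \<Sum>j<3*N. (vec_index y' i * vec_index y j) * B x (d i x) (d j x))"
    using int by (rule double_sum_integral)
  also have "\<dots> = integral\<^sup>L (lebesgue_on \<Omega>) (\<lambda>x. B x (F y' x) (F y x))"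
  proof (rule integral_cong_AE)
    show "(\<lambda>x. \<Sum>i<3*N. \<Sum>j<3*N. (vec_index y' i * vec_index y j) * B x (d i x) (d j x)) \<in> borel_measurable (lebesgue_on \<Omega>)"
      using int by (intro borel_measurable_sum borel_measurable_times borel_measurable_const borel_measurable_integrable) auto
    show "(\<lambda>x. B x (F y' x) (F y x)) \<in> borel_measurable (lebesgue_on \<Omega>)" using int' by (rule borel_measurable_integrable)
    show "AE x in lebesgue_on \<Omega>. (\<Sum>i<3*N. \<Sum>j<3*N. (vec_index y' i * vec_index y j) * B x (d i x) (d j x)) = B x (F y' x) (F y x)"
    proof (rule AE_interior)
      fix K x assume K: "K \<in> \<T>" "x \<in> interior K"
      have "B x (F y' x) (F y x) = (\<Sum>i<3*N. B x (vec_index y' i *\<^sub>R d i x) (F y x))"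
        unfolding F[OF K, of y'] by (rule linear_sum[OF lin(2)])
      also have "\<dots> = (\<Sum>i<3*N. \<Sum>j<3*N. B x (vec_index y' i *\<^sub>R d i x) (vec_index y j *\<^sub>R d j x))"
        unfolding F[OF K, of y] by (intro sum.cong refl linear_sum[OF lin(1)])
      also have "\<dots> = (\<Sum>i<3*N. \<Sum>j<3*N. (vec_index y' i * vec_index y j) * B x (d i x) (d j x))"
        by (intro sum.cong refl) (simp add: linear_scale[OF lin(1)] linear_scale[OF lin(2)])
      finally show "(\<Sum>i<3*N. \<Sum>j<3*N. (vec_index y' i * vec_index y j) * B x (d i x) (d j x)) = B x (F y' x) (F y x)" by simp
    qed
  qed
  finally show ?thesis .
qed

lemma linear_inner: "linear (inner u)" "linear (\<lambda>u. inner u v)" for u v :: "'c::real_inner"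
  by (simp_all add: linearI inner_add_left inner_add_right)

lemma mass_form:
  "(\<Sum>i<3*N. \<Sum>j<3*N. (vec_index y' i * vec_index y j) * L2_inner \<Omega> (basis_fun \<phi> i) (basis_fun \<phi> j))
    = L2_inner \<Omega> (fe y') (fe y)"
proof -
  have int: "integrable (lebesgue_on \<Omega>) (\<lambda>x. inner (u x) (v x))" if "u \<in> S_h3 \<T>" "v \<in> S_h3 \<T>" for u v
    using that by (intro piecewise_integrable[OF piecewise_inner[OF piecewise_value piecewise_value]])
  show ?thesis unfolding L2_inner_def
    by (intro form_expansion[where B = "\<lambda>x. inner"] linear_inner int basis_fun_S_h3 fe_S_h3) (auto simp: fe_def)
qed

lemma stiffness_form:
  "(\<Sum>i<3*N. \<Sum>j<3*N. (vec_index y' i * vec_index y j) * L2_inner \<Omega> (grad (basis_fun \<phi> i)) (grad (basis_fun \<phi> j)))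
    = L2_inner \<Omega> (grad (fe y')) (grad (fe y))"
proof -
  have int: "integrable (lebesgue_on \<Omega>) (\<lambda>x. inner (grad u x) (grad v x))" if "u \<in> S_h3 \<T>" "v \<in> S_h3 \<T>" for u v
    using that by (intro piecewise_integrable[OF piecewise_inner[OF piecewise_grad piecewise_grad]])
  show ?thesis unfolding L2_inner_def
    by (intro form_expansion[where B = "\<lambda>x. inner" and F = "\<lambda>y. grad (fe y)"] linear_inner int basis_fun_S_h3 fe_S_h3 grad_fe)
qed

lemma weighted_mass_form:
  assumes w: "w \<in> borel_measurable (lebesgue_on \<Omega>)" "AE x in lebesgue_on \<Omega>. \<bar>w x\<bar> \<le> B"
  shows "(\<Sum>i<3*N. \<Sum>j<3*N. (vec_index y' i * vec_index y j) * L2_inner \<Omega> (\<lambda>x. w x *\<^sub>R basis_fun \<phi> i x) (basis_fun \<phi> j))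
    = L2_inner \<Omega> (\<lambda>x. w x *\<^sub>R fe y' x) (fe y)"
proof -
  have int: "integrable (lebesgue_on \<Omega>) (\<lambda>x. inner (w x *\<^sub>R u x) (v x))" if "u \<in> S_h3 \<T>" "v \<in> S_h3 \<T>" for u v
    using bounded_times_piecewise_integrable[OF piecewise_inner[OF piecewise_value[OF that(1)] piecewise_value[OF that(2)]] w]
    by simp
  have "linear (\<lambda>u. inner (w x *\<^sub>R u) v)" for x and v :: R3
    by (simp add: linearI inner_add_left algebra_simps)
  then show ?thesis unfolding L2_inner_def
    by (intro form_expansion[where B = "\<lambda>x u v. inner (w x *\<^sub>R u) v"] linear_inner int basis_fun_S_h3 fe_S_h3)
      (auto simp: fe_def)
qed

lemma piecewise_cross3:
  "piecewise f g \<Longrightarrow> piecewise f' g' \<Longrightarrow> piecewise (\<lambda>x. cross3 (f x) (f' x)) (\<lambda>K x. cross3 (g K x) (g' K x))"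
  by (auto simp: piecewise_def intro!: continuous_on_cross)

lemma skew_form:
  assumes m: "m \<in> S_h3 \<T>"
  shows "(\<Sum>i<3*N. \<Sum>j<3*N. (vec_index y' i * vec_index y j) * L2_inner \<Omega> (\<lambda>x. cross3 (m x) (basis_fun \<phi> i x)) (basis_fun \<phi> j))
    = L2_inner \<Omega> (\<lambda>x. cross3 (m x) (fe y' x)) (fe y)"
proof -
  have int: "integrable (lebesgue_on \<Omega>) (\<lambda>x. inner (cross3 (m x) (u x)) (v x))" if "u \<in> S_h3 \<T>" "v \<in> S_h3 \<T>" for u v
    using that m by (intro piecewise_integrable[OF piecewise_inner[OF piecewise_cross3[OF piecewise_value piecewise_value] piecewise_value]])
  have "linear (\<lambda>u. inner (cross3 (m x) u) v)" for x and v :: R3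
    by (simp add: linearI inner_add_left cross_add_right cross_mult_right)
  then show ?thesis unfolding L2_inner_def
    by (intro form_expansion[where B = "\<lambda>x u v. inner (cross3 (m x) u) v"] linear_inner int basis_fun_S_h3 fe_S_h3)
      (auto simp: fe_def)
qed

section \<open>The reduced matrices as forms\<close>

abbreviation Qm :: "real^3^3 \<Rightarrow> (R3 \<Rightarrow> R3) \<Rightarrow> real mat" where
  "Qm Tn \<nu> \<equiv> Q_matrix N z Tn \<nu>"

lemma Q_carrier: "Qm Tn \<nu> \<in> carrier_mat (3 * N) (2 * N)"
  by (simp add: Q_matrix_def)

lemma Q_mult_carrier: "x \<in> carrier_vec (2 * N) \<Longrightarrow> Qm Tn \<nu> *\<^sub>v x \<in> carrier_vec (3 * N)"
  using Q_carrier by (rule mult_mat_vec_carrier)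

text \<open>The row index occupies the first slot of every entry, so the function \<open>v\<close>
  of the left vector \<open>y\<close> appears inside the weight and the cross product. The order
  matters because the skew form is not symmetric.\<close>

lemma system_matrix_form:
  fixes Tn :: "real^3^3" and m :: "R3 \<Rightarrow> R3" and x y :: "real Matrix.vec"
  assumes m: "m \<in> S_h3 \<T>" and w: "w \<in> borel_measurable (lebesgue_on \<Omega>)" "AE x in lebesgue_on \<Omega>. \<bar>w x\<bar> \<le> B"
    and \<alpha>: "\<alpha> > 0" and x: "x \<in> carrier_vec (2 * N)" and y: "y \<in> carrier_vec (2 * N)"
  defines "u \<equiv> fe (Qm Tn m *\<^sub>v x)" and "v \<equiv> fe (Qm Tn m *\<^sub>v y)"
  shows "y \<bullet> (A_Q \<Omega> N z \<phi> Tn \<alpha> w bk m *\<^sub>v x)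
    = L2_inner \<Omega> (\<lambda>x. w x *\<^sub>R v x) u + bk * L2_inner \<Omega> (grad v) (grad u) - L2_inner \<Omega> (\<lambda>x. cross3 (m x) (v x)) u"
proof -
  define f where "f = (\<lambda>(i, j). L2_inner \<Omega> (\<lambda>x. w x *\<^sub>R basis_fun \<phi> i x) (basis_fun \<phi> j)
    + bk * L2_inner \<Omega> (grad (basis_fun \<phi> i)) (grad (basis_fun \<phi> j))
    - L2_inner \<Omega> (\<lambda>x. cross3 (m x) (basis_fun \<phi> i x)) (basis_fun \<phi> j))"
  \<comment> \<open>The factor \<alpha> of the weighted mass matrix cancels the division by \<alpha>
    inside its weight.\<close>
  have A: "A_matrix \<Omega> N \<phi> \<alpha> w bk m = Matrix.mat (3*N) (3*N) f"
    using \<alpha> by (intro eq_matI)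
      (auto simp: A_matrix_def f_def weighted_mass_matrix_def stiffness_matrix_def skew_matrix_def L2_inner_def)
  note Qx = Q_mult_carrier[OF x, of Tn m] Q_mult_carrier[OF y, of Tn m]
  have "y \<bullet> (A_Q \<Omega> N z \<phi> Tn \<alpha> w bk m *\<^sub>v x) = (Qm Tn m *\<^sub>v y) \<bullet> (Matrix.mat (3*N) (3*N) f *\<^sub>v (Qm Tn m *\<^sub>v x))"
    unfolding A_Q_def A by (rule scalar_prod_congruence[OF Q_carrier _ x y]) simp
  also have "\<dots> = L2_inner \<Omega> (\<lambda>x. w x *\<^sub>R v x) u + bk * L2_inner \<Omega> (grad v) (grad u) - L2_inner \<Omega> (\<lambda>x. cross3 (m x) (v x)) u"
    unfolding u_def v_def scalar_prod_mat_mult_vec[OF Qx] mass_form[symmetric] stiffness_form[symmetric]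
      weighted_mass_form[OF w, symmetric] skew_form[OF m, symmetric]
    by (simp add: f_def sum.distrib sum_subtractf sum_distrib_left algebra_simps)
  finally show ?thesis .
qed

text \<open>The matrix whose inverse is the preconditioner; its quadratic form is the energy of the
  function built with the frames of \<open>\<mu>\<close>.\<close>

definition G_Q :: "real^3^3 \<Rightarrow> real \<Rightarrow> real \<Rightarrow> (R3 \<Rightarrow> R3) \<Rightarrow> real mat" where
  "G_Q Tn \<alpha>P bk \<mu> = transpose_mat (Qm Tn \<mu>) * (\<alpha>P \<cdot>\<^sub>m mass_matrix \<Omega> N \<phi> + bk \<cdot>\<^sub>m stiffness_matrix \<Omega> N \<phi>) * Qm Tn \<mu>"

lemma G_Q_carrier: "G_Q Tn \<alpha>P bk \<mu> \<in> carrier_mat (2 * N) (2 * N)"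
proof -
  have "transpose_mat (Qm Tn \<mu>) \<in> carrier_mat (2 * N) (3 * N)" using Q_carrier by simp
  moreover have "\<alpha>P \<cdot>\<^sub>m mass_matrix \<Omega> N \<phi> + bk \<cdot>\<^sub>m stiffness_matrix \<Omega> N \<phi> \<in> carrier_mat (3 * N) (3 * N)"
    by (simp add: mass_matrix_def stiffness_matrix_def)
  ultimately show ?thesis unfolding G_Q_def using Q_carrier by (meson mult_carrier_mat)
qed

lemma preconditioner_form:
  fixes Tn :: "real^3^3" and \<mu> :: "R3 \<Rightarrow> R3" and x y :: "real Matrix.vec"
  assumes x: "x \<in> carrier_vec (2 * N)" and y: "y \<in> carrier_vec (2 * N)"
  defines "u \<equiv> fe (Qm Tn \<mu> *\<^sub>v x)" and "v \<equiv> fe (Qm Tn \<mu> *\<^sub>v y)"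
  shows "y \<bullet> (G_Q Tn \<alpha>P bk \<mu> *\<^sub>v x) = \<alpha>P * L2_inner \<Omega> v u + bk * L2_inner \<Omega> (grad v) (grad u)"
proof -
  define f where "f = (\<lambda>(i, j). \<alpha>P * L2_inner \<Omega> (basis_fun \<phi> i) (basis_fun \<phi> j)
    + bk * L2_inner \<Omega> (grad (basis_fun \<phi> i)) (grad (basis_fun \<phi> j)))"
  have A: "\<alpha>P \<cdot>\<^sub>m mass_matrix \<Omega> N \<phi> + bk \<cdot>\<^sub>m stiffness_matrix \<Omega> N \<phi> = Matrix.mat (3*N) (3*N) f"
    by (intro eq_matI) (auto simp: f_def mass_matrix_def stiffness_matrix_def)
  note Qx = Q_mult_carrier[OF x, of Tn \<mu>] Q_mult_carrier[OF y, of Tn \<mu>]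
  have "y \<bullet> (G_Q Tn \<alpha>P bk \<mu> *\<^sub>v x) = (Qm Tn \<mu> *\<^sub>v y) \<bullet> (Matrix.mat (3*N) (3*N) f *\<^sub>v (Qm Tn \<mu> *\<^sub>v x))"
    unfolding G_Q_def A by (rule scalar_prod_congruence[OF Q_carrier _ x y]) simp
  also have "\<dots> = \<alpha>P * L2_inner \<Omega> v u + bk * L2_inner \<Omega> (grad v) (grad u)"
    unfolding u_def v_def scalar_prod_mat_mult_vec[OF Qx] mass_form[symmetric] stiffness_form[symmetric]
    by (simp add: f_def sum.distrib sum_distrib_left algebra_simps)
  finally show ?thesis .
qed

section \<open>Nodal values in terms of coefficient blocks\<close>

definition block :: "real Matrix.vec \<Rightarrow> nat \<Rightarrow> real^2" where
  "block x j = vector [vec_index x (2 * j), vec_index x (2 * j + 1)]"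

lemma fe_node:
  assumes j: "j < N"
  shows "fe y (z j) = (\<Sum>l<3. vec_index y (3 * j + l) *\<^sub>R axis (of_nat (Suc l)) 1)"
proof -
  have "fe y (z j) = (\<Sum>k<N. \<phi> k (z j) *\<^sub>R (\<Sum>l<3. vec_index y (3 * k + l) *\<^sub>R axis (of_nat (Suc l)) 1))"
    unfolding fe_def sum_lessThan_3_times
  proof (intro sum.cong refl)
    fix k
    have b: "basis_fun \<phi> (3 * k + l) (z j) = \<phi> k (z j) *\<^sub>R axis (of_nat (Suc l)) 1" if "l < 3" for l
      using that by (simp add: basis_fun_def)
    have 3: "(\<Sum>l<3. f l) = f 0 + f 1 + f 2" for f :: "nat \<Rightarrow> R3"
      by (simp add: numeral_3_eq_3 numeral_2_eq_2)
    show "vec_index y (3 * k) *\<^sub>R basis_fun \<phi> (3 * k) (z j) + vec_index y (3 * k + 1) *\<^sub>R basis_fun \<phi> (3 * k + 1) (z j)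
      + vec_index y (3 * k + 2) *\<^sub>R basis_fun \<phi> (3 * k + 2) (z j)
      = \<phi> k (z j) *\<^sub>R (\<Sum>l<3. vec_index y (3 * k + l) *\<^sub>R axis (of_nat (Suc l)) 1)"
      using b[of 0] b[of 1] b[of 2] unfolding 3 by (simp only: scaleR_right_distrib scaleR_left_commute add_0_right)
  qed
  also have "\<dots> = (\<Sum>k<N. if k = j then (\<Sum>l<3. vec_index y (3 * k + l) *\<^sub>R axis (of_nat (Suc l)) 1) else 0)"
    using j by (intro sum.cong refl) (simp add: hat_props)
  finally show ?thesis using j by simp
qed

lemma Q_mult_index:
  assumes j: "j < N" and l: "l < 3" and x: "x \<in> carrier_vec (2 * N)"
  shows "vec_index (Qm Tn \<nu> *\<^sub>v x) (3 * j + l)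
    = ((Tn ** H_block (Tn *v \<nu> (z j))) *v block x j) $ of_nat (Suc l)"
proof -
  define M where "M = Tn ** H_block (Tn *v \<nu> (z j))"
  have jl: "3 * j + l < 3 * N" "(3 * j + l) div 3 = j" "(3 * j + l) mod 3 = l" using j l by auto
  have "vec_index (Qm Tn \<nu> *\<^sub>v x) (3 * j + l)
    = (\<Sum>k<2*N. (if j = k div 2 then M $ of_nat (Suc l) $ of_nat (Suc (k mod 2)) else 0) * vec_index x k)"
    using jl x by (simp add: Q_matrix_def scalar_prod_def atLeast0LessThan M_def cong: if_cong)
  also have "\<dots> = (\<Sum>k<N. if k = j then M $ of_nat (Suc l) $ 1 * vec_index x (2 * k) + M $ of_nat (Suc l) $ 2 * vec_index x (2 * k + 1) else 0)"
    unfolding sum_lessThan_2_times by (intro sum.cong refl) auto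
  also have "\<dots> = M $ of_nat (Suc l) $ 1 * vec_index x (2 * j) + M $ of_nat (Suc l) $ 2 * vec_index x (2 * j + 1)"
    using j by simp
  also have "\<dots> = (M *v block x j) $ of_nat (Suc l)"
    by (simp add: matrix_vector_mult_def sum_2 block_def vector_2)
  finally show ?thesis by (simp add: M_def)
qed

lemma fe_Q_node:
  assumes j: "j < N" and x: "x \<in> carrier_vec (2 * N)"
  shows "fe (Qm Tn \<nu> *\<^sub>v x) (z j) = Tn *v (H_block (Tn *v \<nu> (z j)) *v block x j)"
proof -
  define V where "V = (Tn ** H_block (Tn *v \<nu> (z j))) *v block x j"
  have "fe (Qm Tn \<nu> *\<^sub>v x) (z j) = (\<Sum>l<3. V $ of_nat (Suc l) *\<^sub>R axis (of_nat (Suc l)) 1)"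
    unfolding fe_node[OF j] V_def using Q_mult_index[OF j _ x] by (intro sum.cong refl) simp
  also have "\<dots> = V"
    by (simp add: Finite_Cartesian_Product.vec_eq_iff forall_3 axis_def eval_nat_numeral)
  finally show ?thesis by (simp add: V_def matrix_vector_mul_assoc)
qed

end

section \<open>Spectral equivalence and convergence\<close>

lemma norm_cross3_le: "norm (cross3 x y) \<le> norm x * norm y"
proof -
  have "(norm (cross3 x y))\<^sup>2 \<le> (norm x * norm y)\<^sup>2"
    using norm_cross_dot[of x y] zero_le_power2[of "inner x y"] by linarith
  then show ?thesis by (rule power2_le_imp_le) simp
qed

lemma L2_inner_nonneg: "L2_inner \<Omega> f f \<ge> 0"
  by (simp add: L2_inner_def)

lemma L2_inner_commute: "L2_inner \<Omega> f g = L2_inner \<Omega> g f"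
  by (simp add: L2_inner_def inner_commute)

lemma Linf_norm_diff_commute: "Linf_norm M (\<lambda>x. f x - g x) = Linf_norm M (\<lambda>x. g x - f x)"
  by (simp add: Linf_norm_def norm_minus_commute)

text \<open>The weighted mean becomes the geometric mean for \<open>t = sqrt B / sqrt A\<close>.
  Bounds of this shape are additive in \<open>A\<close> and \<open>B\<close>, so \<open>L2\<close>
  and gradient parts can be estimated separately with the same \<open>t\<close> and optimized
  together.\<close>

lemma le_geometric_meanI:
  fixes a A B c :: real
  assumes nn: "A \<ge> 0" "B \<ge> 0" "c \<ge> 0" and le: "\<And>t. t > 0 \<Longrightarrow> a \<le> c * ((t * A + B / t) / 2)"
  shows "a \<le> c * sqrt A * sqrt B"
proof (cases "A = 0 \<or> B = 0")
  case False
  then have pos: "sqrt A > 0" "sqrt B > 0" using nn by auto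
  have "sqrt B / sqrt A * A = sqrt A * sqrt B" "B / (sqrt B / sqrt A) = sqrt A * sqrt B"
    using nn pos real_sqrt_mult_self[of A] real_sqrt_mult_self[of B] by (auto simp: field_simps)
  then show ?thesis using le[of "sqrt B / sqrt A"] pos by simp
next
  case True
  have "a \<le> 0"
  proof (rule ccontr)
    assume a: "\<not> a \<le> 0"
    \<comment> \<open>If one of the two quantities is zero there may be no optimal \<open>t\<close>.
      With \<open>t\<close> equal to \<open>s\<close> or \<open>1 / s\<close> the other term is
      already too small for a positive \<open>a\<close>.\<close>
    define s where "s = c * (A + B) / a + 1"
    have s: "s > 0" "c * (A + B) < a * s" using nn a by (auto simp: s_def field_simps add_pos_nonneg)
    have "a \<le> c * (A + B) / (2 * s)"
    proof (cases "A = 0")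
      case True
      then show ?thesis using le[of s] s by simp
    next
      case False
      then have "B = 0" using \<open>A = 0 \<or> B = 0\<close> by blast
      then show ?thesis using le[of "1 / s"] s by simp
    qed
    then have "2 * (a * s) \<le> c * (A + B)" using s by (simp add: field_simps)
    then show False using s a mult_pos_pos[of a s] by linarith
  qed
  then show ?thesis using nn True by auto
qed

lemma power_int_neg_eq: "x powi (- numeral k) = inverse (x ^ numeral k)" for x :: real
  by (simp add: power_int_minus)

text \<open>Each factor of the subtracted product is at most 1 and the factor
  \<open>inverse C\<close> is strictly smaller. A positive base keeps \<open>powr\<close> from
  taking its value 0 at base 0.\<close>

lemma contraction_gap:
  fixes \<alpha> \<alpha>P d F C :: real
  assumes "0 < \<alpha>" "\<alpha> \<le> \<alpha>P" "d \<ge> 0" "F \<ge> 1" "C > 1"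
  shows "contraction C \<alpha> \<alpha>P d F > 0"
proof -
  define g where "g = 1 + 1 / \<alpha>P + d / \<alpha>P"
  have g: "g \<ge> 1" using assms by (simp add: g_def)
  have e: "(\<alpha> / \<alpha>P)\<^sup>2 \<le> 1" using assms by (intro power_le_one) auto
  have "g powi (-2) \<le> 1" "F powi (-4) \<le> 1"
    using g assms by (auto simp: power_int_minus inverse_le_1_iff one_le_power)
  moreover have "0 \<le> g powi (-2)" "0 \<le> F powi (-4)" using g assms by (auto intro: zero_le_power_int)
  ultimately have "(\<alpha> / \<alpha>P)\<^sup>2 * g powi (-2) * F powi (-4) \<le> 1 * 1 * 1"
    using e by (intro mult_mono mult_nonneg_nonneg) auto
  then have "inverse C * ((\<alpha> / \<alpha>P)\<^sup>2 * g powi (-2) * F powi (-4)) \<le> inverse C * 1"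
    using assms by (intro mult_left_mono) auto
  also have "\<dots> < 1" using assms by (simp add: inverse_less_1_iff)
  finally show ?thesis by (simp add: contraction_def g_def mult.assoc)
qed

text \<open>The origin of \<open>C = 4 * K^4\<close>: the 4 is the square of the 2 in the coercivity
  constant, and \<open>K * F\<close> enters once through coercivity and once through boundedness
  before the quotient is squared.\<close>

lemma contraction_eq:
  fixes \<alpha> \<alpha>P d F K :: real
  assumes "0 < \<alpha>" "\<alpha> \<le> \<alpha>P" "d \<ge> 0" "F > 0" "K > 0"
  shows "1 - ((\<alpha> / (2 * \<alpha>P) / (K * F)) / ((1 + 1 / \<alpha>P + d / \<alpha>P) * (K * F)))\<^sup>2 = contraction (4 * K ^ 4) \<alpha> \<alpha>P d F"
proof -
  define g where "g = 1 + 1 / \<alpha>P + d / \<alpha>P"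
  have "g \<ge> 1" using assms by (simp add: g_def)
  then have "g > 0" by linarith
  have "(\<alpha> / (2 * \<alpha>P) / (K * F)) / (g * (K * F)) = (\<alpha> / \<alpha>P) / (2 * g * K\<^sup>2 * F\<^sup>2)"
    using assms by (simp add: power2_eq_square)
  then have "((\<alpha> / (2 * \<alpha>P) / (K * F)) / (g * (K * F)))\<^sup>2 = (\<alpha> / \<alpha>P)\<^sup>2 / (4 * g\<^sup>2 * K ^ 4 * F ^ 4)"
    by (simp add: power2_eq_square power4_eq_xxxx mult_ac)
  also have "\<dots> = inverse (4 * K ^ 4) * (\<alpha> / \<alpha>P)\<^sup>2 * g powi (-2) * F powi (-4)"
    by (simp only: power_int_neg_eq divide_inverse inverse_mult_distrib mult_ac)
  finally show ?thesis by (simp add: contraction_def g_def)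
qed

context fe_mesh
begin

lemma energy_nonneg: "a \<ge> 0 \<Longrightarrow> b \<ge> 0 \<Longrightarrow> energy a b v \<ge> 0"
  by (simp add: energy_def L2_inner_nonneg)

lemma M_h_S_h3: "m \<in> M_h \<T> \<Longrightarrow> m \<in> S_h3 \<T>" by (simp add: M_h_def)

text \<open>Unit length is prescribed at the nodes only; in between, convexity leaves the upper
  bound, which is what the cross product term requires.\<close>

lemma M_h_norm_le_1:
  assumes m: "m \<in> M_h \<T>" and x: "K \<in> \<T>" "x \<in> K"
  shows "norm (m x) \<le> 1"
proof -
  have "norm (m z - 0) \<le> 1" if "z \<in> vert K" for z
    using m x that by (auto simp: M_h_def nodes_eq)
  then show ?thesis using element_max_principle[OF M_h_S_h3[OF m] x(1) _ x(2), of 0 1] by simp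
qed

lemma weight_measurable:
  assumes m: "m \<in> S_h3 \<T>" and \<pi>: "bounded_H1_L2 \<Omega> \<pi>" and f: "L2_fun \<Omega> ft"
    and W: "W \<in> borel_measurable borel"
  shows "(\<lambda>y. W (lambda_h l_ex ft \<pi> m y)) \<in> borel_measurable (lebesgue_on \<Omega>)"
proof -
  have "L2_fun \<Omega> (\<pi> m)" using \<pi> H1_fun_S_h3[OF m] unfolding bounded_H1_L2_def by blast
  then have [measurable]: "\<pi> m \<in> borel_measurable (lebesgue_on \<Omega>)" "ft \<in> borel_measurable (lebesgue_on \<Omega>)"
    using f by (auto simp: L2_fun_def)
  have [measurable]: "m \<in> borel_measurable (lebesgue_on \<Omega>)" "grad m \<in> borel_measurable (lebesgue_on \<Omega>)"
    using piecewise_measurable piecewise_value[OF m] piecewise_grad[OF m] by blast+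
  have "lambda_h l_ex ft \<pi> m \<in> borel_measurable (lebesgue_on \<Omega>)"
    unfolding lambda_h_def[abs_def] by measurable
  then show ?thesis using measurable_compose W by blast
qed

end

text \<open>\<open>matrix_inv\<close> is a choice, and invertibility is what gives it the property
  of an inverse. A matrix that equals its inverse and its transpose is orthogonal.\<close>

lemma norm_symmetric_involution:
  fixes Tn :: "real^'n^'n"
  assumes "invertible Tn" "matrix_inv Tn = Tn" "transpose Tn = Tn"
  shows "norm (Tn *v x) = norm x"
proof -
  have "Tn ** matrix_inv Tn = Finite_Cartesian_Product.mat 1 \<and> matrix_inv Tn ** Tn = Finite_Cartesian_Product.mat 1"
    unfolding matrix_inv_def using assms(1) unfolding invertible_def by (rule someI_ex)
  then have "orthogonal_matrix Tn" using assms(2,3) by (simp add: orthogonal_matrix_def)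
  then have "orthogonal_transformation ((*v) Tn)" by (simp add: orthogonal_transformation_matrix matrix_of_matrix_vector_mul)
  then show ?thesis by (rule orthogonal_transformation_norm)
qed

context fe_basis
begin

text \<open>For fixed coefficients \<open>x\<close>, only the frames change with \<nu>. Comparing
  the energies for two fields is the spectral equivalence of the two norms.\<close>

definition U :: "real^3^3 \<Rightarrow> (R3 \<Rightarrow> R3) \<Rightarrow> real Matrix.vec \<Rightarrow> R3 \<Rightarrow> R3" where
  "U Tn \<nu> x = fe (Qm Tn \<nu> *\<^sub>v x)"

lemma A_Q_carrier: "A_Q \<Omega> N z \<phi> Tn \<alpha> w bk m \<in> carrier_mat (2 * N) (2 * N)"
proof -
  have "transpose_mat (Qm Tn m) \<in> carrier_mat (2 * N) (3 * N)" using Q_carrier by simp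
  moreover have "A_matrix \<Omega> N \<phi> \<alpha> w bk m \<in> carrier_mat (3 * N) (3 * N)"
    by (simp add: A_matrix_def skew_matrix_def minus_carrier_mat)
  ultimately show ?thesis unfolding A_Q_def using Q_carrier by (meson mult_carrier_mat)
qed

lemma U_S_h3: "U Tn \<nu> x \<in> S_h3 \<T>" by (simp add: U_def fe_S_h3)

text \<open>The block \<open>b\<close> is obtained before \<nu> is chosen, so one and the same
  \<open>b\<close> describes the nodal values for both fields.\<close>

lemma U_node:
  assumes "y \<in> nodes \<T>" "x \<in> carrier_vec (2 * N)"
  obtains b where "\<And>\<nu>. U Tn \<nu> x y = Tn *v (H_block (Tn *v \<nu> y) *v b)"
proof -
  obtain j where "j < N" "y = z j" using node_index(2)[OF assms(1)] by blast
  then show ?thesis using fe_Q_node[OF _ assms(2)] by (intro that[of "block x j"]) (simp add: U_def)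
qed

lemma U_nonzero_node:
  assumes T: "\<And>v. norm (Tn *v v) = norm v" and x: "x \<in> carrier_vec (2 * N)" "x \<noteq> 0\<^sub>v (2 * N)"
  obtains y where "y \<in> nodes \<T>" "U Tn \<nu> x y \<noteq> 0"
proof -
  have "\<exists>i<2 * N. vec_index x i \<noteq> 0"
  proof (rule ccontr)
    assume "\<not> (\<exists>i<2 * N. vec_index x i \<noteq> 0)"
    then have "x = 0\<^sub>v (2 * N)" using x(1) by (intro eq_vecI) auto
    then show False using x(2) by blast
  qed
  then obtain i where i: "i < 2 * N" "vec_index x i \<noteq> 0" by blast
  define j where "j = i div 2"
  have j: "j < N" using i by (simp add: j_def)
  have "i = 2 * j \<or> i = 2 * j + 1" by (auto simp: j_def)
  then have "block x j \<noteq> 0"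
    using i(2) by (auto simp: block_def Finite_Cartesian_Product.vec_eq_iff forall_2 vector_2)
  then have "norm (U Tn \<nu> x (z j)) \<noteq> 0"
    by (simp add: U_def fe_Q_node[OF j x(1)] T norm_H_block)
  then show ?thesis using that[OF node_index(1)[OF j]] by simp
qed

lemma system_matrix_coercive:
  assumes m: "m \<in> S_h3 \<T>" and w: "w \<in> borel_measurable (lebesgue_on \<Omega>)" "AE x in lebesgue_on \<Omega>. \<bar>w x\<bar> \<le> B"
    and low: "\<And>x. w x \<ge> \<alpha> / 2" and \<alpha>: "0 < \<alpha>" "\<alpha> \<le> \<alpha>P" and bk: "bk \<ge> 0" and x: "x \<in> carrier_vec (2 * N)"
  shows "\<alpha> / (2 * \<alpha>P) * energy \<alpha>P bk (U Tn m x) \<le> x \<bullet> (A_Q \<Omega> N z \<phi> Tn \<alpha> w bk m *\<^sub>v x)"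
proof -
  define v where "v = U Tn m x"
  have v: "v \<in> S_h3 \<T>" by (simp add: v_def U_S_h3)
  note pv = piecewise_inner[OF piecewise_value[OF v] piecewise_value[OF v]]
  have "L2_inner \<Omega> (\<lambda>x. cross3 (m x) (v x)) v = 0"
    by (simp add: L2_inner_def dot_cross_self)
  then have eq: "x \<bullet> (A_Q \<Omega> N z \<phi> Tn \<alpha> w bk m *\<^sub>v x) = L2_inner \<Omega> (\<lambda>x. w x *\<^sub>R v x) v + bk * L2_inner \<Omega> (grad v) (grad v)"
    using system_matrix_form[OF m w \<alpha>(1) x x, of Tn bk] by (simp add: v_def U_def)
  have "\<alpha> / 2 * L2_inner \<Omega> v v = integral\<^sup>L (lebesgue_on \<Omega>) (\<lambda>x. \<alpha> / 2 * inner (v x) (v x))"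
    by (simp add: L2_inner_def)
  also have "\<dots> \<le> L2_inner \<Omega> (\<lambda>x. w x *\<^sub>R v x) v"
    unfolding L2_inner_def
  proof (rule integral_mono)
    show "integrable (lebesgue_on \<Omega>) (\<lambda>x. \<alpha> / 2 * inner (v x) (v x))"
      using piecewise_integrable[OF pv] by simp
    show "integrable (lebesgue_on \<Omega>) (\<lambda>x. inner (w x *\<^sub>R v x) (v x))"
      using bounded_times_piecewise_integrable[OF pv w] by simp
    show "\<alpha> / 2 * inner (v x) (v x) \<le> inner (w x *\<^sub>R v x) (v x)" for x
      using mult_right_mono[OF low[of x], of "inner (v x) (v x)"] by simp
  qed
  finally have 1: "\<alpha> / (2 * \<alpha>P) * (\<alpha>P * L2_inner \<Omega> v v) \<le> L2_inner \<Omega> (\<lambda>x. w x *\<^sub>R v x) v"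
    using \<alpha> by simp
  have "L2_inner \<Omega> (grad v) (grad v) \<ge> 0" by (simp add: L2_inner_def)
  \<comment> \<open>The assumption \<open>\<alpha> \<le> \<alpha>P\<close> makes the factor at most
    1, so the stiffness part, which is present with full weight, can afford it.\<close>
  then have "\<alpha> / (2 * \<alpha>P) * (bk * L2_inner \<Omega> (grad v) (grad v)) \<le> 1 * (bk * L2_inner \<Omega> (grad v) (grad v))"
    using \<alpha> bk by (intro mult_right_mono) auto
  then show ?thesis using 1 unfolding eq v_def[symmetric] energy_def distrib_left by linarith
qed

lemma inner_le_weighted_squares:
  fixes u v :: "'c::real_inner"
  assumes "t > 0"
  shows "norm v * norm u \<le> (t * inner v v + inner u u / t) / 2"
proof -
  have "0 \<le> (t * norm v - norm u)\<^sup>2 / t" using assms by simp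
  also have "\<dots> = t * inner v v + inner u u / t - 2 * (norm v * norm u)"
    using assms by (simp add: power2_diff power2_norm_eq_inner[symmetric] field_simps power2_eq_square)
  finally show ?thesis by simp
qed

text \<open>The weight is at most \<open>\<alpha>P + d\<close> and the cross product adds 1, because
  \<open>m\<close> has length at most 1. Relative to the mass part \<open>\<alpha>P\<close> of the
  energy this is the stated constant; the stiffness part has constant 1, which is smaller.\<close>

lemma system_matrix_bounded:
  assumes m: "m \<in> M_h \<T>" and w: "w \<in> borel_measurable (lebesgue_on \<Omega>)" "AE x in lebesgue_on \<Omega>. \<bar>w x - \<alpha>P\<bar> \<le> d"
    and d: "d \<ge> 0" and \<alpha>: "0 < \<alpha>" "\<alpha> \<le> \<alpha>P" and bk: "bk \<ge> 0" and x: "x \<in> carrier_vec (2 * N)" "y \<in> carrier_vec (2 * N)"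
  shows "y \<bullet> (A_Q \<Omega> N z \<phi> Tn \<alpha> w bk m *\<^sub>v x)
    \<le> (1 + 1 / \<alpha>P + d / \<alpha>P) * sqrt (energy \<alpha>P bk (U Tn m y)) * sqrt (energy \<alpha>P bk (U Tn m x))"
proof (rule le_geometric_meanI)
  define u v where "u = U Tn m x" and "v = U Tn m y"
  have u: "u \<in> S_h3 \<T>" and v: "v \<in> S_h3 \<T>" by (simp_all add: u_def v_def U_S_h3)
  show "0 \<le> energy \<alpha>P bk (U Tn m y)" "0 \<le> energy \<alpha>P bk (U Tn m x)"
    using \<alpha> bk by (auto intro: energy_nonneg)
  define c where "c = 1 + 1 / \<alpha>P + d / \<alpha>P"
  have c: "c \<ge> 1" "c * \<alpha>P = \<alpha>P + d + 1" using \<alpha> d by (auto simp: c_def field_simps)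
  then show "0 \<le> 1 + 1 / \<alpha>P + d / \<alpha>P" by (simp add: c_def)
  have wB: "AE x in lebesgue_on \<Omega>. \<bar>w x\<bar> \<le> \<alpha>P + d" using w(2) by eventually_elim (use \<alpha> in linarith)
  have ms: "m \<in> S_h3 \<T>" using m by (rule M_h_S_h3)
  note eq = system_matrix_form[OF ms w(1) wB \<alpha>(1) x, of Tn bk, folded U_def, folded u_def v_def]
  fix t :: real assume t: "t > 0"
  note int = piecewise_integrable[OF piecewise_inner]
  note pu = piecewise_value[OF u] and pv = piecewise_value[OF v]
  note gu = piecewise_grad[OF u] and gv = piecewise_grad[OF v]
  have i1: "integrable (lebesgue_on \<Omega>) (\<lambda>x. inner (w x *\<^sub>R v x) (u x))"
    using bounded_times_piecewise_integrable[OF piecewise_inner[OF pv pu] w(1) wB] by simp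
  have i2: "integrable (lebesgue_on \<Omega>) (\<lambda>x. inner (cross3 (m x) (v x)) (u x))"
    by (rule int[OF piecewise_cross3[OF piecewise_value[OF ms] pv] pu])
  have "L2_inner \<Omega> (\<lambda>x. w x *\<^sub>R v x) u - L2_inner \<Omega> (\<lambda>x. cross3 (m x) (v x)) u
    = integral\<^sup>L (lebesgue_on \<Omega>) (\<lambda>x. inner (w x *\<^sub>R v x) (u x) - inner (cross3 (m x) (v x)) (u x))"
    unfolding L2_inner_def using i1 i2 by simp
  also have "\<dots> \<le> integral\<^sup>L (lebesgue_on \<Omega>) (\<lambda>x. (\<alpha>P + d + 1) * ((t * inner (v x) (v x) + inner (u x) (u x) / t) / 2))"
  proof (rule integral_mono_AE)
    show "integrable (lebesgue_on \<Omega>) (\<lambda>x. inner (w x *\<^sub>R v x) (u x) - inner (cross3 (m x) (v x)) (u x))"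
      using i1 i2 by simp
    show "integrable (lebesgue_on \<Omega>) (\<lambda>x. (\<alpha>P + d + 1) * ((t * inner (v x) (v x) + inner (u x) (u x) / t) / 2))"
      using int[OF pv pv] int[OF pu pu] by (intro integrable_mult_right integrable_divide_zero Bochner_Integration.integrable_add) auto
    have "AE x in lebesgue_on \<Omega>. norm (m x) \<le> 1"
      using M_h_norm_le_1[OF m] interior_subset by (intro AE_interior) blast
    with wB show "AE x in lebesgue_on \<Omega>. inner (w x *\<^sub>R v x) (u x) - inner (cross3 (m x) (v x)) (u x)
      \<le> (\<alpha>P + d + 1) * ((t * inner (v x) (v x) + inner (u x) (u x) / t) / 2)"
    proof eventually_elim
      case (elim x)
      have "inner (w x *\<^sub>R v x) (u x) \<le> \<bar>w x\<bar> * (norm (v x) * norm (u x))"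
        using norm_cauchy_schwarz[of "w x *\<^sub>R v x" "u x"] by (simp add: mult.assoc)
      also have "\<dots> \<le> (\<alpha>P + d) * (norm (v x) * norm (u x))" using elim by (intro mult_right_mono) auto
      finally have a: "inner (w x *\<^sub>R v x) (u x) \<le> (\<alpha>P + d) * (norm (v x) * norm (u x))" .
      have "- inner (cross3 (m x) (v x)) (u x) \<le> norm (cross3 (m x) (v x)) * norm (u x)"
        using Cauchy_Schwarz_ineq2[of "cross3 (m x) (v x)" "u x"] by linarith
      also have "\<dots> \<le> (1 * norm (v x)) * norm (u x)"
        by (rule mult_right_mono[OF order_trans[OF norm_cross3_le mult_right_mono[OF elim(2) norm_ge_zero]] norm_ge_zero])
      finally have "inner (w x *\<^sub>R v x) (u x) - inner (cross3 (m x) (v x)) (u x) \<le> (\<alpha>P + d + 1) * (norm (v x) * norm (u x))"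
        using a by (simp add: distrib_right)
      also have "\<dots> \<le> (\<alpha>P + d + 1) * ((t * inner (v x) (v x) + inner (u x) (u x) / t) / 2)"
        using \<alpha> d inner_le_weighted_squares[OF t] by (intro mult_left_mono) auto
      finally show ?case .
    qed
  qed
  also have "\<dots> = (c * \<alpha>P) * ((t * L2_inner \<Omega> v v + L2_inner \<Omega> u u / t) / 2)"
    using int[OF pv pv] int[OF pu pu] by (simp add: L2_inner_def c(2))
  finally have 1: "L2_inner \<Omega> (\<lambda>x. w x *\<^sub>R v x) u - L2_inner \<Omega> (\<lambda>x. cross3 (m x) (v x)) u
    \<le> (c * \<alpha>P) * ((t * L2_inner \<Omega> v v + L2_inner \<Omega> u u / t) / 2)" .
  have "L2_inner \<Omega> (grad v) (grad u)
    \<le> integral\<^sup>L (lebesgue_on \<Omega>) (\<lambda>x. (t * inner (grad v x) (grad v x) + inner (grad u x) (grad u x) / t) / 2)"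
    unfolding L2_inner_def
  proof (rule integral_mono)
    show "integrable (lebesgue_on \<Omega>) (\<lambda>x. (t * inner (grad v x) (grad v x) + inner (grad u x) (grad u x) / t) / 2)"
      using int[OF gv gv] int[OF gu gu] by (intro integrable_divide_zero Bochner_Integration.integrable_add) auto
    show "inner (grad v x) (grad u x) \<le> (t * inner (grad v x) (grad v x) + inner (grad u x) (grad u x) / t) / 2" for x
      using norm_cauchy_schwarz[of "grad v x" "grad u x"] inner_le_weighted_squares[OF t, of "grad v x" "grad u x"] by linarith
  qed (rule int[OF gv gu])
  also have "\<dots> = (t * L2_inner \<Omega> (grad v) (grad v) + L2_inner \<Omega> (grad u) (grad u) / t) / 2" (is "_ = ?G")
    using int[OF gv gv] int[OF gu gu] by (simp add: L2_inner_def)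
  finally have "bk * L2_inner \<Omega> (grad v) (grad u) \<le> bk * ?G" using bk by (rule mult_left_mono)
  also have "\<dots> \<le> c * (bk * ?G)"
  proof -
    have "0 \<le> bk * ?G"
      using bk t L2_inner_nonneg[of \<Omega> "grad v"] L2_inner_nonneg[of \<Omega> "grad u"]
      by (intro mult_nonneg_nonneg divide_nonneg_nonneg add_nonneg_nonneg) auto
    then show ?thesis using mult_right_mono[OF c(1), of "bk * ?G"] by simp
  qed
  finally have 2: "bk * L2_inner \<Omega> (grad v) (grad u) \<le> c * (bk * ?G)" .
  have "y \<bullet> (A_Q \<Omega> N z \<phi> Tn \<alpha> w bk m *\<^sub>v x)
    \<le> (c * \<alpha>P) * ((t * L2_inner \<Omega> v v + L2_inner \<Omega> u u / t) / 2) + c * (bk * ?G)"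
    unfolding eq using 1 2 by linarith
  also have "\<dots> = c * ((t * energy \<alpha>P bk v + energy \<alpha>P bk u / t) / 2)"
    using t by (simp add: energy_def field_simps)
  finally show "y \<bullet> (A_Q \<Omega> N z \<phi> Tn \<alpha> w bk m *\<^sub>v x)
    \<le> (1 + 1 / \<alpha>P + d / \<alpha>P) * ((t * energy \<alpha>P bk (U Tn m y) + energy \<alpha>P bk (U Tn m x) / t) / 2)"
    by (simp add: c_def u_def v_def)
qed

text \<open>The triangle inequality bounds the difference between two nodes by the two nodal
  deviations, so the comparison is used with \<open>p = 2 * \<kappa> / h\<close> and
  \<open>q = 0\<close>. Squaring the 2 gives the constant \<open>4 * 589824\<close>.\<close>

lemma energy_U_comparison_nodal:
  assumes T: "\<And>v. norm (Tn *v v) = norm v" and x: "x \<in> carrier_vec (2 * N)" and ab: "a > 0" "b \<ge> 0"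
    and \<kappa>: "\<kappa> \<ge> 0" "\<And>y v. y \<in> nodes \<T> \<Longrightarrow>
      norm (H_block (Tn *v \<mu> y) *v v - H_block (Tn *v \<nu> y) *v v) \<le> \<kappa> * norm v"
  shows "energy a b (U Tn \<mu> x) \<le> 2359296 * c ^ 6 * (1 + b / (a * h\<^sup>2) * \<kappa>\<^sup>2) * energy a b (U Tn \<nu> x)"
proof -
  let ?u = "U Tn \<mu> x" and ?v = "U Tn \<nu> x"
  have eq: "norm (?u y) = norm (?v y)" and d: "norm (?u y - ?v y) \<le> \<kappa> * norm (?v y)" if y: "y \<in> nodes \<T>" for y
  proof -
    obtain v where v: "\<And>\<nu>. U Tn \<nu> x y = Tn *v (H_block (Tn *v \<nu> y) *v v)" using U_node[OF y x] by blast
    show "norm (?u y) = norm (?v y)" by (simp add: v T norm_H_block)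
    show "norm (?u y - ?v y) \<le> \<kappa> * norm (?v y)"
      using \<kappa>(2)[OF y, of v] by (simp add: v T norm_H_block flip: matrix_vector_mult_diff_distrib)
  qed
  have en: "energy a b ?u \<le> 589824 * c ^ 6 * (1 + 0\<^sup>2 + b * (2 * \<kappa> / h)\<^sup>2 / a) * energy a b ?v"
  proof (rule energy_comparison[OF U_S_h3 U_S_h3 ab])
    fix K S y y' assume K: "K \<in> \<T>" and S: "\<And>y. y \<in> vert K \<Longrightarrow> norm (?v y) \<le> S" and y: "y \<in> vert K" "y' \<in> vert K"
    have "y \<in> nodes \<T>" "y' \<in> nodes \<T>" using K y by (auto simp: nodes_eq)
    then have "norm (?u y - ?v y) \<le> \<kappa> * S" "norm (?u y' - ?v y') \<le> \<kappa> * S"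
      using d S y \<kappa>(1) mult_left_mono order_trans by meson+
    then have "norm ((?u y - ?v y) - (?u y' - ?v y')) \<le> \<kappa> * S + \<kappa> * S"
      using norm_triangle_ineq4 add_mono order_trans by meson
    then show "norm ((?u y - ?v y) - (?u y' - ?v y')) \<le> 2 * \<kappa> / h * h * S + 0 * norm (?v y - ?v y')"
      using h by (simp add: mult_ac)
  qed (use \<kappa>(1) h eq in auto)
  also have "\<dots> \<le> 2359296 * c ^ 6 * (1 + b / (a * h\<^sup>2) * \<kappa>\<^sup>2) * energy a b ?v"
  proof (rule mult_right_mono)
    define Z where "Z = b / (a * h\<^sup>2) * \<kappa>\<^sup>2"
    have "b * (2 * \<kappa> / h)\<^sup>2 / a = 4 * Z"
      by (simp add: Z_def power_divide power_mult_distrib mult_ac)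
    then have "589824 * c ^ 6 * (1 + 0\<^sup>2 + b * (2 * \<kappa> / h)\<^sup>2 / a) = 589824 * c ^ 6 * (1 + 4 * Z)"
      by simp
    also have "\<dots> \<le> 589824 * c ^ 6 * (4 * (1 + Z))"
      by (intro mult_left_mono) auto
    also have "\<dots> = 2359296 * c ^ 6 * (1 + Z)" by (simp add: algebra_simps)
    finally show "589824 * c ^ 6 * (1 + 0\<^sup>2 + b * (2 * \<kappa> / h)\<^sup>2 / a) \<le> 2359296 * c ^ 6 * (1 + b / (a * h\<^sup>2) * \<kappa>\<^sup>2)"
      unfolding Z_def .
    show "0 \<le> energy a b ?v" using ab by (simp add: energy_nonneg)
  qed
  finally show ?thesis .
qed

text \<open>Between nodes of one element each field varies by at most \<open>D * (c * h)\<close> and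
  their difference by at most \<open>\<delta> * (c * h)\<close>. The mixed difference of the frames
  thus supplies the \<open>h\<close> that cancels the inverse estimate. The constant is
  \<open>589824 * 6718464\<close> with \<open>6718464 = 16 * 648^2\<close>, and \<open>c^8\<close>
  is \<open>c^6\<close> times the square of the factor \<open>c\<close> in \<open>p\<close>.\<close>

lemma energy_U_comparison_gamma:
  assumes T: "\<And>v. norm (Tn *v v) = norm v" and x: "x \<in> carrier_vec (2 * N)" and ab: "a > 0" "b \<ge> 0"
    and m: "\<mu> \<in> M_h \<T>" "\<nu> \<in> M_h \<T>" and g: "\<gamma> > 0"
      "\<And>y. y \<in> nodes \<T> \<Longrightarrow> 1 + (Tn *v \<mu> y) $ 3 \<ge> \<gamma>" "\<And>y. y \<in> nodes \<T> \<Longrightarrow> 1 + (Tn *v \<nu> y) $ 3 \<ge> \<gamma>"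
  shows "energy a b (U Tn \<mu> x) \<le> 3962711310336 * c ^ 8 * F_gamma \<Omega> \<gamma> a b \<nu> \<mu> * energy a b (U Tn \<nu> x)"
proof -
  let ?u = "U Tn \<mu> x" and ?v = "U Tn \<nu> x"
  note S = M_h_S_h3[OF m(1)] M_h_S_h3[OF m(2)]
  define \<epsilon> \<delta> D\<mu> D\<nu> where "\<epsilon> = Linf_norm (lebesgue_on \<Omega>) (\<lambda>x. \<nu> x - \<mu> x)"
    and "\<delta> = Linf_norm (lebesgue_on \<Omega>) (\<lambda>x. grad \<nu> x - grad \<mu> x)"
    and "D\<mu> = Linf_norm (lebesgue_on \<Omega>) (grad \<mu>)" and "D\<nu> = Linf_norm (lebesgue_on \<Omega>) (grad \<nu>)"
  have nn: "\<epsilon> \<ge> 0" "\<delta> \<ge> 0" "D\<mu> \<ge> 0" "D\<nu> \<ge> 0"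
    unfolding \<epsilon>_def \<delta>_def D\<mu>_def D\<nu>_def
    using piecewise_Linf_norm_nonneg piecewise_diff piecewise_value[OF S(1)] piecewise_value[OF S(2)]
      piecewise_grad[OF S(1)] piecewise_grad[OF S(2)] by blast+
  have c: "c \<ge> 1" by (rule c_ge_1)
  have unit: "norm (Tn *v \<mu> y) = 1" "norm (Tn *v \<nu> y) = 1" if "y \<in> nodes \<T>" for y
    using m that by (simp_all add: T M_h_def)
  obtain y0 where y0: "y0 \<in> nodes \<T>" using nodes_finite by blast
  have \<gamma>2: "\<gamma> \<le> 2" using g(2)[OF y0] component_bounds(1)[OF unit(1)[OF y0], of 3] by linarith
  have e: "norm (\<mu> y - \<nu> y) \<le> \<epsilon>" if "K \<in> \<T>" "y \<in> K" for K y
    using piecewise_le_Linf_norm[OF piecewise_diff[OF piecewise_value[OF S(2)] piecewise_value[OF S(1)]] that]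
      aff_eq[OF S(1) that] aff_eq[OF S(2) that] by (simp add: \<epsilon>_def norm_minus_commute)
  have gK: "norm (gmat \<mu> K) \<le> D\<mu>" "norm (gmat \<nu> K) \<le> D\<nu>" "norm (gmat \<mu> K - gmat \<nu> K) \<le> \<delta>" if K: "K \<in> \<T>" for K
  proof -
    obtain p where p: "p \<in> K" using element(6)[OF K] by blast
    show "norm (gmat \<mu> K) \<le> D\<mu>" "norm (gmat \<nu> K) \<le> D\<nu>" "norm (gmat \<mu> K - gmat \<nu> K) \<le> \<delta>"
      using piecewise_le_Linf_norm[OF piecewise_grad[OF S(1)] K p] piecewise_le_Linf_norm[OF piecewise_grad[OF S(2)] K p]
        piecewise_le_Linf_norm[OF piecewise_diff[OF piecewise_grad[OF S(2)] piecewise_grad[OF S(1)]] K p]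
      by (simp_all add: D\<mu>_def D\<nu>_def \<delta>_def norm_minus_commute)
  qed
  define D where "D = D\<mu> + D\<nu>"
  \<comment> \<open>These are the two coefficients of the pair estimate for the blocks, with one
    factor \<open>h\<close> taken out of the first.\<close>
  define p q where "p = c * (24 * \<delta> / \<gamma> + 648 * \<epsilon> * D / \<gamma>\<^sup>2)" and "q = 24 * \<epsilon> / \<gamma>"
  have D0: "D \<ge> 0" using nn by (simp add: D_def)
  have pq: "p \<ge> 0" "q \<ge> 0" using nn g(1) c D0 by (auto simp: p_def q_def)
  have eq: "norm (?u y) = norm (?v y)" if y: "y \<in> nodes \<T>" for y
  proof -
    obtain v where v: "\<And>\<nu>. U Tn \<nu> x y = Tn *v (H_block (Tn *v \<nu> y) *v v)" using U_node[OF y x] by blast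
    show "norm (?u y) = norm (?v y)" by (simp add: v T norm_H_block)
  qed
  have en: "energy a b ?u \<le> 589824 * c ^ 6 * (1 + q\<^sup>2 + b * p\<^sup>2 / a) * energy a b ?v"
  proof (rule energy_comparison[OF U_S_h3 U_S_h3 ab pq])
    fix K S' y y' assume K: "K \<in> \<T>" and S': "\<And>y. y \<in> vert K \<Longrightarrow> norm (?v y) \<le> S'" and y: "y \<in> vert K" "y' \<in> vert K"
    have yn: "y \<in> nodes \<T>" "y' \<in> nodes \<T>" using K y by (auto simp: nodes_eq)
    have yK: "y \<in> K" "y' \<in> K" using y vert_subset by blast+
    obtain v where v: "\<And>\<nu>. U Tn \<nu> x y = Tn *v (H_block (Tn *v \<nu> y) *v v)" using U_node[OF yn(1) x] by blast
    obtain v' where v': "\<And>\<nu>. U Tn \<nu> x y' = Tn *v (H_block (Tn *v \<nu> y') *v v')" using U_node[OF yn(2) x] by blast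
    have Td: "norm (Tn *v r - Tn *v s) = norm (r - s)" for r s by (simp add: T flip: matrix_vector_mult_diff_distrib)
    have ch: "0 \<le> c * h" using c h by simp
    have inc: "norm (\<mu> y - \<mu> y') \<le> D * (c * h)" "norm (\<nu> y - \<nu> y') \<le> D * (c * h)"
      using gK(1,2)[OF K] nn by (auto intro!: increment_bound[OF S(1) K yK] increment_bound[OF S(2) K yK] simp: D_def)
    have dinc: "norm ((\<mu> y - \<nu> y) - (\<mu> y' - \<nu> y')) \<le> \<delta> * (c * h)"
      using gK(3)[OF K] gmat_diff[OF S K] by (intro increment_bound[OF S_h3_diff[OF S] K yK]) simp
    have "norm ((Tn *v \<mu> y - Tn *v \<nu> y) - (Tn *v \<mu> y' - Tn *v \<nu> y')) \<le> \<delta> * (c * h)"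
      using dinc unfolding matrix_vector_mult_diff_distrib[symmetric] T .
    moreover have "norm (Tn *v \<mu> y - Tn *v \<nu> y) \<le> \<epsilon>" "norm (Tn *v \<mu> y' - Tn *v \<nu> y') \<le> \<epsilon>"
      "norm (Tn *v \<nu> y - Tn *v \<nu> y') \<le> D * (c * h)" "norm (Tn *v \<mu> y - Tn *v \<mu> y') \<le> D * (c * h)"
      using e[OF K yK(1)] e[OF K yK(2)] inc by (simp_all add: Td)
    ultimately have "norm ((H_block (Tn *v \<mu> y) *v v - H_block (Tn *v \<nu> y) *v v) - (H_block (Tn *v \<mu> y') *v v' - H_block (Tn *v \<nu> y') *v v'))
      \<le> (24 * (\<delta> * (c * h)) / \<gamma> + 648 * \<epsilon> * (D * (c * h)) / \<gamma>\<^sup>2) * norm v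
        + 24 * \<epsilon> / \<gamma> * norm (H_block (Tn *v \<nu> y) *v v - H_block (Tn *v \<nu> y') *v v')"
      by (intro H_block_pair_difference unit yn g)
    also have "24 * (\<delta> * (c * h)) / \<gamma> + 648 * \<epsilon> * (D * (c * h)) / \<gamma>\<^sup>2 = p * h"
      by (simp add: p_def algebra_simps)
    also have "norm (H_block (Tn *v \<nu> y) *v v - H_block (Tn *v \<nu> y') *v v') = norm (?v y - ?v y')"
      by (simp add: v v' Td)
    also have "norm ((H_block (Tn *v \<mu> y) *v v - H_block (Tn *v \<nu> y) *v v) - (H_block (Tn *v \<mu> y') *v v' - H_block (Tn *v \<nu> y') *v v'))
      = norm ((?u y - ?v y) - (?u y' - ?v y'))"
      unfolding v v' matrix_vector_mult_diff_distrib[symmetric] T ..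
    finally have "norm ((?u y - ?v y) - (?u y' - ?v y')) \<le> p * h * norm v + q * norm (?v y - ?v y')"
      by (simp add: q_def)
    moreover have "norm v \<le> S'" using S'[OF y(1)] by (simp add: v T norm_H_block)
    then have "p * h * norm v \<le> p * h * S'" using pq h by (intro mult_left_mono) auto
    ultimately show "norm ((?u y - ?v y) - (?u y' - ?v y')) \<le> p * h * S' + q * norm (?v y - ?v y')" by linarith
  qed (use eq in auto)
  define X Y Z where "X = \<gamma> powi (-2) * \<epsilon>\<^sup>2" and "Y = b / (a * \<gamma>\<^sup>2) * \<delta>\<^sup>2" and "Z = b / (a * \<gamma> ^ 6) * (D\<nu>\<^sup>2 + D\<mu>\<^sup>2) * \<epsilon>\<^sup>2"
  have XYZ: "X \<ge> 0" "Y \<ge> 0" "Z \<ge> 0" using ab g(1) by (auto simp: X_def Y_def Z_def)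
  have q2: "q\<^sup>2 = 576 * X"
    by (simp add: q_def X_def power_int_neg_eq power_divide power_mult_distrib power_inverse divide_inverse mult_ac)
  have sq: "(r + s)\<^sup>2 \<le> 2 * r\<^sup>2 + 2 * s\<^sup>2" for r s :: real
    using zero_le_power2[of "r - s"] by (simp add: power2_sum power2_diff)
  have D2: "D\<^sup>2 \<le> 2 * (D\<nu>\<^sup>2 + D\<mu>\<^sup>2)" using sq[of D\<mu> D\<nu>] by (simp add: D_def)
  \<comment> \<open>The estimate itself yields the inverse fourth power of \<gamma>. Since
    \<open>\<gamma> \<le> 2\<close>, it is at most 4 times the inverse sixth power, which occurs in
    \<open>F_gamma\<close>.\<close>
  have "\<gamma>\<^sup>2 \<le> 2\<^sup>2" using g(1) \<gamma>2 by (intro power_mono) auto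
  then have "\<gamma> ^ 4 * \<gamma>\<^sup>2 \<le> \<gamma> ^ 4 * 4" using g(1) by (intro mult_left_mono) auto
  then have \<gamma>6: "1 / \<gamma> ^ 4 \<le> 4 / \<gamma> ^ 6" using g(1) by (simp add: field_simps flip: power_add)
  have "p\<^sup>2 = c\<^sup>2 * (24 * \<delta> / \<gamma> + 648 * \<epsilon> * D / \<gamma>\<^sup>2)\<^sup>2" by (simp add: p_def power_mult_distrib)
  also have "\<dots> \<le> c\<^sup>2 * (2 * (24 * \<delta> / \<gamma>)\<^sup>2 + 2 * (648 * \<epsilon> * D / \<gamma>\<^sup>2)\<^sup>2)" by (intro mult_left_mono sq) auto
  also have "\<dots> = c\<^sup>2 * (1152 * (\<delta>\<^sup>2 / \<gamma>\<^sup>2) + 839808 * (\<epsilon>\<^sup>2 * D\<^sup>2 * (1 / \<gamma> ^ 4)))"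
    by (simp add: power_divide power_mult_distrib flip: power_mult)
  also have "\<dots> \<le> c\<^sup>2 * (1152 * (\<delta>\<^sup>2 / \<gamma>\<^sup>2) + 839808 * (\<epsilon>\<^sup>2 * (2 * (D\<nu>\<^sup>2 + D\<mu>\<^sup>2)) * (4 / \<gamma> ^ 6)))"
    using D2 \<gamma>6 g(1) by (intro mult_left_mono add_left_mono mult_mono) auto
  finally have p2: "p\<^sup>2 \<le> c\<^sup>2 * (1152 * (\<delta>\<^sup>2 / \<gamma>\<^sup>2) + 839808 * (\<epsilon>\<^sup>2 * (2 * (D\<nu>\<^sup>2 + D\<mu>\<^sup>2)) * (4 / \<gamma> ^ 6)))" .
  have "b / a * p\<^sup>2 \<le> b / a * (c\<^sup>2 * (1152 * (\<delta>\<^sup>2 / \<gamma>\<^sup>2) + 839808 * (\<epsilon>\<^sup>2 * (2 * (D\<nu>\<^sup>2 + D\<mu>\<^sup>2)) * (4 / \<gamma> ^ 6))))"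
    using p2 ab by (intro mult_left_mono) auto
  also have "\<dots> = c\<^sup>2 * (1152 * Y + 6718464 * Z)" by (simp add: Y_def Z_def divide_inverse algebra_simps)
  finally have bp: "b * p\<^sup>2 / a \<le> c\<^sup>2 * (1152 * Y + 6718464 * Z)" by simp
  have c2: "c\<^sup>2 \<ge> 1" using c by (simp add: one_le_power)
  have "1 + q\<^sup>2 + b * p\<^sup>2 / a \<le> c\<^sup>2 * 1 + c\<^sup>2 * (576 * X) + c\<^sup>2 * (1152 * Y + 6718464 * Z)"
    unfolding q2 using bp c2 XYZ mult_right_mono[OF c2, of "576 * X"] by (intro add_mono) auto
  also have "\<dots> = c\<^sup>2 * (1 + 576 * X + (1152 * Y + 6718464 * Z))" by (simp only: distrib_left)
  also have "\<dots> \<le> c\<^sup>2 * (6718464 * (1 + X + Y + Z))" using XYZ by (intro mult_left_mono) auto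
  also have "1 + X + Y + Z = F_gamma \<Omega> \<gamma> a b \<nu> \<mu>"
    by (simp add: F_gamma_def X_def Y_def Z_def \<epsilon>_def \<delta>_def D\<mu>_def D\<nu>_def)
  finally have F: "1 + q\<^sup>2 + b * p\<^sup>2 / a \<le> c\<^sup>2 * (6718464 * F_gamma \<Omega> \<gamma> a b \<nu> \<mu>)" .
  have "energy a b ?v \<ge> 0" using ab by (simp add: energy_nonneg)
  then have "589824 * c ^ 6 * (1 + q\<^sup>2 + b * p\<^sup>2 / a) * energy a b ?v
    \<le> 589824 * c ^ 6 * (c\<^sup>2 * (6718464 * F_gamma \<Omega> \<gamma> a b \<nu> \<mu>)) * energy a b ?v"
    using F by (intro mult_right_mono mult_left_mono) auto
  also have "\<dots> = 3962711310336 * c ^ 8 * F_gamma \<Omega> \<gamma> a b \<nu> \<mu> * energy a b ?v"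
  proof -
    have "c ^ 8 = c ^ 6 * c\<^sup>2" by (simp flip: power_add)
    then show ?thesis by (simp add: mult_ac)
  qed
  finally show ?thesis using en by linarith
qed

text \<open>Coercivity and boundedness are known in the norm of \<open>m\<close>, whereas the
  iteration minimizes in the norm of \<open>\<mu>\<close>. Coercivity is transferred by
  \<open>ge\<close>; boundedness is transferred by \<open>le\<close>, where each of its two norms
  costs a square root of \<open>K * F\<close>.\<close>

lemma gmres_contraction:
  assumes T: "\<And>v. norm (Tn *v v) = norm v" and m: "m \<in> M_h \<T>"
    and w: "w \<in> borel_measurable (lebesgue_on \<Omega>)" "AE x in lebesgue_on \<Omega>. \<bar>w x - \<alpha>P\<bar> \<le> d" "\<And>x. w x \<ge> \<alpha> / 2"
    and d: "d \<ge> 0" and \<alpha>: "0 < \<alpha>" "\<alpha> \<le> \<alpha>P" and bk: "bk \<ge> 0" and F: "F \<ge> 1" and K: "K \<ge> 1"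
    and le: "\<And>x. x \<in> carrier_vec (2 * N) \<Longrightarrow> energy \<alpha>P bk (U Tn m x) \<le> K * F * energy \<alpha>P bk (U Tn \<mu> x)"
    and ge: "\<And>x. x \<in> carrier_vec (2 * N) \<Longrightarrow> energy \<alpha>P bk (U Tn \<mu> x) \<le> K * F * energy \<alpha>P bk (U Tn m x)"
    and b: "b \<in> carrier_vec (2 * N)" and x0: "x0 \<in> carrier_vec (2 * N)"
    and P: "P = mat_inv (G_Q Tn \<alpha>P bk \<mu>)" and A: "A = A_Q \<Omega> N z \<phi> Tn \<alpha> w bk m" and gmres: "gmres_iterates P A b x0 x"
  shows "prec_norm P (prec_residual P A b (x l))
    \<le> contraction (4 * K ^ 4) \<alpha> \<alpha>P d F powr (real l / 2) * prec_norm P (prec_residual P A b (x 0))"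
proof -
  have \<alpha>P: "\<alpha>P > 0" using \<alpha> by linarith
  have KF: "K * F > 0" using K F by simp
  define g where "g = 1 + 1 / \<alpha>P + d / \<alpha>P"
  have g: "g \<ge> 1" using \<alpha>P d by (simp add: g_def)
  have G: "x \<bullet> (G_Q Tn \<alpha>P bk \<mu> *\<^sub>v x) = energy \<alpha>P bk (U Tn \<mu> x)" if "x \<in> carrier_vec (2 * N)" for x
    using preconditioner_form[OF that that] by (simp add: energy_def U_def)
  have nn: "energy \<alpha>P bk v \<ge> 0" for v using \<alpha>P bk by (simp add: energy_nonneg)
  have wB: "AE x in lebesgue_on \<Omega>. \<bar>w x\<bar> \<le> \<alpha>P + d" using w(2) by eventually_elim (use \<alpha> in linarith)
  show ?thesis unfolding P A
  proof (rule gmres_residual_bound[where ?c1.0 = "\<alpha> / (2 * \<alpha>P) / (K * F)" and ?c2.0 = "g * (K * F)",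
      OF G_Q_carrier _ b x0 _ _ _ _ _ _ _ _ gmres[unfolded P A]])
    show "A_Q \<Omega> N z \<phi> Tn \<alpha> w bk m \<in> carrier_mat (2 * N) (2 * N)"
      by (rule A_Q_carrier)
    fix x y :: "real Matrix.vec" assume x: "x \<in> carrier_vec (2 * N)" and y: "y \<in> carrier_vec (2 * N)"
    show "x \<bullet> (G_Q Tn \<alpha>P bk \<mu> *\<^sub>v y) = y \<bullet> (G_Q Tn \<alpha>P bk \<mu> *\<^sub>v x)"
      using preconditioner_form[OF x y, of Tn \<alpha>P bk \<mu>] preconditioner_form[OF y x, of Tn \<alpha>P bk \<mu>]
        L2_inner_commute[of \<Omega> "fe (Qm Tn \<mu> *\<^sub>v x)"] L2_inner_commute[of \<Omega> "grad (fe (Qm Tn \<mu> *\<^sub>v x))"] by simp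
    show "y \<bullet> (A_Q \<Omega> N z \<phi> Tn \<alpha> w bk m *\<^sub>v x)
      \<le> (g * (K * F)) * sqrt (x \<bullet> (G_Q Tn \<alpha>P bk \<mu> *\<^sub>v x)) * sqrt (y \<bullet> (G_Q Tn \<alpha>P bk \<mu> *\<^sub>v y))"
    proof -
      have "y \<bullet> (A_Q \<Omega> N z \<phi> Tn \<alpha> w bk m *\<^sub>v x)
        \<le> g * sqrt (energy \<alpha>P bk (U Tn m y)) * sqrt (energy \<alpha>P bk (U Tn m x))"
        unfolding g_def by (rule system_matrix_bounded[OF m w(1,2) d \<alpha> bk x y])
      also have "\<dots> \<le> g * sqrt (K * F * energy \<alpha>P bk (U Tn \<mu> y)) * sqrt (K * F * energy \<alpha>P bk (U Tn \<mu> x))"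
        using le[OF x] le[OF y] g nn KF by (intro mult_mono real_sqrt_le_mono mult_nonneg_nonneg) auto
      also have "\<dots> = (g * (sqrt (K * F) * sqrt (K * F))) * sqrt (energy \<alpha>P bk (U Tn \<mu> x)) * sqrt (energy \<alpha>P bk (U Tn \<mu> y))"
        unfolding real_sqrt_mult[of "K * F"] by (simp only: mult_ac)
      also have "sqrt (K * F) * sqrt (K * F) = K * F" using KF by simp
      finally show ?thesis by (simp only: G[OF x] G[OF y])
    qed
  next
    fix x :: "real Matrix.vec" assume x: "x \<in> carrier_vec (2 * N)"
    show "0 < x \<bullet> (G_Q Tn \<alpha>P bk \<mu> *\<^sub>v x)" if nz: "x \<noteq> 0\<^sub>v (2 * N)"
    proof -
      obtain y where "y \<in> nodes \<T>" "U Tn \<mu> x y \<noteq> 0" using U_nonzero_node[OF T x nz] by blast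
      then show ?thesis unfolding G[OF x] by (intro energy_pos[OF U_S_h3 \<alpha>P bk])
    qed
    have "\<alpha> / (2 * \<alpha>P) / (K * F) * energy \<alpha>P bk (U Tn \<mu> x) \<le> \<alpha> / (2 * \<alpha>P) / (K * F) * (K * F * energy \<alpha>P bk (U Tn m x))"
      using ge[OF x] KF \<alpha> \<alpha>P by (intro mult_left_mono) auto
    also have "\<dots> = \<alpha> / (2 * \<alpha>P) * energy \<alpha>P bk (U Tn m x)" using K F by auto
    also have "\<dots> \<le> x \<bullet> (A_Q \<Omega> N z \<phi> Tn \<alpha> w bk m *\<^sub>v x)"
      by (rule system_matrix_coercive[OF M_h_S_h3[OF m] w(1) wB w(3) \<alpha> bk x])
    finally show "\<alpha> / (2 * \<alpha>P) / (K * F) * (x \<bullet> (G_Q Tn \<alpha>P bk \<mu> *\<^sub>v x)) \<le> x \<bullet> (A_Q \<Omega> N z \<phi> Tn \<alpha> w bk m *\<^sub>v x)"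
      by (simp only: G[OF x])
  next
    show "0 < \<alpha> / (2 * \<alpha>P) / (K * F)" "0 < g * (K * F)" using KF \<alpha> \<alpha>P g by auto
    show "1 - (\<alpha> / (2 * \<alpha>P) / (K * F) / (g * (K * F)))\<^sup>2 \<le> contraction (4 * K ^ 4) \<alpha> \<alpha>P d F"
      unfolding g_def using contraction_eq[OF \<alpha> d, of F K] F K by simp
    have "1 \<le> K ^ 4" using K by (rule one_le_power)
    then show "0 < contraction (4 * K ^ 4) \<alpha> \<alpha>P d F" using \<alpha> d F by (intro contraction_gap) auto
  qed
qed

end

section \<open>Properties of the two factors\<close>

lemma F_gamma_ge_1:
  assumes "\<alpha>P > 0" "bk \<ge> 0"
  shows "F_gamma \<Omega> \<gamma> \<alpha>P bk m \<mu> \<ge> 1"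
proof -
  have "\<gamma> powi (-2) \<ge> 0" by (simp add: power_int_minus)
  then show ?thesis using assms by (simp add: F_gamma_def)
qed

text \<open>Symmetry in the two fields lets a one-sided energy comparison serve in both directions
  with the same factor.\<close>

lemma F_gamma_commute: "F_gamma \<Omega> \<gamma> \<alpha>P bk m \<mu> = F_gamma \<Omega> \<gamma> \<alpha>P bk \<mu> m"
  unfolding F_gamma_def Linf_norm_diff_commute[of _ m \<mu>] Linf_norm_diff_commute[of _ "grad m" "grad \<mu>"]
  by (simp add: add.commute)

context fe_mesh
begin

text \<open>The factor contains a maximum of squares; \<kappa> is its square root, a uniform
  operator bound for the difference of the frames at all nodes.\<close>

lemma F_nodal_bound:
  assumes "\<alpha>P > 0" "bk \<ge> 0"
  obtains \<kappa> where "\<kappa> \<ge> 0" "F_nodal \<T> h Tn \<alpha>P bk m \<mu> = 1 + bk / (\<alpha>P * h\<^sup>2) * \<kappa>\<^sup>2"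
    "\<And>y v. y \<in> nodes \<T> \<Longrightarrow> norm (H_block (Tn *v m y) *v v - H_block (Tn *v \<mu> y) *v v) \<le> \<kappa> * norm v"
proof -
  define o' where "o' = (\<lambda>y. onorm ((*v) (H_block (Tn *v m y) - H_block (Tn *v \<mu> y))))"
  define Q where "Q = (MAX y\<in>nodes \<T>. (o' y)\<^sup>2)"
  have Q: "(o' y)\<^sup>2 \<le> Q" if "y \<in> nodes \<T>" for y using nodes_finite that by (simp add: Q_def)
  then have Q0: "Q \<ge> 0" using nodes_finite by (meson ex_in_conv order_trans zero_le_power2)
  show ?thesis
  proof (rule that[of "sqrt Q"])
    show "F_nodal \<T> h Tn \<alpha>P bk m \<mu> = 1 + bk / (\<alpha>P * h\<^sup>2) * (sqrt Q)\<^sup>2"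
      using Q0 by (simp add: F_nodal_def Q_def o'_def)
    fix y v assume y: "y \<in> nodes \<T>"
    have "norm ((H_block (Tn *v m y) - H_block (Tn *v \<mu> y)) *v v) \<le> o' y * norm v"
      unfolding o'_def by (rule onorm[OF matrix_vector_mul_bounded_linear])
    also have "\<dots> \<le> sqrt Q * norm v" using Q[OF y] by (intro mult_right_mono real_le_rsqrt) auto
    finally show "norm (H_block (Tn *v m y) *v v - H_block (Tn *v \<mu> y) *v v) \<le> sqrt Q * norm v"
      by (simp add: matrix_vector_mult_diff_rdistrib)
  qed (use Q0 in simp)
qed

end

theorem theorem5:
  fixes C_mesh :: real
  shows "\<exists>C1>1. \<exists>C2>1.
    \<forall>(\<Omega> :: R3 set) (\<T> :: R3 set set) (h :: real)
     (N :: nat) (z :: nat \<Rightarrow> R3) (\<phi> :: nat \<Rightarrow> R3 \<Rightarrow> real)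
     (\<alpha> :: real) (l_ex :: real) (T :: real) (M :: nat) (n :: nat) (k :: real)
     (\<pi> :: (R3 \<Rightarrow> R3) \<Rightarrow> R3 \<Rightarrow> R3) (f :: real \<Rightarrow> R3 \<Rightarrow> R3)
     (\<beta> :: real \<Rightarrow> real) (W :: real \<Rightarrow> real \<Rightarrow> real)
     (Lh :: (R3 \<Rightarrow> R3) \<Rightarrow> (R3 \<Rightarrow> R3) \<Rightarrow> R3 \<Rightarrow> R3)
     (m :: R3 \<Rightarrow> R3) (m_prev :: R3 \<Rightarrow> R3) (\<mu> :: R3 \<Rightarrow> R3)
     (Tn :: real^3^3) (\<alpha>P :: real)
     (w :: R3 \<Rightarrow> real) (P :: real mat) (A :: real mat) (b :: real Matrix.vec)
     (x0 :: real Matrix.vec) (x :: nat \<Rightarrow> real Matrix.vec) (r :: nat \<Rightarrow> real Matrix.vec).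
      bounded_lipschitz_domain \<Omega> \<and> tetrahedral_mesh \<Omega> \<T> \<and> h > 0 \<and> quasi_uniform C_mesh h \<T> \<and>
      hat_functions \<T> N z \<phi> \<and>
      0 < \<alpha> \<and> \<alpha> \<le> 1 \<and> l_ex > 0 \<and> T > 0 \<and> n < M \<and> k = T / real M \<and>
      bounded_H1_L2 \<Omega> \<pi> \<and> C1_L2 \<Omega> T f \<and>
      (\<forall>\<kappa>>0. \<beta> \<kappa> > 0) \<and> ((\<lambda>\<kappa>. \<beta> \<kappa> * \<kappa>) \<longlongrightarrow> 0) (at_right 0) \<and>
      (\<forall>\<kappa>>0. W \<kappa> \<in> borel_measurable borel \<and> bounded (range (W \<kappa>)) \<and> (\<forall>s. W \<kappa> s > 0)) \<and>
      ((\<lambda>\<kappa>. Linf_norm lborel (\<lambda>s. W \<kappa> s - \<alpha>)) \<longlongrightarrow> 0) (at_right 0) \<and>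
      (\<forall>\<kappa>>0. \<forall>s. W \<kappa> s \<ge> \<alpha> / 2) \<and>
      m \<in> M_h \<T> \<and> m_prev \<in> M_h \<T> \<and> \<mu> \<in> M_h \<T> \<and> L2_fun \<Omega> (Lh m m_prev) \<and>
      invertible Tn \<and> matrix_inv Tn = Tn \<and> transpose Tn = Tn \<and>
      \<alpha>P > 0 \<and> \<alpha>P \<ge> \<alpha> \<and>
      w = (\<lambda>y. W k (lambda_h l_ex (f (k * real n)) \<pi> m y)) \<and>
      A = A_Q \<Omega> N z \<phi> Tn \<alpha> w (\<beta> k * k) m \<and>
      b = b_Q \<Omega> N z \<phi> Tn l_ex (Lh m m_prev) m \<and>
      P = P_Q \<Omega> N z \<phi> Tn \<alpha>P (\<beta> k * k) \<mu> \<and>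
      x0 \<in> carrier_vec (2 * N) \<and> gmres_iterates P A b x0 x \<and>
      r = (\<lambda>l. prec_residual P A b (x l))
      \<longrightarrow>
      (let d = Linf_norm (lebesgue_on \<Omega>) (\<lambda>y. w y - \<alpha>P);
           F = F_nodal \<T> h Tn \<alpha>P (\<beta> k * k) m \<mu>
       in F \<ge> 1 \<and>
          (\<forall>l. prec_norm P (r l)
             \<le> contraction C1 \<alpha> \<alpha>P d F powr (real l / 2) * prec_norm P (r 0))) \<and>
      (\<forall>\<gamma>>0. (\<forall>y\<in>nodes \<T>. 1 + (Tn *v m y) $ 3 \<ge> \<gamma> \<and> 1 + (Tn *v \<mu> y) $ 3 \<ge> \<gamma>) \<longrightarrow>
         (let d = Linf_norm (lebesgue_on \<Omega>) (\<lambda>y. w y - \<alpha>P);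
              F = F_gamma \<Omega> \<gamma> \<alpha>P (\<beta> k * k) m \<mu>
          in F \<ge> 1 \<and>
             (\<forall>l. prec_norm P (r l)
                \<le> contraction C2 \<alpha> \<alpha>P d F powr (real l / 2) * prec_norm P (r 0))))"
proof -
  \<comment> \<open>The constants are fixed before any mesh is given. Even powers are nonnegative
    for every real \<open>C_mesh\<close>, so the added 1 guarantees values of at least 1.\<close>
  define K1 K2 where "K1 = 1 + 2359296 * C_mesh ^ 6" and "K2 = 1 + 3962711310336 * C_mesh ^ 8"
  have K: "K1 \<ge> 1" "K2 \<ge> 1" "2359296 * C_mesh ^ 6 \<le> K1" "3962711310336 * C_mesh ^ 8 \<le> K2"
    by (simp_all add: K1_def K2_def)
  have C: "4 * K1 ^ 4 > 1" "4 * K2 ^ 4 > 1" using one_le_power[OF K(1), of 4] one_le_power[OF K(2), of 4] by linarith+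
  show ?thesis
  proof (rule exI[of _ "4 * K1 ^ 4"], rule conjI[OF C(1)], rule exI[of _ "4 * K2 ^ 4"], rule conjI[OF C(2)],
      intro allI impI, elim conjE)
    fix \<Omega> :: "R3 set" and \<T> :: "R3 set set" and h :: real and N :: nat and z :: "nat \<Rightarrow> R3" and \<phi> :: "nat \<Rightarrow> R3 \<Rightarrow> real"
      and \<alpha> l_ex T :: real and M n :: nat and k :: real and \<pi> :: "(R3 \<Rightarrow> R3) \<Rightarrow> R3 \<Rightarrow> R3" and f :: "real \<Rightarrow> R3 \<Rightarrow> R3"
      and \<beta> :: "real \<Rightarrow> real" and W :: "real \<Rightarrow> real \<Rightarrow> real" and Lh :: "(R3 \<Rightarrow> R3) \<Rightarrow> (R3 \<Rightarrow> R3) \<Rightarrow> R3 \<Rightarrow> R3"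
      and m m_prev \<mu> :: "R3 \<Rightarrow> R3" and Tn :: "real^3^3" and \<alpha>P :: real and w :: "R3 \<Rightarrow> real" and P A :: "real mat"
      and b x0 :: "real Matrix.vec" and x r :: "nat \<Rightarrow> real Matrix.vec"
    assume mesh: "bounded_lipschitz_domain \<Omega>" "tetrahedral_mesh \<Omega> \<T>" "h > 0" "quasi_uniform C_mesh h \<T>"
      "hat_functions \<T> N z \<phi>"
      and \<alpha>: "0 < \<alpha>" and T: "T > 0" "n < M" "k = T / real M"
      and \<pi>: "bounded_H1_L2 \<Omega> \<pi>" and f: "C1_L2 \<Omega> T f" and \<beta>: "\<forall>\<kappa>>0. \<beta> \<kappa> > 0"
      and W: "\<forall>\<kappa>>0. W \<kappa> \<in> borel_measurable borel \<and> bounded (range (W \<kappa>)) \<and> (\<forall>s. W \<kappa> s > 0)"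
        "\<forall>\<kappa>>0. \<forall>s. W \<kappa> s \<ge> \<alpha> / 2"
      and m: "m \<in> M_h \<T>" "\<mu> \<in> M_h \<T>" and Tn: "invertible Tn" "matrix_inv Tn = Tn" "transpose Tn = Tn"
      and \<alpha>P: "\<alpha>P > 0" "\<alpha>P \<ge> \<alpha>" and w: "w = (\<lambda>y. W k (lambda_h l_ex (f (k * real n)) \<pi> m y))"
      and A: "A = A_Q \<Omega> N z \<phi> Tn \<alpha> w (\<beta> k * k) m" and b: "b = b_Q \<Omega> N z \<phi> Tn l_ex (Lh m m_prev) m"
      and P: "P = P_Q \<Omega> N z \<phi> Tn \<alpha>P (\<beta> k * k) \<mu>"
      and x0: "x0 \<in> carrier_vec (2 * N)" and gmres: "gmres_iterates P A b x0 x" and r: "r = (\<lambda>l. prec_residual P A b (x l))"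
    interpret fe_basis \<Omega> \<T> h C_mesh N z \<phi>
      using mesh by unfold_locales
    have k: "k > 0" using T by simp
    define bk where "bk = \<beta> k * k"
    have bk: "bk \<ge> 0" using \<beta> k by (simp add: bk_def less_imp_le)
    \<comment> \<open>\<open>C1_L2\<close> provides square integrability of \<open>f\<close> on
      \<open>{0..T}\<close>, so the time point has to be placed there.\<close>
    have "k * real n \<le> k * real M" using k T(2) by (intro mult_left_mono) auto
    then have "k * real n \<in> {0..T}" using k T by simp
    then have "L2_fun \<Omega> (f (k * real n))" using f by (auto simp: C1_L2_def)
    then have w_meas: "w \<in> borel_measurable (lebesgue_on \<Omega>)"
      unfolding w using W(1) k by (intro weight_measurable[OF M_h_S_h3[OF m(1)] \<pi>]) auto
    have w_low: "w y \<ge> \<alpha> / 2" for y using W(2) k by (simp add: w)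
    have "bounded (range (W k))" using W(1) k by blast
    then obtain B where B: "\<And>s. \<bar>W k s\<bar> \<le> B" by (auto simp: bounded_iff)
    define d where "d = Linf_norm (lebesgue_on \<Omega>) (\<lambda>y. w y - \<alpha>P)"
    \<comment> \<open>A bound for the weight makes \<open>d\<close> a genuine essential supremum and
      not the default 0 of an infinite one.\<close>
    have "\<bar>w y - \<alpha>P\<bar> \<le> B + \<alpha>P" for y
      using B[of "lambda_h l_ex (f (k * real n)) \<pi> m y"] \<alpha>P by (simp add: w)
    then have wd: "AE y in lebesgue_on \<Omega>. norm (w y - \<alpha>P) \<le> B + \<alpha>P" by simp
    have d: "d \<ge> 0" "AE y in lebesgue_on \<Omega>. \<bar>w y - \<alpha>P\<bar> \<le> d"
      using Linf_norm_props[OF borel_measurable_diff[OF w_meas borel_measurable_const] wd domain_nonnull] by (simp_all add: d_def)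
    have iso: "norm (Tn *v v) = norm v" for v using norm_symmetric_involution[OF Tn] .
    have P': "P = mat_inv (G_Q Tn \<alpha>P bk \<mu>)" by (simp add: P P_Q_def G_Q_def bk_def)
    have bc: "b \<in> carrier_vec (2 * N)"
      unfolding b b_Q_def using Q_carrier[of Tn m] by (intro mult_mat_vec_carrier[of _ _ "3 * N"]) (auto simp: b_vector_def)
    have nn: "energy \<alpha>P bk v \<ge> 0" for v using \<alpha>P bk by (simp add: energy_nonneg)
    \<comment> \<open>\<open>K'\<close> is the constant delivered by an energy comparison and
      \<open>K\<close> its enlargement to at least 1, as the contraction estimate demands.\<close>
    have main: "prec_norm P (r l) \<le> contraction (4 * K ^ 4) \<alpha> \<alpha>P d F powr (real l / 2) * prec_norm P (r 0)"
      if K: "K \<ge> 1" "K' \<le> K" and F: "F \<ge> 1"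
        and le: "\<And>x. x \<in> carrier_vec (2 * N) \<Longrightarrow> energy \<alpha>P bk (U Tn m x) \<le> K' * F * energy \<alpha>P bk (U Tn \<mu> x)"
        and ge: "\<And>x. x \<in> carrier_vec (2 * N) \<Longrightarrow> energy \<alpha>P bk (U Tn \<mu> x) \<le> K' * F * energy \<alpha>P bk (U Tn m x)" for F K K' l
    proof -
      have up: "K' * F * energy \<alpha>P bk v \<le> K * F * energy \<alpha>P bk v" for v
        using K F nn by (intro mult_right_mono) auto
      show ?thesis unfolding r
        by (rule gmres_contraction[OF iso m(1) w_meas d(2) w_low d(1) \<alpha> \<alpha>P(2) bk F K(1)
          order_trans[OF le up] order_trans[OF ge up] bc x0 P' A[folded bk_def] gmres])
    qed
    have part1: "F_nodal \<T> h Tn \<alpha>P bk m \<mu> \<ge> 1 \<and> (\<forall>l. prec_norm P (r l)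
        \<le> contraction (4 * K1 ^ 4) \<alpha> \<alpha>P d (F_nodal \<T> h Tn \<alpha>P bk m \<mu>) powr (real l / 2) * prec_norm P (r 0))"
    proof -
      obtain \<kappa> where \<kappa>: "\<kappa> \<ge> 0" "F_nodal \<T> h Tn \<alpha>P bk m \<mu> = 1 + bk / (\<alpha>P * h\<^sup>2) * \<kappa>\<^sup>2"
        "\<And>y v. y \<in> nodes \<T> \<Longrightarrow> norm (H_block (Tn *v m y) *v v - H_block (Tn *v \<mu> y) *v v) \<le> \<kappa> * norm v"
        using F_nodal_bound[OF \<alpha>P(1) bk] by metis
      have \<kappa>': "norm (H_block (Tn *v \<mu> y) *v v - H_block (Tn *v m y) *v v) \<le> \<kappa> * norm v" if "y \<in> nodes \<T>" for y v
        using \<kappa>(3)[OF that, of v] by (simp add: norm_minus_commute)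
      have F: "F_nodal \<T> h Tn \<alpha>P bk m \<mu> \<ge> 1" using \<kappa>(2) \<alpha>P bk by simp
      have le: "energy \<alpha>P bk (U Tn m x) \<le> 2359296 * C_mesh ^ 6 * F_nodal \<T> h Tn \<alpha>P bk m \<mu> * energy \<alpha>P bk (U Tn \<mu> x)"
        if "x \<in> carrier_vec (2 * N)" for x
        unfolding \<kappa>(2) by (rule energy_U_comparison_nodal[OF iso that \<alpha>P(1) bk \<kappa>(1)]) (rule \<kappa>(3))
      have ge: "energy \<alpha>P bk (U Tn \<mu> x) \<le> 2359296 * C_mesh ^ 6 * F_nodal \<T> h Tn \<alpha>P bk m \<mu> * energy \<alpha>P bk (U Tn m x)"
        if "x \<in> carrier_vec (2 * N)" for x
        unfolding \<kappa>(2) by (rule energy_U_comparison_nodal[OF iso that \<alpha>P(1) bk \<kappa>(1)]) (rule \<kappa>')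
      show ?thesis using F main[OF K(1,3) F le ge] by blast
    qed
    have part2: "F_gamma \<Omega> \<gamma> \<alpha>P bk m \<mu> \<ge> 1 \<and> (\<forall>l. prec_norm P (r l)
        \<le> contraction (4 * K2 ^ 4) \<alpha> \<alpha>P d (F_gamma \<Omega> \<gamma> \<alpha>P bk m \<mu>) powr (real l / 2) * prec_norm P (r 0))"
      if \<gamma>: "\<gamma> > 0" "\<forall>y\<in>nodes \<T>. 1 + (Tn *v m y) $ 3 \<ge> \<gamma> \<and> 1 + (Tn *v \<mu> y) $ 3 \<ge> \<gamma>" for \<gamma>
    proof -
      have g: "\<And>y. y \<in> nodes \<T> \<Longrightarrow> 1 + (Tn *v m y) $ 3 \<ge> \<gamma>" "\<And>y. y \<in> nodes \<T> \<Longrightarrow> 1 + (Tn *v \<mu> y) $ 3 \<ge> \<gamma>"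
        using \<gamma>(2) by blast+
      have F: "F_gamma \<Omega> \<gamma> \<alpha>P bk m \<mu> \<ge> 1" using \<alpha>P(1) bk by (rule F_gamma_ge_1)
      have le: "energy \<alpha>P bk (U Tn m x) \<le> 3962711310336 * C_mesh ^ 8 * F_gamma \<Omega> \<gamma> \<alpha>P bk m \<mu> * energy \<alpha>P bk (U Tn \<mu> x)"
        and ge: "energy \<alpha>P bk (U Tn \<mu> x) \<le> 3962711310336 * C_mesh ^ 8 * F_gamma \<Omega> \<gamma> \<alpha>P bk m \<mu> * energy \<alpha>P bk (U Tn m x)"
        if "x \<in> carrier_vec (2 * N)" for x
        using energy_U_comparison_gamma[OF iso that \<alpha>P(1) bk m \<gamma>(1) g]
          energy_U_comparison_gamma[OF iso that \<alpha>P(1) bk m(2,1) \<gamma>(1) g(2,1)]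
        unfolding F_gamma_commute[of \<Omega> \<gamma> \<alpha>P bk \<mu> m] by blast+
      show ?thesis using F main[OF K(2,4) F le ge] by blast
    qed
    show "(let d = Linf_norm (lebesgue_on \<Omega>) (\<lambda>y. w y - \<alpha>P); F = F_nodal \<T> h Tn \<alpha>P (\<beta> k * k) m \<mu>
       in F \<ge> 1 \<and> (\<forall>l. prec_norm P (r l) \<le> contraction (4 * K1 ^ 4) \<alpha> \<alpha>P d F powr (real l / 2) * prec_norm P (r 0))) \<and>
      (\<forall>\<gamma>>0. (\<forall>y\<in>nodes \<T>. 1 + (Tn *v m y) $ 3 \<ge> \<gamma> \<and> 1 + (Tn *v \<mu> y) $ 3 \<ge> \<gamma>) \<longrightarrow>
         (let d = Linf_norm (lebesgue_on \<Omega>) (\<lambda>y. w y - \<alpha>P); F = F_gamma \<Omega> \<gamma> \<alpha>P (\<beta> k * k) m \<mu>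
          in F \<ge> 1 \<and> (\<forall>l. prec_norm P (r l) \<le> contraction (4 * K2 ^ 4) \<alpha> \<alpha>P d F powr (real l / 2) * prec_norm P (r 0))))"
      unfolding Let_def d_def[symmetric] bk_def[symmetric] using part1 part2 by blast
  qed
qed

end
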